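(* Let $f$, $\mathcal S$, $y_*$, $H_\epsilon$, $H_0$, $\Delta f$, $f_\epsilon$, $\varphi$, $w$, $\kappa$ be as in the context. Assume: (a) $f$ satisfies (f1)--(f3); (b) the interpolation kernel $\varphi$ satisfies (IK1), (IK2) and, in addition, its Fourier transform $\tilde\varphi(\lambda)=\int\varphi(x)e^{i\lambda x}dx$ satisfies $\tilde\varphi(\lambda)=O(|\lambda|^{-3})$ as $\lambda\to\infty$; (c) $H_\epsilon$ satisfies (H1) and (H2); (d) $w\in C_0^2(\mathbb R)$ and $\int_{\mathbb R} w(p)\,dp=1$. Let $x_0\notin\mathcal S$ be such that no line through $x_0$ which intersects $\mathcal S$ is tangent to $\mathcal S$ (this includes the endpoints of $\mathcal S$, in which case the one-sided tangents to $\mathcal S$ are considered). Suppose the level sets of $H_0$ are well-behaved, i.e. there exist $\rho,L_0>0$ independent of $\hat t$ such that any open interval of any length $L\ge L_0$ contains no more than $\rho L$ points from $H_0^{-1}(\hat t)$ for any $\hat t$. Then the reconstruction $f_\epsilon^{\mathrm{rec}}$ of $f_\epsilon$ from its discrete data satisfies $$f_\epsilon^{\mathrm{rec}}(x)=O\big(\epsilon^{1/2}\ln(1/\epsilon)\big),\qquad \epsilon\to0,$$ uniformly with respect to $x$ in a sufficiently small neighborhood of $x_0$.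
   Context: Notation. For an angle $\alpha$, $\vec\alpha=(\cos\alpha,\sin\alpha)$; for an angle $\theta$, $\vec\Theta=(\cos\theta,\sin\theta)$. $C_0^2(\mathbb R)$ denotes compactly supported functions $h$ with $h''\in L^\infty(\mathbb R)$. The function $f$. $f$ is a compactly supported function on $\mathbb R^2$ and $\mathcal S:=\{x\in\mathbb R^2: f\notin C^2(U)\text{ for any open }U\ni x\}$. (f1) For each $z\in\mathcal S$ there exist a neighborhood $U\ni z$, domains $D_\pm$ and functions $f_\pm\in C^2(\mathbb R^2)$ such that $f=\chi_{D_-}f_-+\chi_{D_+}f_+$ on $U\setminus\mathcal S$ ($\chi_{D_\pm}$ are the characteristic functions of $D_\pm$), $D_-\cap D_+=\varnothing$, $D_-\cup D_+=U\setminus\mathcal S$. (f2) $\mathcal S$ is a $C^4$ curve. (f3) There are finitely many points of $\mathcal S$ where the curvature of $\mathcal S$ equals zero, and these zeroes are of finite order. Parametrization. $\mathcal S$ is parametrized by $[-a,a]\ni\theta\mapsto y_*(\theta)\in\mathcal S$, where $y_*(\theta)$ is the point at which the line $\{x\in\mathbb R^2:(x-y_*(\theta))\cdot\vec\Theta=0\}$ is tangent to $\mathcal S$, and $R(\theta)=\vec\Theta\cdot y_*''(\theta)>0$, $|\theta|\le a$, is the radius of curvature of $\mathcal S$ at $y_*(\theta)$. In (f1), $D_+$ is on the side of $\mathcal S$ to which the normal pointing towards the center of curvature points (the positive side), and $D_-$ is on the other (negative) side. With $f_\pm$ as in (f1), $\Delta f(x):=f_+(x)-f_-(x)$. Perturbation.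 $H_\epsilon(s)$, $s\in\mathbb R$, is a family of functions defined for all sufficiently small $\epsilon>0$ with the properties: (H1) there exists $c$ such that $|\epsilon^{-1}H_\epsilon(s)|\le c$ for all $s\in\mathbb R$ and all sufficiently small $\epsilon>0$; (H2) $\epsilon^{-1}H_\epsilon(\epsilon^{1/2}s)$ is uniformly Hölder continuous with exponent $\gamma$, $0<\gamma\le1$, i.e. $\sup_{s\in\mathbb R,\,h>0,\,\epsilon>0}\dfrac{|H_\epsilon(s+\epsilon^{1/2}h)-H_\epsilon(s)|}{\epsilon h^\gamma}<\infty$. Set $H_0(s):=\epsilon^{-1}H_\epsilon(\epsilon^{1/2}s)$; the dependence of $H_0$ on $\epsilon$ is omitted from the notation. For $x=y_*(\theta)+t\vec\Theta$ define $f_\epsilon(x)=\Delta f(x)$ if $0<t<H_\epsilon(\theta)$, $f_\epsilon(x)=-\Delta f(x)$ if $H_\epsilon(\theta)<t<0$, and $f_\epsilon(x)=0$ in all other cases. Data and reconstruction. $\kappa>0$ is fixed, $p_j=j\epsilon$, $\alpha_k=k\Delta\alpha$, $\Delta\alpha=\kappa\epsilon$ ($j,k\in\mathbb Z$). The data of $f_\epsilon$, with detector aperture function $w$, are $$\hat f_\epsilon(\alpha_k,p_j)=\frac1\epsilon\iint_{\mathbb R^2} w\Big(\frac{p_j-\vec\alpha_k\cdot y}{\epsilon}\Big)f_\epsilon(y)\,dy,$$ and the reconstruction, with interpolation kernel $\varphi$, is (the inner integral being a Hilbert transform, i.e. a principal value integral) $$f_\epsilon^{\mathrm{rec}}(x)=-\frac{\Delta\alpha}{2\pi}\sum_{|\alpha_k|\le\pi/2}\frac1\pi\int_{\mathbb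 R}\frac{\partial_p\sum_j\varphi\big(\frac{p-p_j}{\epsilon}\big)\hat f_\epsilon(\alpha_k,p_j)}{p-\vec\alpha_k\cdot x}\,dp .$$ (IK1) $\varphi$ is even and $\varphi\in C_0^2(\mathbb R)$. (IK2) $\sum_{j\in\mathbb Z}j^m\varphi(u-j)=u^m$ for all $u\in\mathbb R$, $m=0,1$. *)

theory Defs
  imports "HOL-Analysis.Analysis" "HOL-Library.Landau_Symbols"
begin

definition dir :: "real \<Rightarrow> real \<times> real" where
  "dir \<alpha> = (cos \<alpha>, sin \<alpha>)"

definition compact_support :: "('a::topological_space \<Rightarrow> real) \<Rightarrow> bool" where
  "compact_support f \<longleftrightarrow> compact (closure {x. f x \<noteq> 0})"

text \<open>Compactly supported functions on the line whose second derivative, in the sense of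
  distributions, is bounded: \<open>h\<close> is differentiable and its derivative \<open>h1\<close> is an indefinite
  integral of an essentially bounded function \<open>h2\<close>. The second derivative need not exist
  everywhere (think of a quadratic B-spline).\<close>

definition C02 :: "(real \<Rightarrow> real) \<Rightarrow> bool" where
  "C02 h \<longleftrightarrow> compact_support h \<and>
     (\<exists>h1 h2 B. (\<forall>x. (h has_real_derivative h1 x) (at x)) \<and>
        h2 \<in> borel_measurable borel \<and> (AE x in lborel. \<bar>h2 x\<bar> \<le> B) \<and>
        (\<forall>x y. x \<le> y \<longrightarrow> h1 y - h1 x = (LINT u:{x..y}|lborel. h2 u)))"

definition C2_on :: "('a::real_normed_vector \<Rightarrow> real) \<Rightarrow> 'a set \<Rightarrow> bool" where
  "C2_on f U \<longleftrightarrow>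
     (\<exists>(f1 :: 'a \<Rightarrow> 'a \<Rightarrow>\<^sub>L real) (f2 :: 'a \<Rightarrow> 'a \<Rightarrow>\<^sub>L 'a \<Rightarrow>\<^sub>L real).
        (\<forall>x\<in>U. (f has_derivative blinfun_apply (f1 x)) (at x)) \<and>
        (\<forall>x\<in>U. (f1 has_derivative blinfun_apply (f2 x)) (at x)) \<and>
        continuous_on U f2)"

definition singular_set :: "(real \<times> real \<Rightarrow> real) \<Rightarrow> (real \<times> real) set" where
  "singular_set f = {x. \<not> (\<exists>U. open U \<and> x \<in> U \<and> C2_on f U)}"

definition two_sided_on ::
  "(real \<times> real \<Rightarrow> real) \<Rightarrow> (real \<times> real) set \<Rightarrow> (real \<times> real) set \<Rightarrow> (real \<times> real) set
    \<Rightarrow> (real \<times> real \<Rightarrow> real) \<Rightarrow> (real \<times> real \<Rightarrow> real) \<Rightarrow> bool" where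
  "two_sided_on f U Dm Dp fm fp \<longleftrightarrow>
     open U \<and>
     open Dm \<and> connected Dm \<and> Dm \<noteq> {} \<and> open Dp \<and> connected Dp \<and> Dp \<noteq> {} \<and>
     Dm \<inter> Dp = {} \<and> Dm \<union> Dp = U - singular_set f \<and>
     C2_on fm UNIV \<and> C2_on fp UNIV \<and>
     (\<forall>x\<in>U - singular_set f. f x = indicator Dm x * fm x + indicator Dp x * fp x)"

definition piecewise_C2 :: "(real \<times> real \<Rightarrow> real) \<Rightarrow> bool" where
  "piecewise_C2 f \<longleftrightarrow>
     (\<forall>z\<in>singular_set f. \<exists>U Dm Dp fm fp. z \<in> U \<and> two_sided_on f U Dm Dp fm fp)"

text \<open>A regular local \<open>C\<^sup>4\<close> parametrization of a planar set; \<open>g i\<close> is the \<open>i\<close>-th derivative of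
  the parametrization \<open>g 0\<close>. The interval \<open>I\<close> need not be open, so that curves may have
  endpoints.\<close>

definition C4_chart ::
  "(real \<times> real) set \<Rightarrow> (real \<times> real) set \<Rightarrow> real set \<Rightarrow> (nat \<Rightarrow> real \<Rightarrow> real \<times> real) \<Rightarrow> bool" where
  "C4_chart S U I g \<longleftrightarrow>
     open U \<and> is_interval I \<and> interior I \<noteq> {} \<and>
     (\<forall>i<4. \<forall>t\<in>I. (g i has_vector_derivative g (Suc i) t) (at t within I)) \<and>
     continuous_on I (g 4) \<and> (\<forall>t\<in>I. g 1 t \<noteq> 0) \<and>
     (\<exists>h. homeomorphism I (S \<inter> U) (g 0) h)"

definition C4_curve :: "(real \<times> real) set \<Rightarrow> bool" where
  "C4_curve S \<longleftrightarrow> (\<forall>z\<in>S. \<exists>U I g. z \<in> U \<and> C4_chart S U I g)"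

definition curvature :: "(nat \<Rightarrow> real \<Rightarrow> real \<times> real) \<Rightarrow> real \<Rightarrow> real" where
  "curvature g t =
     (fst (g 1 t) * snd (g 2 t) - snd (g 1 t) * fst (g 2 t)) / norm (g 1 t) ^ 3"

text \<open>Since the curvature of a \<open>C\<^sup>4\<close> curve is only twice differentiable, a zero of finite order
  is one at which the curvature is not \<open>O(\<bar>u - t\<bar> ^ n)\<close> for every \<open>n\<close>.\<close>

definition finite_order_flat_points :: "(real \<times> real) set \<Rightarrow> bool" where
  "finite_order_flat_points S \<longleftrightarrow>
     finite {z. \<exists>U I g t. C4_chart S U I g \<and> t \<in> I \<and> g 0 t = z \<and> curvature g t = 0} \<and>
     (\<forall>U I g t. C4_chart S U I g \<and> t \<in> I \<and> curvature g t = 0 \<longrightarrow>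
        (\<exists>n. curvature g \<notin> O[at t within I](\<lambda>u. \<bar>u - t\<bar> ^ n)))"

text \<open>Parametrization of a piece of \<open>S\<close> by the angle of its normal. Differentiating
  \<open>y1 \<theta> \<bullet> dir \<theta> = 0\<close> shows that \<open>dir \<theta> \<bullet> y2 \<theta> > 0\<close> forces \<open>y1 \<theta> \<noteq> 0\<close>; so \<open>y1 \<theta>\<close> spans the
  tangent, the line through \<open>y \<theta>\<close> with normal \<open>dir \<theta>\<close> is the tangent line, and the centre of
  curvature lies in the direction \<open>dir \<theta>\<close>. The piece may be all of \<open>S\<close> (a closed convex curve),
  in which case its endpoints coincide; this is why injectivity is asked only on the two
  half-open intervals.\<close>

definition normal_angle_param ::
  "(real \<times> real) set \<Rightarrow> real \<Rightarrow> (real \<Rightarrow> real \<times> real) \<Rightarrow> bool" where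
  "normal_angle_param S a y \<longleftrightarrow>
     0 < a \<and> y ` {-a..a} \<subseteq> S \<and> inj_on y {-a..<a} \<and> inj_on y {-a<..a} \<and>
     (\<exists>y1 y2. \<forall>\<theta>\<in>{-a..a}.
        (y has_vector_derivative y1 \<theta>) (at \<theta> within {-a..a}) \<and>
        (y1 has_vector_derivative y2 \<theta>) (at \<theta> within {-a..a}) \<and>
        y1 \<theta> \<bullet> dir \<theta> = 0 \<and> dir \<theta> \<bullet> y2 \<theta> > 0)"

definition tangent_line :: "(real \<Rightarrow> real \<times> real) \<Rightarrow> real \<Rightarrow> (real \<times> real) set" where
  "tangent_line y \<theta> = {x. (x - y \<theta>) \<bullet> dir \<theta> = 0}"

text \<open>\<open>Df\<close> is, near every point of the parametrized curve, a difference \<open>fp - fm\<close> of two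
  functions representing \<open>f\<close> on the two sides, where \<open>Dp\<close> is the side to which \<open>dir\<close> points.
  On the curve itself \<open>Df\<close> is thereby determined by \<open>f\<close>; off the curve it depends on the choice
  of \<open>fp\<close> and \<open>fm\<close>.\<close>

definition jump_of ::
  "(real \<times> real \<Rightarrow> real) \<Rightarrow> real \<Rightarrow> (real \<Rightarrow> real \<times> real) \<Rightarrow> (real \<times> real \<Rightarrow> real) \<Rightarrow> bool" where
  "jump_of f a y Df \<longleftrightarrow>
     (\<forall>\<theta>\<in>{-a..a}. \<exists>U Dm Dp fm fp.
        y \<theta> \<in> U \<and> two_sided_on f U Dm Dp fm fp \<and>
        (\<forall>\<theta>'\<in>{-a..a}. y \<theta>' \<in> U \<longrightarrow>
           (\<forall>\<^sub>F t in at_right 0. y \<theta>' + t *\<^sub>R dir \<theta>' \<in> Dp \<and> y \<theta>' - t *\<^sub>R dir \<theta>' \<in> Dm)) \<and>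
        (\<forall>x\<in>U. Df x = fp x - fm x))"

text \<open>In the following, \<open>h\<close> is the perturbation \<open>H\<^sub>\<epsilon>\<close> for a fixed \<open>\<epsilon>\<close>. The coordinates
  \<open>(\<theta>, t)\<close> of a point are unique only near the curve (up to coinciding endpoints of a closed
  curve), hence the two cases can overlap in a nonnegligible set only if \<open>h\<close> is not small.\<close>

definition perturbation ::
  "real \<Rightarrow> (real \<Rightarrow> real \<times> real) \<Rightarrow> (real \<times> real \<Rightarrow> real) \<Rightarrow> (real \<Rightarrow> real)
    \<Rightarrow> real \<times> real \<Rightarrow> real" where
  "perturbation a y Df h x =
     (if \<exists>\<theta>\<in>{-a..a}. \<exists>t. x = y \<theta> + t *\<^sub>R dir \<theta> \<and> 0 < t \<and> t < h \<theta> then Df x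
      else if \<exists>\<theta>\<in>{-a..a}. \<exists>t. x = y \<theta> + t *\<^sub>R dir \<theta> \<and> h \<theta> < t \<and> t < 0 then - Df x
      else 0)"

definition amplitude_bounded :: "(real \<Rightarrow> real \<Rightarrow> real) \<Rightarrow> bool" where
  "amplitude_bounded H \<longleftrightarrow> (\<exists>c. \<forall>\<^sub>F \<epsilon> in at_right 0. \<forall>s. \<bar>H \<epsilon> s / \<epsilon>\<bar> \<le> c)"

definition uniformly_Hoelder :: "real \<Rightarrow> (real \<Rightarrow> real \<Rightarrow> real) \<Rightarrow> bool" where
  "uniformly_Hoelder \<gamma> H \<longleftrightarrow>
     (\<exists>C. \<forall>\<^sub>F \<epsilon> in at_right 0. \<forall>s. \<forall>h>0.
        \<bar>H \<epsilon> (s + sqrt \<epsilon> * h) - H \<epsilon> s\<bar> / (\<epsilon> * h powr \<gamma>) \<le> C)"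

definition rescaled :: "(real \<Rightarrow> real \<Rightarrow> real) \<Rightarrow> real \<Rightarrow> real \<Rightarrow> real" where
  "rescaled H \<epsilon> s = H \<epsilon> (sqrt \<epsilon> * s) / \<epsilon>"

text \<open>The constants are uniform in the level as well as in \<open>\<epsilon>\<close>.\<close>

definition well_behaved_level_sets :: "(real \<Rightarrow> real \<Rightarrow> real) \<Rightarrow> bool" where
  "well_behaved_level_sets H \<longleftrightarrow>
     (\<exists>\<rho>>0. \<exists>L\<^sub>0>0. \<forall>\<^sub>F \<epsilon> in at_right 0. \<forall>\<tau> u L. L\<^sub>0 \<le> L \<longrightarrow>
        finite ({u<..<u + L} \<inter> rescaled H \<epsilon> -` {\<tau>}) \<and>
        real (card ({u<..<u + L} \<inter> rescaled H \<epsilon> -` {\<tau>})) \<le> \<rho> * L)"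

definition interpolation_kernel :: "(real \<Rightarrow> real) \<Rightarrow> bool" where
  "interpolation_kernel \<phi> \<longleftrightarrow>
     (\<forall>u. \<phi> (- u) = \<phi> u) \<and> C02 \<phi> \<and>
     (\<forall>m\<in>{0, 1::nat}. \<forall>u. ((\<lambda>j::int. of_int j ^ m * \<phi> (u - of_int j)) has_sum u ^ m) UNIV)"

definition fourier :: "(real \<Rightarrow> real) \<Rightarrow> real \<Rightarrow> complex" where
  "fourier \<phi> l = (LINT x|lborel. of_real (\<phi> x) * exp (\<i> * of_real (l * x)))"

definition pv_integral :: "(real \<Rightarrow> real) \<Rightarrow> real \<Rightarrow> real" where
  "pv_integral g c = Lim (at_right 0) (\<lambda>\<delta>. LINT p:{p. \<delta> < \<bar>p - c\<bar>}|lborel. g p / (p - c))"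

definition radon_data ::
  "(real \<Rightarrow> real) \<Rightarrow> (real \<times> real \<Rightarrow> real) \<Rightarrow> real \<Rightarrow> real \<Rightarrow> real \<Rightarrow> real" where
  "radon_data w g \<epsilon> \<alpha> p = (1 / \<epsilon>) * (LINT v|lborel. w ((p - dir \<alpha> \<bullet> v) / \<epsilon>) * g v)"

definition interpolated_data ::
  "(real \<Rightarrow> real) \<Rightarrow> (real \<Rightarrow> real) \<Rightarrow> (real \<times> real \<Rightarrow> real) \<Rightarrow> real \<Rightarrow> real \<Rightarrow> real \<Rightarrow> real" where
  "interpolated_data \<phi> w g \<epsilon> \<alpha> p =
     (\<Sum>\<^sub>\<infinity>j::int. \<phi> ((p - of_int j * \<epsilon>) / \<epsilon>) * radon_data w g \<epsilon> \<alpha> (of_int j * \<epsilon>))"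

definition reconstruction ::
  "real \<Rightarrow> (real \<Rightarrow> real) \<Rightarrow> (real \<Rightarrow> real) \<Rightarrow> (real \<times> real \<Rightarrow> real) \<Rightarrow> real \<Rightarrow> real \<times> real \<Rightarrow> real" where
  "reconstruction \<kappa> \<phi> w g \<epsilon> x =
     (let \<Delta>\<alpha> = \<kappa> * \<epsilon> in
      - (\<Delta>\<alpha> / (2 * pi)) *
      (\<Sum>k\<in>{k::int. \<bar>of_int k * \<Delta>\<alpha>\<bar> \<le> pi / 2}.
         (1 / pi) * pv_integral (deriv (interpolated_data \<phi> w g \<epsilon> (of_int k * \<Delta>\<alpha>)))
                      (dir (of_int k * \<Delta>\<alpha>) \<bullet> x)))"

end

theory Submission
  imports Defs
begin

text \<open>
  The reconstruction is an integral of \<open>f\<^sub>\<epsilon>\<close> against \<open>\<Sum>\<^sub>k \<psi>(\<alpha>\<^sub>k \<bullet> x / \<epsilon>, \<alpha>\<^sub>k \<bullet> v / \<epsilon>)\<close>, where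
  \<open>\<psi>(u, v) = \<Sum>\<^sub>j \<eta>(u - j) w(j - v)\<close> and \<open>\<eta>\<close> is the Hilbert transform of \<open>\<phi>'\<close>. Since the translates of
  \<open>\<phi>\<close> sum to one, \<open>\<psi>\<close> has an antiderivative \<open>\<Psi>\<close> in \<open>v\<close> that decays like \<open>1 / (1 + \<bar>u - v\<bar>)\<close>, while
  \<open>\<psi>\<close> itself decays quadratically. In the coordinates \<open>(\<theta>, t)\<close> the region where \<open>f\<^sub>\<epsilon> \<noteq> 0\<close> is, for
  fixed \<open>t\<close>, a union of intervals of \<open>\<theta>\<close> whose \<open>O(1 / sqrt \<epsilon>)\<close> endpoints lie on a level set of \<open>H\<^sub>\<epsilon>\<close>.
  Integrating by parts on each interval gains a factor \<open>\<epsilon>\<close> and leaves boundary terms bounded by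
  \<open>1 / (1 + \<bar>\<alpha>\<^sub>k \<bullet> (x - Y)\<bar> / \<epsilon>)\<close>, whose sum over \<open>k\<close> is \<open>O(ln (1 / \<epsilon>))\<close> because \<open>x\<close> stays away from the
  curve. The integration by parts degenerates where \<open>\<alpha>\<^sub>k \<bullet> Y\<close> is stationary in \<open>\<theta>\<close>; there
  \<open>\<bar>\<alpha>\<^sub>k \<bullet> (x - Y)\<bar>\<close> is bounded below, as \<open>x\<close> lies on no tangent line, and the decay of \<open>\<psi>\<close> suffices.
\<close>

section \<open>The Hilbert transform\<close>

text \<open>Bookkeeping of orders: \<open>f\<^sub>\<epsilon>\<close> lives in a strip of thickness
  O(\<epsilon>). A slice at fixed \<open>t\<close> gives a factor \<epsilon> from the integration by
  parts, times O(1 / sqrt \<epsilon>) endpoints, times one logarithm. The reconstruction carries a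
  prefactor of order 1/\<epsilon>, and the product is sqrt \<epsilon> * ln (1/\<epsilon>).
  Stationary directions are handled without a cutoff. If q and p are the components of x - Y along
  \<open>dir \<alpha>\<close> and \<open>ndir \<alpha>\<close>, then (x - Y) .
  \<open>dir \<theta>\<close> = cos (\<alpha> - \<theta>) q - sin (\<alpha> - \<theta>) p, and the
  left side is bounded away from 0. Dividing by it splits the integrand exactly: the sine part is a
  \<theta>-derivative up to lower order, and in the other part q trades one power of decay of \<psi>
  for a factor \<epsilon>. The sum over the angles has to precede every estimate in \<theta>: a
  single boundary term may be of size 1 at some \<theta>, and only the sum at a fixed point is
  logarithmic. The global obstacle is injectivity of (\<theta>, t) on a tube of fixed width, also
  across the joint of a closed curve, where a corner must first be excluded.\<close>

text \<open>No measurability of \<open>h\<close> is asked for, since a non-integrable function has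
  integral 0. This allows the application to inner integrals of a Fubini decomposition.\<close>

lemma abs_LINT_le:
  fixes h :: "real \<Rightarrow> real"
  assumes "\<And>s. \<bar>h s\<bar> \<le> B * indicator {-R..R} s" "0 \<le> R"
  shows "\<bar>LINT s|lborel. h s\<bar> \<le> 2 * R * B"
proof -
  have i: "integrable lborel (\<lambda>s::real. B * indicator {-R..R} s :: real)"
    by (intro integrable_mult_right integrable_real_indicator) (auto simp: emeasure_lborel_Icc_eq)
  have "\<bar>LINT s|lborel. h s\<bar> \<le> (LINT s|lborel. \<bar>h s\<bar>)"
    by (rule integral_abs_bound)
  also have "\<dots> \<le> (LINT s|lborel. B * indicator {-R..R} s)"
    by (rule integral_mono'[OF i]) (use assms(1) in \<open>auto intro: order_trans[OF abs_ge_zero]\<close>)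
  also have "\<dots> = 2 * R * B"
    using \<open>0 \<le> R\<close> by simp
  finally show ?thesis .
qed

lemma integrable_bounded_support:
  fixes h :: "real \<Rightarrow> real"
  assumes [measurable]: "h \<in> borel_measurable borel"
    and "\<And>s. \<bar>h s\<bar> \<le> B * indicator {-R..R} s"
  shows "integrable lborel h"
proof (rule Bochner_Integration.integrable_bound)
  show "integrable lborel (\<lambda>s::real. B * indicator {-R..R} s :: real)"
    by (intro integrable_mult_right integrable_real_indicator) (auto simp: emeasure_lborel_Icc_eq)
  show "AE s in lborel. norm (h s) \<le> norm (B * indicator {-R..R} s)"
    using assms(2) by (auto intro!: always_eventually intro: order_trans[OF _ abs_ge_self])
qed simp

text \<open>The principal value of the integral of g(p) / (p - x), without a factor 1 / pi,
  symmetrized about \<open>x\<close>. For Lipschitz \<open>g\<close> the integrand is bounded, so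
  this is an ordinary Lebesgue integral.\<close>

definition hilb :: "(real \<Rightarrow> real) \<Rightarrow> real \<Rightarrow> real" where
  "hilb g x = (LINT s|lborel. (g (x + s) - g (x - s)) / s) / 2"

text \<open>The regularity that a \<open>C02\<close> function leaves to its derivative. The
  constants are parameters because the bounds on the Hilbert transform depend on them.\<close>

definition lip_supp :: "real \<Rightarrow> real \<Rightarrow> (real \<Rightarrow> real) \<Rightarrow> bool" where
  "lip_supp L A g \<longleftrightarrow> 0 \<le> L \<and> 0 < A \<and> (\<forall>x y. \<bar>g x - g y\<bar> \<le> L * \<bar>x - y\<bar>)
     \<and> (\<forall>x. A \<le> \<bar>x\<bar> \<longrightarrow> g x = 0)"

lemma lip_suppD:
  assumes "lip_supp L A g"
  shows "0 \<le> L" "0 < A" "\<bar>g x - g y\<bar> \<le> L * \<bar>x - y\<bar>" "A \<le> \<bar>x\<bar> \<Longrightarrow> g x = 0"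
  using assms by (auto simp: lip_supp_def)

lemma lip_supp_continuous:
  assumes "lip_supp L A g" shows "continuous_on S g"
proof -
  have "L-lipschitz_on S g"
    using lip_suppD[OF assms] by (auto simp: lipschitz_on_def dist_real_def)
  then show ?thesis by (rule lipschitz_on_continuous_on)
qed

lemma lip_supp_measurable: "lip_supp L A g \<Longrightarrow> g \<in> borel_measurable borel"
  by (rule borel_measurable_continuous_onI[OF lip_supp_continuous])

lemma lip_supp_bounded:
  assumes "lip_supp L A g" shows "\<bar>g x\<bar> \<le> L * A * indicator {-A..A} x"
proof (cases "A \<le> \<bar>x\<bar>")
  case True then show ?thesis using lip_suppD[OF assms]
    by (auto simp: indicator_def)
next
  case False
  have "\<bar>g x - g A\<bar> \<le> L * \<bar>x - A\<bar>" "\<bar>g x - g (-A)\<bar> \<le> L * \<bar>x - (-A)\<bar>"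
    by (rule lip_suppD(3)[OF assms])+
  moreover have "g A = 0" "g (-A) = 0"
    using lip_suppD(4)[OF assms] lip_suppD(2)[OF assms] by auto
  \<comment> \<open>The nearer of the two zeros \<open>A\<close> and \<open>-A\<close> of
    \<open>g\<close> is at distance at most \<open>A\<close>.\<close>
  moreover have "min \<bar>x - A\<bar> \<bar>x - (-A)\<bar> \<le> A" using False by auto
  ultimately have "\<bar>g x\<bar> \<le> L * A"
    using lip_suppD(1)[OF assms] False
    by (metis abs_minus_commute diff_zero dual_order.trans min_le_iff_disj mult_left_mono)
  moreover have "indicator {-A..A} x = (1::real)" using False by (auto simp: indicator_def abs_if split: if_splits)
  ultimately show ?thesis by simp
qed

text \<open>The Lipschitz constant controls the quotient near \<open>s = 0\<close>; for
  \<open>\<bar>s\<bar> > \<bar>x\<bar> + A\<close> both \<open>x + s\<close> and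
  \<open>x - s\<close> have left the support.\<close>

lemma hilb_integrand_bound:
  assumes "lip_supp L A g"
  shows "\<bar>(g (x + s) - g (x - s)) / s\<bar> \<le> 2 * L * indicator {-(\<bar>x\<bar> + A)..\<bar>x\<bar> + A} s"
proof (cases "s \<in> {-(\<bar>x\<bar> + A)..\<bar>x\<bar> + A}")
  case True
  have "\<bar>g (x + s) - g (x - s)\<bar> \<le> L * \<bar>2 * s\<bar>"
    using lip_suppD(3)[OF assms, of "x+s" "x-s"] by simp
  then show ?thesis using True lip_suppD(1)[OF assms]
    by (cases "s = 0") (auto simp: abs_mult divide_simps mult_ac)
next
  case False
  then have "A \<le> \<bar>x + s\<bar>" "A \<le> \<bar>x - s\<bar>" by (auto simp: abs_if split: if_splits)
  then show ?thesis using False lip_suppD(4)[OF assms] by simp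
qed

lemma hilb_integrand_integrable:
  assumes "lip_supp L A g"
  shows "integrable lborel (\<lambda>s. (g (x + s) - g (x - s)) / s)"
proof -
  note [measurable] = lip_supp_measurable[OF assms]
  show ?thesis
    by (rule integrable_bounded_support[OF _ hilb_integrand_bound[OF assms]]) measurable
qed

text \<open>Averaging the truncated integral with its reflection at \<open>c\<close> removes the singularity.\<close>

lemma pv_hilb:
  assumes g: "lip_supp L A g"
  shows "((\<lambda>\<delta>. LINT p:{p. \<delta> < \<bar>p - c\<bar>}|lborel. g p / (p - c)) \<longlongrightarrow> hilb g c) (at_right 0)"
proof -
  note [measurable] = lip_supp_measurable[OF g]
  define h where "h s = (g (c + s) - g (c - s)) / s" for s
  have [measurable]: "h \<in> borel_measurable borel" unfolding h_def by measurable
  have eq: "(LINT p:{p. \<delta> < \<bar>p - c\<bar>}|lborel. g p / (p - c))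
      = (LINT s|lborel. indicator {s. \<delta> < \<bar>s\<bar>} s * h s) / 2" if "\<delta> > 0" for \<delta>
  proof -
    let ?I = "\<lambda>s::real. indicator {s. \<delta> < \<bar>s\<bar>} s :: real"
    let ?u = "\<lambda>p. indicator {p. \<delta> < \<bar>p - c\<bar>} p *\<^sub>R (g p / (p - c))"
    have u: "integrable lborel ?u"
    proof (rule integrable_bounded_support[where B = "L * A / \<delta>" and R = A])
      fix s
      show "\<bar>?u s\<bar> \<le> L * A / \<delta> * indicator {-A..A} s"
      proof (cases "\<delta> < \<bar>s - c\<bar>")
        case True
        have "\<bar>g s\<bar> / \<bar>s - c\<bar> \<le> (L * A * indicator {-A..A} s) / \<delta>"
          by (rule frac_le) (use lip_supp_bounded[OF g, of s] True \<open>\<delta> > 0\<close> in auto)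
        then show ?thesis using True by simp
      qed (use lip_suppD(1,2)[OF g] \<open>\<delta> > 0\<close> in auto)
    qed measurable
    \<comment> \<open>The substitutions p = c + s and p = c - s. The second one reverses the sign of
      the denominator, so the mean of the two integrands is \<open>h / 2\<close>.\<close>
    have e1: "(LINT p|lborel. ?u p) = (LINT s|lborel. ?I s * (g (c + s) / s))"
      by (subst lborel_integral_real_affine[where c=1 and t=c]) (auto intro!: Bochner_Integration.integral_cong simp: indicator_def)
    have e2: "(LINT p|lborel. ?u p) = (LINT s|lborel. ?I s * (- g (c - s) / s))"
      by (subst lborel_integral_real_affine[where c="-1" and t=c]) (auto intro!: Bochner_Integration.integral_cong simp: indicator_def)
    have i1: "integrable lborel (\<lambda>s. ?I s * (g (c + s) / s))"
      using lborel_integrable_real_affine[OF u, of 1 c] by (simp add: indicator_def cong: if_cong)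
    have i2: "integrable lborel (\<lambda>s. ?I s * (- g (c - s) / s))"
      using lborel_integrable_real_affine[OF u, of "-1" c] by (simp add: indicator_def cong: if_cong)
    have "2 * (LINT p|lborel. ?u p) = (LINT s|lborel. ?I s * (g (c + s) / s) + ?I s * (- g (c - s) / s))"
      using e1 e2 Bochner_Integration.integral_add[OF i1 i2] by simp
    also have "\<dots> = (LINT s|lborel. ?I s * h s)"
      by (intro Bochner_Integration.integral_cong) (auto simp: h_def diff_divide_distrib algebra_simps)
    finally show ?thesis by (simp add: set_lebesgue_integral_def)
  qed
  have lim: "((\<lambda>\<delta>. (LINT s|lborel. indicator {s. \<delta> < \<bar>s\<bar>} s * h s) / 2) \<longlongrightarrow> hilb g c) (at_right 0)"
  proof (rule tendsto_at_right_sequentially[where b = 1])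
    fix S :: "nat \<Rightarrow> real" assume S: "\<And>n. 0 < S n" "S \<longlonglongrightarrow> 0"
    have "(\<lambda>n. LINT s|lborel. indicator {s. S n < \<bar>s\<bar>} s * h s) \<longlonglongrightarrow> (LINT s|lborel. h s)"
    proof (rule integral_dominated_convergence[where w = "\<lambda>s. \<bar>h s\<bar>"])
      show "integrable lborel (\<lambda>s. \<bar>h s\<bar>)"
        unfolding h_def by (intro integrable_abs hilb_integrand_integrable[OF g])
      show "AE s in lborel. (\<lambda>n. indicator {s. S n < \<bar>s\<bar>} s * h s) \<longlonglongrightarrow> h s"
      proof (rule AE_I2)
        fix s
        show "(\<lambda>n. indicator {s. S n < \<bar>s\<bar>} s * h s) \<longlonglongrightarrow> h s"
        proof (cases "s = 0")
          \<comment> \<open>At \<open>s = 0\<close> every truncated integrand is 0, and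
            \<open>h 0 = 0\<close> by the convention for division by zero.\<close>
          case True then show ?thesis by (simp add: h_def)
        next
          case False
          then have "\<forall>\<^sub>F n in sequentially. S n < \<bar>s\<bar>"
            using S(2) by (simp add: order_tendstoD(2))
          then have "\<forall>\<^sub>F n in sequentially. indicator {s. S n < \<bar>s\<bar>} s * h s = h s"
            by eventually_elim auto
          then show ?thesis by (rule tendsto_eventually)
        qed
      qed
    qed (auto simp: indicator_def)
    then show "(\<lambda>n. (LINT s|lborel. indicator {s. S n < \<bar>s\<bar>} s * h s) / 2) \<longlonglongrightarrow> hilb g c"
      unfolding hilb_def h_def by (intro tendsto_divide) auto
  qed auto
  show ?thesis
    by (rule Lim_transform_eventually[OF lim]) (auto simp: eventually_at_right_field eq intro: exI[of _ 1])
qed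

lemma pv_integral_eq_hilb: "lip_supp L A g \<Longrightarrow> pv_integral g c = hilb g c"
  unfolding pv_integral_def by (rule tendsto_Lim[OF _ pv_hilb]) auto

text \<open>The pole \<open>x\<close> is further than \<open>A\<close> from the support, so a
  truncation at \<delta> < A only discards points where \<open>g\<close> vanishes.\<close>

lemma hilb_far:
  assumes g: "lip_supp L A g" and x: "2 * A < \<bar>x\<bar>"
  shows "hilb g x = (LINT p|lborel. g p / (p - x))"
proof (rule tendsto_unique[OF _ pv_hilb[OF g]])
  have "A > 0" using lip_suppD(2)[OF g] .
  have "\<forall>\<^sub>F \<delta> in at_right 0. \<delta> < A"
    using \<open>A > 0\<close> by (auto simp: eventually_at_right_field)
  then have "\<forall>\<^sub>F \<delta> in at_right 0. (LINT p:{p. \<delta> < \<bar>p - x\<bar>}|lborel. g p / (p - x)) = (LINT p|lborel. g p / (p - x))"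
  proof eventually_elim
    case (elim \<delta>)
    have "g p = 0" if "\<not> \<delta> < \<bar>p - x\<bar>" for p
      using that elim x by (intro lip_suppD(4)[OF g]) (auto simp: abs_if split: if_splits)
    then show ?case unfolding set_lebesgue_integral_def
      by (intro Bochner_Integration.integral_cong) (auto simp: indicator_def)
  qed
  then show "((\<lambda>\<delta>. LINT p:{p. \<delta> < \<bar>p - x\<bar>}|lborel. g p / (p - x)) \<longlongrightarrow> (LINT p|lborel. g p / (p - x))) (at_right 0)"
    by (rule tendsto_eventually)
qed auto

lemma hilb_far_integrand_bound:
  assumes g: "lip_supp L A g" and x: "2 * A < \<bar>x\<bar>"
  shows "\<bar>g p / (p - x)\<bar> \<le> L * A * 2 / \<bar>x\<bar> * indicator {-A..A} p"
proof (cases "p \<in> {-A..A}")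
  case True
  have "\<bar>g p\<bar> / \<bar>p - x\<bar> \<le> (L * A) / (\<bar>x\<bar> / 2)"
    using lip_supp_bounded[OF g, of p] True x lip_suppD(1,2)[OF g]
    by (intro frac_le) (auto simp: abs_if split: if_splits)
  then show ?thesis using True by simp
qed (use lip_supp_bounded[OF g, of p] in simp)

lemma hilb_near:
  assumes g: "lip_supp L A g" and x: "\<bar>x\<bar> \<le> 2 * A"
  shows "\<bar>hilb g x\<bar> \<le> 6 * L * A"
proof -
  have "\<bar>LINT s|lborel. (g (x + s) - g (x - s)) / s\<bar> \<le> 2 * (\<bar>x\<bar> + A) * (2 * L)"
    using lip_suppD(2)[OF g] by (intro abs_LINT_le hilb_integrand_bound[OF g]) auto
  also have "\<dots> \<le> 2 * (3 * A) * (2 * L)"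
    using x lip_suppD(1)[OF g] by (intro mult_right_mono) auto
  finally show ?thesis by (simp add: hilb_def mult_ac)
qed

text \<open>Two regimes: for \<open>\<bar>x\<bar> \<le> 2 * A\<close> the integrand bound suffices,
  beyond that 1 / (p - x) is of size 1/|x| on the support. \<open>C\<close> is the sum of the two
  resulting constants.\<close>

lemma hilb_decay:
  assumes g: "lip_supp L A g"
  shows "\<exists>C\<ge>0. \<forall>x. \<bar>hilb g x\<bar> \<le> C / (1 + \<bar>x\<bar>)"
proof -
  have A: "A > 0" and L: "L \<ge> 0" using lip_suppD[OF g] by auto
  define C where "C = 6 * L * A * (1 + 2 * A) + 4 * L * A\<^sup>2 * (1 + 1 / (2 * A))"
  have C: "6 * L * A * (1 + 2 * A) \<le> C" "4 * L * A\<^sup>2 * (1 + 1 / (2 * A)) \<le> C" "0 \<le> C"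
    using A L by (auto simp: C_def intro!: add_nonneg_nonneg)
  have "\<bar>hilb g x\<bar> * (1 + \<bar>x\<bar>) \<le> C" for x
  proof (cases "\<bar>x\<bar> \<le> 2 * A")
    case True
    have "\<bar>hilb g x\<bar> * (1 + \<bar>x\<bar>) \<le> (6 * L * A) * (1 + 2 * A)"
      using hilb_near[OF g True] True A L by (intro mult_mono) auto
    then show ?thesis using C by linarith
  next
    case False
    then have x: "2 * A < \<bar>x\<bar>" by simp
    have "\<bar>LINT p|lborel. g p / (p - x)\<bar> \<le> 2 * A * (L * A * 2 / \<bar>x\<bar>)"
      by (rule abs_LINT_le[OF hilb_far_integrand_bound[OF g x]]) (use A in simp)
    then have "\<bar>hilb g x\<bar> * (1 + \<bar>x\<bar>) \<le> (2 * A * (L * A * 2 / \<bar>x\<bar>)) * (1 + \<bar>x\<bar>)"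
      unfolding hilb_far[OF g x] by (intro mult_right_mono) auto
    also have "\<dots> = 4 * L * A\<^sup>2 * (1 + 1 / \<bar>x\<bar>)"
      using x A by (simp add: field_simps power2_eq_square)
    also have "\<dots> \<le> 4 * L * A\<^sup>2 * (1 + 1 / (2 * A))"
      using x A L by (intro mult_left_mono add_left_mono divide_left_mono) auto
    finally show ?thesis using C by linarith
  qed
  then show ?thesis using C(3) by (intro exI[of _ C]) (auto simp: field_simps)
qed

text \<open>The zero mean allows the integral of g(p) / x to be added for free. The sum g / (p - x)
  + g / x equals (p / x) g / (p - x), and |p| is at most \<open>A\<close> on the support, which
  gains a second factor 1/|x|.\<close>

lemma hilb_decay2:
  assumes g: "lip_supp L A g" and z: "(LINT p|lborel. g p) = 0"
  shows "\<exists>C\<ge>0. \<forall>x. \<bar>hilb g x\<bar> \<le> C / (1 + x\<^sup>2)"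
proof -
  have A: "A > 0" and L: "L \<ge> 0" using lip_suppD[OF g] by auto
  note [measurable] = lip_supp_measurable[OF g]
  define C where "C = 6 * L * A * (1 + (2 * A)\<^sup>2) + 4 * L * A ^ 3 * (1 + 1 / (2 * A)\<^sup>2)"
  have C: "6 * L * A * (1 + (2 * A)\<^sup>2) \<le> C" "4 * L * A ^ 3 * (1 + 1 / (2 * A)\<^sup>2) \<le> C" "0 \<le> C"
    using A L by (auto simp: C_def intro!: add_nonneg_nonneg)
  have "\<bar>hilb g x\<bar> * (1 + x\<^sup>2) \<le> C" for x
  proof (cases "\<bar>x\<bar> \<le> 2 * A")
    case True
    have "x\<^sup>2 \<le> (2 * A)\<^sup>2" using True A by (metis abs_ge_zero power2_abs power_mono)
    then have "\<bar>hilb g x\<bar> * (1 + x\<^sup>2) \<le> (6 * L * A) * (1 + (2 * A)\<^sup>2)"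
      using hilb_near[OF g True] A L by (intro mult_mono) auto
    then show ?thesis using C by linarith
  next
    case False
    then have x: "2 * A < \<bar>x\<bar>" by simp
    have x0: "x \<noteq> 0" using x A by auto
    note b = hilb_far_integrand_bound[OF g x]
    have i1: "integrable lborel (\<lambda>p. g p / (p - x))"
      by (rule integrable_bounded_support[OF _ b]) measurable
    have i2: "integrable lborel g"
      by (rule integrable_bounded_support[OF _ lip_supp_bounded[OF g]]) measurable
    have "(LINT p|lborel. g p / (p - x)) = (LINT p|lborel. g p / (p - x)) + (LINT p|lborel. g p / x)"
      using z by simp
    also have "\<dots> = (LINT p|lborel. g p / (p - x) + g p / x)"
      by (rule Bochner_Integration.integral_add[symmetric]) (use i1 i2 in auto)
    also have "\<dots> = (LINT p|lborel. p / x * (g p / (p - x)))"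
    proof (rule Bochner_Integration.integral_cong[OF refl])
      fix p
      show "g p / (p - x) + g p / x = p / x * (g p / (p - x))"
      proof (cases "p = x")
        case True
        then have "g p = 0" using x A by (intro lip_suppD(4)[OF g]) auto
        then show ?thesis by simp
      qed (use x0 in \<open>simp add: field_simps\<close>)
    qed
    finally have e: "hilb g x = (LINT p|lborel. p / x * (g p / (p - x)))"
      by (simp add: hilb_far[OF g x])
    have "\<bar>hilb g x\<bar> \<le> 2 * A * (A / \<bar>x\<bar> * (L * A * 2 / \<bar>x\<bar>))"
      unfolding e
    proof (rule abs_LINT_le)
      fix p
      show "\<bar>p / x * (g p / (p - x))\<bar> \<le> A / \<bar>x\<bar> * (L * A * 2 / \<bar>x\<bar>) * indicator {-A..A} p"
      proof (cases "p \<in> {-A..A}")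
        case True
        have "\<bar>p / x\<bar> \<le> A / \<bar>x\<bar>" using True by (auto intro!: divide_right_mono)
        then have "\<bar>p / x\<bar> * \<bar>g p / (p - x)\<bar> \<le> A / \<bar>x\<bar> * (L * A * 2 / \<bar>x\<bar>)"
          using b[of p] True A by (intro mult_mono) auto
        then show ?thesis using True by (simp add: abs_mult)
      qed (use lip_supp_bounded[OF g, of p] in simp)
    qed (use A in simp)
    then have "\<bar>hilb g x\<bar> * (1 + x\<^sup>2) \<le> (2 * A * (A / \<bar>x\<bar> * (L * A * 2 / \<bar>x\<bar>))) * (1 + x\<^sup>2)"
      by (intro mult_right_mono) auto
    also have "\<dots> = 4 * L * A ^ 3 * ((1 + x\<^sup>2) / (\<bar>x\<bar> * \<bar>x\<bar>))"
      by (simp add: power2_eq_square power3_eq_cube)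
    also have "(1 + x\<^sup>2) / (\<bar>x\<bar> * \<bar>x\<bar>) = 1 + 1 / x\<^sup>2"
      using x0 by (simp add: field_simps power2_eq_square)
    also have "4 * L * A ^ 3 * (1 + 1 / x\<^sup>2) \<le> 4 * L * A ^ 3 * (1 + 1 / (2 * A)\<^sup>2)"
    proof -
      have "(2 * A)\<^sup>2 \<le> x\<^sup>2" using x A by (metis less_eq_real_def mult_nonneg_nonneg power2_abs power_mono zero_le_numeral)
      then show ?thesis using A L
        by (intro mult_left_mono add_left_mono divide_left_mono) (auto simp: x0)
    qed
    finally show ?thesis using C by linarith
  qed
  moreover have "0 < 1 + x\<^sup>2" for x :: real by (simp add: add_pos_nonneg)
  ultimately show ?thesis using C(3) by (intro exI[of _ C]) (auto simp: pos_le_divide_eq)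
qed

section \<open>Symmetries and linearity of the Hilbert transform\<close>

lemma hilb_translate: "hilb (\<lambda>s. g (s - j)) x = hilb g (x - j)"
  unfolding hilb_def by (simp add: algebra_simps)

text \<open>The measure ds / s is invariant under dilations, so no power of \<open>e\<close>
  appears.\<close>

lemma hilb_scale:
  assumes "0 < (e::real)"
  shows "hilb (\<lambda>p. g (p / e)) x = hilb g (x / e)"
proof -
  have "(LINT s|lborel. (g ((x + s) / e) - g ((x - s) / e)) / s)
      = \<bar>e\<bar> *\<^sub>R (LINT s|lborel. (g ((x + (0 + e * s)) / e) - g ((x - (0 + e * s)) / e)) / (0 + e * s))"
    using assms by (intro lborel_integral_real_affine) auto
  also have "\<dots> = (LINT s|lborel. e * ((g ((x + (0 + e * s)) / e) - g ((x - (0 + e * s)) / e)) / (0 + e * s)))"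
    by (simp only: abs_of_pos[OF assms] real_scaleR_def integral_mult_right_zero)
  also have "\<dots> = (LINT s|lborel. (g (x / e + s) - g (x / e - s)) / s)"
    using assms by (intro Bochner_Integration.integral_cong) (auto simp: add_divide_distrib diff_divide_distrib right_diff_distrib)
  finally show ?thesis by (simp add: hilb_def)
qed

lemma hilb_sum:
  assumes "finite J" "\<And>j. j \<in> J \<Longrightarrow> \<exists>L A. lip_supp L A (G j)"
  shows "hilb (\<lambda>p. \<Sum>j\<in>J. c j * G j p) x = (\<Sum>j\<in>J. c j * hilb (G j) x)"
proof -
  have i: "integrable lborel (\<lambda>s. (G j (x + s) - G j (x - s)) / s)" if "j \<in> J" for j
    using assms(2)[OF that] hilb_integrand_integrable by blast
  have "(LINT s|lborel. ((\<Sum>j\<in>J. c j * G j (x + s)) - (\<Sum>j\<in>J. c j * G j (x - s))) / s)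
     = (LINT s|lborel. (\<Sum>j\<in>J. c j * ((G j (x + s) - G j (x - s)) / s)))"
    by (intro Bochner_Integration.integral_cong)
      (auto simp: sum_divide_distrib right_diff_distrib diff_divide_distrib simp flip: sum_subtractf)
  also have "\<dots> = (\<Sum>j\<in>J. c j * (LINT s|lborel. (G j (x + s) - G j (x - s)) / s))"
    by (subst Bochner_Integration.integral_sum)
      (auto intro!: integrable_mult_right i simp del: times_divide_eq_right)
  finally show ?thesis by (simp add: hilb_def sum_divide_distrib)
qed

section \<open>Interpolation kernels\<close>

lemma C02_derivative:
  assumes "C02 h"
  obtains d L A where "\<And>x. (h has_real_derivative d x) (at x)" "lip_supp L A d"
    "\<And>x. A \<le> \<bar>x\<bar> \<Longrightarrow> h x = 0"
proof -
  obtain d h2 B where d: "\<And>x. (h has_real_derivative d x) (at x)"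
    and [measurable]: "h2 \<in> borel_measurable borel"
    and B: "AE x in lborel. \<bar>h2 x\<bar> \<le> B"
    and i: "\<And>x y. x \<le> y \<Longrightarrow> d y - d x = (LINT u:{x..y}|lborel. h2 u)"
    using assms unfolding C02_def by blast
  have "bounded {x. h x \<noteq> 0}"
    using assms unfolding C02_def compact_support_def
    by (meson bounded_subset closure_subset compact_imp_bounded)
  then obtain b where b: "\<And>x. h x \<noteq> 0 \<Longrightarrow> \<bar>x\<bar> \<le> b"
    unfolding bounded_iff by auto
  \<comment> \<open>The extra 1 makes \<open>h\<close> vanish on a neighbourhood of every point with
    \<open>A \<le> \<bar>x\<bar>\<close>, so that the derivative is 0 there too, the endpoints
    included.\<close>
  define A where "A = max b 0 + 1"
  define L where "L = max B 0"
  have h0: "h x = 0" if "b < \<bar>x\<bar>" for x using b[of x] that by fastforce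
  have d0: "d x = 0" if "A \<le> \<bar>x\<bar>" for x
  proof -
    have "open {z::real. b < \<bar>z\<bar>}" by (intro open_Collect_less continuous_intros)
    then have "(h has_real_derivative 0) (at x)"
      by (rule has_field_derivative_transform_within_open[where f = "\<lambda>_. 0", OF DERIV_const])
        (use that h0 in \<open>auto simp: A_def\<close>)
    then show ?thesis using DERIV_unique d by blast
  qed
  have *: "\<bar>d y - d x\<bar> \<le> L * (y - x)" if "x \<le> y" for x y
  proof -
    let ?g = "\<lambda>u. indicator {x..y} u * h2 u"
    have "\<bar>LINT u|lborel. ?g u\<bar> \<le> L * (y - x)"
    proof (cases "integrable lborel ?g")
      case True
      have "\<bar>LINT u|lborel. ?g u\<bar> \<le> (LINT u|lborel. \<bar>?g u\<bar>)"
        by (rule integral_abs_bound)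
      also have "\<dots> \<le> (LINT u|lborel. L * indicator {x..y} u)"
      proof (rule integral_mono_AE)
        show "AE u in lborel. \<bar>?g u\<bar> \<le> L * indicator {x..y} u"
          using B by eventually_elim (auto simp: L_def indicator_def)
      qed (use True in \<open>auto simp: emeasure_lborel_Icc_eq intro!: integrable_real_indicator\<close>)
      also have "\<dots> = L * (y - x)" using that by simp
      finally show ?thesis .
    \<comment> \<open>Without integrability the integral is 0 by convention and the bound is
      trivial.\<close>
    qed (use that in \<open>simp add: not_integrable_integral_eq L_def\<close>)
    then show ?thesis using i[OF that] by (simp add: set_lebesgue_integral_def)
  qed
  have "\<bar>d x - d y\<bar> \<le> L * \<bar>x - y\<bar>" for x y
    using *[of x y] *[of y x] by (cases "x \<le> y") (auto simp: abs_minus_commute)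
  then have "lip_supp L A d"
    using d0 by (auto simp: lip_supp_def L_def A_def)
  then show ?thesis using d h0 by (intro that[of d L A]) (auto simp: A_def)
qed

lemma hilb_diff:
  assumes "lip_supp L A g" "lip_supp L' A' g'"
  shows "hilb (\<lambda>s. g s - g' s) x = hilb g x - hilb g' x"
proof -
  have "(LINT s|lborel. (g (x + s) - g' (x + s) - (g (x - s) - g' (x - s))) / s)
    = (LINT s|lborel. (g (x + s) - g (x - s)) / s - (g' (x + s) - g' (x - s)) / s)"
    by (intro Bochner_Integration.integral_cong) (auto simp: diff_divide_distrib)
  also have "\<dots> = (LINT s|lborel. (g (x + s) - g (x - s)) / s) - (LINT s|lborel. (g' (x + s) - g' (x - s)) / s)"
    by (intro Bochner_Integration.integral_diff hilb_integrand_integrable[OF assms(1)] hilb_integrand_integrable[OF assms(2)])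
  finally show ?thesis by (simp add: hilb_def diff_divide_distrib)
qed

section \<open>Closure properties of compactly supported Lipschitz functions, and locally finite
  sums\<close>

lemma lip_supp_shift:
  assumes "lip_supp L A g" shows "lip_supp L (A + \<bar>c\<bar>) (\<lambda>s. g (s - c))"
  unfolding lip_supp_def
proof (intro conjI allI impI)
  show "\<bar>g (x - c) - g (y - c)\<bar> \<le> L * \<bar>x - y\<bar>" for x y
    using lip_suppD(3)[OF assms, of "x - c" "y - c"] by simp
  show "g (x - c) = 0" if "A + \<bar>c\<bar> \<le> \<bar>x\<bar>" for x
    using that by (intro lip_suppD(4)[OF assms]) linarith
qed (use lip_suppD[OF assms] in auto)

lemma lip_supp_scale:
  assumes "lip_supp L A g" "0 < e" shows "lip_supp (L / e) (A * e) (\<lambda>s. g (s / e))"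
  unfolding lip_supp_def
proof (intro conjI allI impI)
  show "\<bar>g (x / e) - g (y / e)\<bar> \<le> L / e * \<bar>x - y\<bar>" for x y
    using lip_suppD(3)[OF assms(1), of "x / e" "y / e"] assms(2)
    by (simp flip: diff_divide_distrib)
  show "g (x / e) = 0" if "A * e \<le> \<bar>x\<bar>" for x
    using that assms(2) by (intro lip_suppD(4)[OF assms(1)]) (simp add: field_simps)
qed (use lip_suppD[OF assms(1)] assms(2) in auto)

lemma lip_supp_cmult:
  assumes "lip_supp L A g" shows "lip_supp (\<bar>c\<bar> * L) A (\<lambda>s. c * g s)"
  unfolding lip_supp_def
proof (intro conjI allI impI)
  show "\<bar>c * g x - c * g y\<bar> \<le> \<bar>c\<bar> * L * \<bar>x - y\<bar>" for x y
    using mult_left_mono[OF lip_suppD(3)[OF assms, of x y], of "\<bar>c\<bar>"]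
    by (simp add: mult.assoc flip: abs_mult right_diff_distrib)
qed (use lip_suppD[OF assms] in auto)

lemma lip_supp_add:
  assumes "lip_supp L A g" "lip_supp L' A' g'"
  shows "lip_supp (L + L') (max A A') (\<lambda>s. g s + g' s)"
  unfolding lip_supp_def
proof (intro conjI allI impI)
  show "\<bar>g x + g' x - (g y + g' y)\<bar> \<le> (L + L') * \<bar>x - y\<bar>" for x y
    using lip_suppD(3)[OF assms(1), of x y] lip_suppD(3)[OF assms(2), of x y]
    by (simp add: distrib_right)
qed (use lip_suppD[OF assms(1)] lip_suppD[OF assms(2)] in auto)

lemma lip_supp_sum:
  assumes "finite J" "\<And>j. j \<in> J \<Longrightarrow> \<exists>L A. lip_supp L A (G j)"
  shows "\<exists>L A. lip_supp L A (\<lambda>s. \<Sum>j\<in>J. G j s)"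
  using assms
proof (induction J rule: finite_induct)
  case empty
  have "lip_supp 0 1 (\<lambda>s. 0)" by (simp add: lip_supp_def)
  then show ?case by auto
next
  case (insert j J)
  then obtain L A L1 A1 where "lip_supp L A (G j)" "lip_supp L1 A1 (\<lambda>s. \<Sum>j\<in>J. G j s)"
    by (metis insertCI)
  then show ?case using lip_supp_add insert.hyps by fastforce
qed

lemma infsum_int_finite:
  fixes f :: "int \<Rightarrow> real"
  assumes "finite J" "\<And>j. j \<notin> J \<Longrightarrow> f j = 0"
  shows "(\<Sum>\<^sub>\<infinity>j. f j) = (\<Sum>j\<in>J. f j)"
proof -
  have "infsum f UNIV = infsum f J"
    by (rule infsum_cong_neutral) (use assms in auto)
  then show ?thesis using assms by simp
qed

text \<open>The translates of \<open>d\<close> sum to zero because those of \<phi> sum to one. Hence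
  \<open>d\<close> is the first difference of a compactly supported Lipschitz function
  \<open>M\<close>, and \<open>N\<close> is the Hilbert transform of \<open>M\<close>; a later
  summation by parts rests on it. Moreover \<open>d\<close> has zero mean, so its own transform
  decays quadratically.\<close>

lemma interpolation_kernel_hilb:
  assumes "interpolation_kernel \<phi>"
  obtains d L A N C where "\<And>x. (\<phi> has_real_derivative d x) (at x)" "lip_supp L A d"
    "\<And>x. A \<le> \<bar>x\<bar> \<Longrightarrow> \<phi> x = 0" "\<And>x. N x - N (x - 1) = hilb d x" "0 \<le> C"
    "\<And>x. \<bar>N x\<bar> \<le> C / (1 + \<bar>x\<bar>)" "\<And>x. \<bar>hilb d x\<bar> \<le> C / (1 + x\<^sup>2)"
proof -
  obtain d L A where d: "\<And>x. (\<phi> has_real_derivative d x) (at x)" and lip: "lip_supp L A d"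
    and \<phi>0: "\<And>x. A \<le> \<bar>x\<bar> \<Longrightarrow> \<phi> x = 0"
    by (rule C02_derivative[of \<phi>]) (use assms in \<open>auto simp: interpolation_kernel_def\<close>)
  note L = lip_suppD(1)[OF lip] and A = lip_suppD(2)[OF lip] and dl = lip_suppD(3)[OF lip]
    and d0 = lip_suppD(4)[OF lip]
  have part: "((\<lambda>j::int. \<phi> (u - of_int j)) has_sum 1) UNIV" for u
    using assms unfolding interpolation_kernel_def by auto
  have dsum: "(\<Sum>j\<in>J. d (u - of_int j)) = 0"
    if "finite J" "\<And>j. j \<notin> J \<Longrightarrow> d (u - of_int j) = 0" for u and J :: "int set"
  proof -
    \<comment> \<open>All translates with index beyond \<open>n\<close> vanish on the whole unit
      ball around \<open>u\<close>, so the partition of unity is a finite sum there and can be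
      differentiated termwise.\<close>
    define n where "n = \<lceil>\<bar>u\<bar> + A + 1\<rceil>"
    have n: "\<bar>u\<bar> + A + 1 \<le> of_int n" unfolding n_def by linarith
    have far: "A \<le> \<bar>v - of_int j\<bar>" if "j \<notin> {-n..n}" "v \<in> ball u 1" for v and j :: int
    proof -
      have "of_int n < \<bar>of_int j :: real\<bar>" using that by (auto simp: abs_if)
      moreover have "\<bar>v\<bar> < \<bar>u\<bar> + 1" using that by (auto simp: dist_real_def)
      ultimately show ?thesis using n by linarith
    qed
    have "(\<Sum>j\<in>{-n..n}. \<phi> (v - of_int j)) = 1" if "v \<in> ball u 1" for v
    proof -
      have "(\<Sum>\<^sub>\<infinity>j::int. \<phi> (v - of_int j)) = (\<Sum>j\<in>{-n..n}. \<phi> (v - of_int j))"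
        by (rule infsum_int_finite) (use that far \<phi>0 in auto)
      then show ?thesis using infsumI[OF part[of v]] by simp
    qed
    then have "((\<lambda>v. \<Sum>j\<in>{-n..n}. \<phi> (v - of_int j)) has_real_derivative 0) (at u)"
      by (intro has_field_derivative_transform_within_open[where f = "\<lambda>_. 1", OF DERIV_const open_ball]) auto
    moreover have "((\<lambda>v. \<Sum>j\<in>{-n..n}. \<phi> (v - of_int j)) has_real_derivative (\<Sum>j\<in>{-n..n}. d (u - of_int j))) (at u)"
      by (intro DERIV_sum DERIV_cong[OF DERIV_chain2[OF d DERIV_diff[OF DERIV_ident DERIV_const]]]) auto
    ultimately have "(\<Sum>j\<in>{-n..n}. d (u - of_int j)) = 0" by (rule DERIV_unique[symmetric])
    moreover have "(\<Sum>\<^sub>\<infinity>j::int. d (u - of_int j)) = (\<Sum>j\<in>{-n..n}. d (u - of_int j))"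
      by (rule infsum_int_finite) (use far d0 in auto)
    \<comment> \<open>Passing through the infinite sum makes the result independent of the index
      set, as long as that set contains all nonzero terms.\<close>
    moreover have "(\<Sum>\<^sub>\<infinity>j::int. d (u - of_int j)) = (\<Sum>j\<in>J. d (u - of_int j))"
      by (rule infsum_int_finite) (use that in auto)
    ultimately show ?thesis by simp
  qed
  \<comment> \<open>For \<open>s\<close> in (A - 1, A] the indices 0, ..., \<open>n\<close> catch
    every nonzero d(s - j): a negative \<open>j\<close> gives s - j > A, and j > n gives s - j <
    -A.\<close>
  define n where "n = \<lceil>2 * A\<rceil>"
  have n: "2 * A \<le> of_int n" "0 \<le> n" using A by (auto simp: n_def)
  define P where "P s = (\<Sum>j\<in>{0..n}. d (s - of_int j))" for s
  \<comment> \<open>\<open>M s = \<Sum>\<^sub>j\<^sub>\<ge>\<^sub>0 d (s - j)\<close> telescopes to \<open>d\<close>; it vanishes for \<open>s \<ge> A\<close> because all translates of \<open>d\<close> sum to zero.\<close>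
  define M where "M s = P (min s A)" for s
  have P0: "P s = 0" if "A - 1 < s" "s \<le> A" for s
    unfolding P_def
  proof (rule dsum)
    fix j :: int assume "j \<notin> {0..n}"
    then have "j \<le> -1 \<or> n + 1 \<le> j" by auto
    then have "real_of_int j \<le> -1 \<or> real_of_int n + 1 \<le> real_of_int j" by linarith
    then show "d (s - real_of_int j) = 0" using that n A by (intro d0) linarith
  qed simp
  have Plip: "\<bar>P x - P y\<bar> \<le> (of_int (n + 1) * L) * \<bar>x - y\<bar>" for x y
  proof -
    have "\<bar>P x - P y\<bar> \<le> (\<Sum>j\<in>{0..n}. \<bar>d (x - of_int j) - d (y - of_int j)\<bar>)"
      unfolding P_def sum_subtractf[symmetric] by (rule sum_abs)
    also have "\<dots> \<le> (\<Sum>j\<in>{0..n}. L * \<bar>x - y\<bar>)"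
      using dl[of "x - of_int j" "y - of_int j" for j] by (intro sum_mono) auto
    finally show ?thesis using n by simp
  qed
  have M: "lip_supp (of_int (n + 1) * L) A M"
    unfolding lip_supp_def
  proof (intro conjI allI impI)
    fix x y
    have "\<bar>M x - M y\<bar> \<le> (of_int (n + 1) * L) * \<bar>min x A - min y A\<bar>"
      unfolding M_def by (rule Plip)
    also have "\<dots> \<le> (of_int (n + 1) * L) * \<bar>x - y\<bar>"
      using L n by (intro mult_left_mono) auto
    finally show "\<bar>M x - M y\<bar> \<le> (of_int (n + 1) * L) * \<bar>x - y\<bar>" .
  next
    fix x assume x: "A \<le> \<bar>x\<bar>"
    show "M x = 0"
    proof (cases "A \<le> x")
      case True then show ?thesis using P0[of A] by (simp add: M_def)
    next
      case False
      have "d (x - of_int j) = 0" if "j \<in> {0..n}" for j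
        using False x that A by (intro d0) (auto simp: abs_if split: if_splits)
      then show ?thesis using False by (simp add: M_def P_def)
    qed
  qed (use n L A in auto)
  have Md: "M s - M (s - 1) = d s" for s
  proof (cases "s \<le> A")
    case True
    have "P (s - 1) = (\<Sum>j\<in>{1..n+1}. d (s - of_int j))"
      unfolding P_def
      by (rule sum.reindex_bij_witness[where i = "\<lambda>j. j - 1" and j = "\<lambda>j. j + 1"]) (auto simp: algebra_simps)
    also have "\<dots> = (\<Sum>j\<in>{1..n}. d (s - of_int j)) + d (s - of_int (n + 1))"
    proof -
      have "{1..n+1} = insert (n + 1) {1..n}" using n by auto
      then show ?thesis by simp
    qed
    also have "d (s - of_int (n + 1)) = 0"
      using True n A by (intro d0) auto
    finally have 1: "P (s - 1) = (\<Sum>j\<in>{1..n}. d (s - of_int j))" by simp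
    have "{0..n} = insert 0 {1..n}" using n by auto
    then have "P s = d s + (\<Sum>j\<in>{1..n}. d (s - of_int j))"
      by (simp add: P_def)
    then show ?thesis using True 1 by (simp add: M_def)
  next
    case False
    then have "M s = 0" "d s = 0"
      using d0[of s] lip_suppD(4)[OF M, of s] by auto
    \<comment> \<open>For \<open>s > A\<close> the point \<open>min (s - 1) A\<close> lies in (A -
      1, A], where \<open>P\<close> vanishes.\<close>
    moreover have "M (s - 1) = 0"
      using False P0[of "min (s - 1) A"] by (simp add: M_def min_def split: if_splits)
    ultimately show ?thesis by simp
  qed
  have diff: "hilb M x - hilb M (x - 1) = hilb d x" for x
    using hilb_diff[OF M lip_supp_shift[OF M, of 1], of x] hilb_translate[of M 1 x] Md by simp
  have int0: "(LINT p|lborel. d p) = 0"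
  proof -
    have "(LINT p|lborel. d p * indicator {-A..A} p) = \<phi> A - \<phi> (-A)"
      using A by (intro integral_FTC_Icc_real)
        (auto simp: has_real_derivative_iff_has_vector_derivative[symmetric] intro!: d has_field_derivative_at_within
          continuous_on_interior[OF lip_supp_continuous[OF lip, of UNIV]])
    moreover have "(\<lambda>p. d p * indicator {-A..A} p) = d"
      using d0 by (force simp: indicator_def)
    ultimately show ?thesis using \<phi>0[of A] \<phi>0[of "-A"] A by simp
  qed
  obtain C1 where C1: "0 \<le> C1" "\<And>x. \<bar>hilb M x\<bar> \<le> C1 / (1 + \<bar>x\<bar>)"
    using hilb_decay[OF M] by blast
  obtain C2 where C2: "0 \<le> C2" "\<And>x. \<bar>hilb d x\<bar> \<le> C2 / (1 + x\<^sup>2)"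
    using hilb_decay2[OF lip int0] by blast
  show ?thesis
  proof (rule that[OF d lip \<phi>0 diff])
    show "0 \<le> C1 + C2" using C1 C2 by simp
    show "\<bar>hilb M x\<bar> \<le> (C1 + C2) / (1 + \<bar>x\<bar>)" for x
      by (rule order_trans[OF C1(2)]) (use C2 in \<open>auto intro!: divide_right_mono\<close>)
    show "\<bar>hilb d x\<bar> \<le> (C1 + C2) / (1 + x\<^sup>2)" for x
      by (rule order_trans[OF C2(2)]) (use C1 in \<open>auto intro!: divide_right_mono simp: add_nonneg_nonneg\<close>)
  qed
qed

section \<open>The reconstruction kernel\<close>

lemma divide_le_scaled:
  fixes p q C D :: real
  assumes "0 < p" "0 < q" "0 \<le> C" "q \<le> D * p" shows "C / p \<le> C * D / q"
  using mult_left_mono[OF assms(4,3)] assms by (simp add: divide_simps mult_ac)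

lemma norm_dir [simp]: "norm (dir \<alpha>) = 1"
  by (simp add: dir_def norm_Pair)

lemma dir_inner_le: "\<bar>dir \<alpha> \<bullet> v\<bar> \<le> norm v"
  using Cauchy_Schwarz_ineq2[of "dir \<alpha>" v] by simp

text \<open>Only integers within \<open>m\<close> of \<open>v\<close> contribute; rounding both ends
  of the window outwards still leaves at most \<open>2 * m + 4\<close> of them.\<close>

lemma abs_infsum_int_near:
  fixes f :: "int \<Rightarrow> real"
  assumes "\<And>j. m \<le> \<bar>of_int j - v\<bar> \<Longrightarrow> f j = 0" "\<And>j. \<bar>of_int j - v\<bar> < m \<Longrightarrow> \<bar>f j\<bar> \<le> K" "0 \<le> K" "0 \<le> m"
  shows "\<bar>\<Sum>\<^sub>\<infinity>j. f j\<bar> \<le> (2 * m + 4) * K"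
proof -
  define J where "J = {\<lfloor>v - m\<rfloor>..\<lceil>v + m\<rceil>}"
  have out: "m \<le> \<bar>of_int j - v\<bar>" if "j \<notin> J" for j
  proof -
    have "j < \<lfloor>v - m\<rfloor> \<or> \<lceil>v + m\<rceil> < j" using that by (auto simp: J_def)
    then show ?thesis by linarith
  qed
  have "(\<Sum>\<^sub>\<infinity>j. f j) = (\<Sum>j\<in>J. f j)"
    by (rule infsum_int_finite) (use out assms(1) in \<open>auto simp: J_def\<close>)
  moreover have "\<bar>\<Sum>j\<in>J. f j\<bar> \<le> (\<Sum>j\<in>J. K)"
    by (rule order_trans[OF sum_abs sum_mono]) (metis assms(1,2,3) abs_zero not_le)
  moreover have "real (card J) \<le> 2 * m + 4"
    using \<open>0 \<le> m\<close> unfolding J_def by (auto simp: of_nat_nat) linarith+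
  ultimately show ?thesis
    using \<open>0 \<le> K\<close> mult_right_mono[of "real (card J)" "2 * m + 4" K] by (simp add: mult.commute)
qed

lemma antiderivative_real:
  fixes w :: "real \<Rightarrow> real"
  assumes "continuous_on UNIV w"
  obtains W where "\<And>x. (W has_real_derivative w x) (at x)"
proof
  fix x :: real
  have "((\<lambda>u. LBINT y=ereal 0..u. w y) has_vector_derivative w x) (at x within {-\<bar>x\<bar>-1..\<bar>x\<bar>+1})"
    by (rule interval_integral_FTC2) (auto intro: continuous_on_subset[OF assms])
  then show "((\<lambda>u. LBINT y=ereal 0..u. w y) has_real_derivative w x) (at x)"
    unfolding has_real_derivative_iff_has_vector_derivative
    by (subst (asm) at_within_interior) (auto simp: interior_atLeastAtMost_real)
qed

text \<open>Data, interpolation and Hilbert transform are linear in \<open>g\<close>, so their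
  composition is given by a kernel, with lengths measured in units of \<epsilon>. One factor of
  1/\<epsilon>^2 is the normalization of the data, the other comes from differentiating \<phi>(p /
  \<epsilon>); the Hilbert transform is scale invariant.\<close>

lemma reconstruction_kernel:
  assumes "interpolation_kernel \<phi>" "C02 w"
  obtains \<psi> \<Psi> C where
    "\<And>u v. ((\<lambda>v. \<Psi> u v) has_real_derivative \<psi> u v) (at v)"
    "0 \<le> C" "\<And>u v. \<bar>\<Psi> u v\<bar> \<le> C / (1 + \<bar>u - v\<bar>)" "\<And>u v. \<bar>\<psi> u v\<bar> \<le> C / (1 + (u - v)\<^sup>2)"
    "\<And>u. continuous_on UNIV (\<psi> u)"
    "\<And>\<epsilon> \<alpha> x g B. \<lbrakk>0 < \<epsilon>; integrable lborel g; \<And>v. g v \<noteq> 0 \<Longrightarrow> norm v \<le> B\<rbrakk> \<Longrightarrow>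
      pv_integral (deriv (interpolated_data \<phi> w g \<epsilon> \<alpha>)) (dir \<alpha> \<bullet> x)
        = 1 / \<epsilon>\<^sup>2 * (LINT v|lborel. \<psi> (dir \<alpha> \<bullet> x / \<epsilon>) (dir \<alpha> \<bullet> v / \<epsilon>) * g v)"
proof -
  obtain d L A N C where d: "\<And>x. (\<phi> has_real_derivative d x) (at x)" and lip: "lip_supp L A d"
    and \<phi>0: "\<And>x. A \<le> \<bar>x\<bar> \<Longrightarrow> \<phi> x = 0" and N: "\<And>x. N x - N (x - 1) = hilb d x" and C: "0 \<le> C"
    and Nb: "\<And>x. \<bar>N x\<bar> \<le> C / (1 + \<bar>x\<bar>)" and db: "\<And>x. \<bar>hilb d x\<bar> \<le> C / (1 + x\<^sup>2)"
    by (rule interpolation_kernel_hilb[OF assms(1)]) blast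
  obtain w' L' D where w: "\<And>x. (w has_real_derivative w' x) (at x)" and D: "0 < D"
    and w0: "\<And>x. D \<le> \<bar>x\<bar> \<Longrightarrow> w x = 0"
    by (rule C02_derivative[OF assms(2)]) (use lip_suppD in blast)
  have wc: "continuous_on S w" for S
    using w DERIV_isCont continuous_at_imp_continuous_on by blast
  note [measurable] = borel_measurable_continuous_onI[OF wc]
  obtain W where W: "\<And>x. (W has_real_derivative w x) (at x)"
    using antiderivative_real[OF wc] by blast
  obtain K where K: "\<And>x. \<bar>w x\<bar> \<le> K" "0 \<le> K"
  proof -
    have "compact (w ` {-D..D})" by (intro compact_continuous_image wc) auto
    then obtain K where K: "\<And>x. x \<in> {-D..D} \<Longrightarrow> \<bar>w x\<bar> \<le> K"
      using bounded_iff compact_imp_bounded by (metis imageI real_norm_def)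
    have "\<bar>w x\<bar> \<le> max K 0" if "\<bar>x\<bar> < D" for x
      using K[of x] that by (simp add: abs_less_iff le_max_iff_disj)
    then have "\<bar>w x\<bar> \<le> max K 0" for x
      using w0[of x] by (cases "D \<le> \<bar>x\<bar>") auto
    then show ?thesis by (rule that) simp
  qed
  define V where "V x = W x - W (x - 1)" for x
  \<comment> \<open>Reading \<open>V x\<close> as a value of \<open>w\<close> at an intermediate
    point gives both its support and its bound.\<close>
  have Vmvt: "\<exists>z. x - 1 < z \<and> z < x \<and> V x = w z" for x
    using MVT2[of "x - 1" x W w] W unfolding V_def by auto
  have V0: "V x = 0" if "D + 1 \<le> \<bar>x\<bar>" for x
  proof -
    obtain z where "x - 1 < z" "z < x" "V x = w z" using Vmvt by blast
    moreover have "D \<le> \<bar>z\<bar>" using that D calculation by linarith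
    ultimately show ?thesis using w0 by simp
  qed
  have Vb: "\<bar>V x\<bar> \<le> K" for x using Vmvt[of x] K(1) by auto
  have Vd: "(V has_real_derivative (w x - w (x - 1))) (at x)" for x
    unfolding V_def by (intro DERIV_diff W DERIV_cong[OF DERIV_chain2[OF W DERIV_diff[OF DERIV_ident DERIV_const]]]) auto
  define \<eta> where "\<eta> = hilb d"
  define \<psi> where "\<psi> u v = (\<Sum>\<^sub>\<infinity>j::int. \<eta> (u - of_int j) * w (of_int j - v))" for u v
  \<comment> \<open>Summation by parts in \<open>- \<Sum>\<^sub>j \<eta>(u - j) W(j - v)\<close>; the differences \<open>V\<close> have compact support.\<close>
  define \<Psi> where "\<Psi> u v = - (\<Sum>\<^sub>\<infinity>j::int. N (u - of_int j) * V (of_int j - v))" for u v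
  \<comment> \<open>One finite window serves \<open>w (j - v)\<close>, \<open>V (j - v)\<close> and
    the shifted \<open>w (j - v - 1)\<close> for all \<open>v\<close> within 1 of the centre; this
    is why it is wider than the support.\<close>
  define J where "J v = {\<lfloor>v\<rfloor> - \<lceil>D\<rceil> - 4..\<lceil>v\<rceil> + \<lceil>D\<rceil> + 4}" for v :: real
  have J: "D + 3 \<le> \<bar>of_int j - v\<bar>" if "j \<notin> J v0" "v \<in> ball v0 1" for j v v0
  proof -
    have "j < \<lfloor>v0\<rfloor> - \<lceil>D\<rceil> - 4 \<or> \<lceil>v0\<rceil> + \<lceil>D\<rceil> + 4 < j" using that by (auto simp: J_def)
    moreover have "\<bar>v0 - v\<bar> < 1" using that by (auto simp: dist_real_def)
    ultimately show ?thesis by linarith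
  qed
  have [simp]: "finite (J v)" for v by (simp add: J_def)
  have \<psi>eq: "\<psi> u v = (\<Sum>j\<in>J v0. \<eta> (u - of_int j) * w (of_int j - v))" if "v \<in> ball v0 1" for u v v0
    unfolding \<psi>_def by (rule infsum_int_finite) (use J[OF _ that] w0 in force)+
  have \<Psi>eq: "\<Psi> u v = - (\<Sum>j\<in>J v0. N (u - of_int j) * V (of_int j - v))" if "v \<in> ball v0 1" for u v v0
    unfolding \<Psi>_def by (subst infsum_int_finite[of "J v0"]) (use J[OF _ that] V0 in force)+
  have der: "((\<lambda>v. \<Psi> u v) has_real_derivative \<psi> u v0) (at v0)" for u v0
  proof -
    let ?S = "\<lambda>v. - (\<Sum>j\<in>J v0. N (u - of_int j) * V (of_int j - v))"
    let ?D = "- (\<Sum>j\<in>J v0. N (u - of_int j) * ((w (of_int j - v0) - w (of_int j - v0 - 1)) * (0 - 1)))"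
    have 1: "(?S has_real_derivative ?D) (at v0)"
      by (intro DERIV_minus DERIV_sum DERIV_cmult DERIV_chain2[OF Vd] DERIV_diff DERIV_const DERIV_ident)
    have "?D = (\<Sum>j\<in>J v0. N (u - of_int j) * w (of_int j - v0)) - (\<Sum>j\<in>J v0. N (u - of_int j) * w (of_int j - v0 - 1))"
      by (simp add: sum_subtractf right_diff_distrib flip: sum_negf)
    also have "(\<Sum>j\<in>J v0. N (u - of_int j) * w (of_int j - v0 - 1))
      = (\<Sum>\<^sub>\<infinity>j::int. N (u - of_int j) * w (of_int j - v0 - 1))"
      by (rule infsum_int_finite[symmetric]) (use J[of _ v0 v0] w0 in force)+
    \<comment> \<open>The index is shifted in the infinite sum, since the window \<open>J v0\<close>
      is not invariant under j + 1. Then N(u - j) - N(u - j - 1) collapses to \<eta>(u - j).\<close>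
    also have "\<dots> = (\<Sum>\<^sub>\<infinity>j::int. N (u - of_int (j + 1)) * w (of_int (j + 1) - v0 - 1))"
      by (rule infsum_reindex_bij_betw[symmetric]) (rule bij_betw_byWitness[where f' = "\<lambda>j. j - 1"], auto)
    also have "\<dots> = (\<Sum>j\<in>J v0. N (u - of_int (j + 1)) * w (of_int (j + 1) - v0 - 1))"
      by (rule infsum_int_finite) (use J[of _ v0 v0] w0 in force)+
    also have "(\<Sum>j\<in>J v0. N (u - of_int j) * w (of_int j - v0)) - \<dots> = (\<Sum>j\<in>J v0. \<eta> (u - of_int j) * w (of_int j - v0))"
      unfolding \<eta>_def N[symmetric] sum_subtractf[symmetric]
      by (intro sum.cong) (auto simp: algebra_simps)
    also have "\<dots> = \<psi> u v0" by (rule \<psi>eq[symmetric]) simp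
    finally have "?D = \<psi> u v0" .
    with 1 have "(?S has_real_derivative \<psi> u v0) (at v0)" by metis
    then show ?thesis
      by (rule has_field_derivative_transform_within_open[OF _ open_ball[of v0 1]]) (auto simp: \<Psi>eq)
  qed
  have cont: "continuous_on UNIV (\<psi> u)" for u
  proof (rule continuous_at_imp_continuous_on, rule ballI)
    fix v0
    have "continuous_on UNIV (\<lambda>v. \<Sum>j\<in>J v0. \<eta> (u - of_int j) * w (of_int j - v))"
      by (intro continuous_intros continuous_on_compose2[OF wc[of UNIV]]) auto
    then have "continuous_on (ball v0 1) (\<psi> u)"
      by (rule continuous_on_eq[OF continuous_on_subset]) (auto simp: \<psi>eq)
    then show "isCont (\<psi> u) v0"
      by (simp add: continuous_on_eq_continuous_at)
  qed
  \<comment> \<open>A common support radius for \<open>w\<close> and \<open>V\<close>. For the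
    indices within \<open>m\<close> of \<open>v\<close>, decay in u - j is comparable with decay in
    u - v, which yields both bounds below.\<close>
  define m where "m = D + 1"
  have m: "m > 0" using D by (simp add: m_def)
  define C' where "C' = (2 * m + 4) * (C * (1 + m) * K) + (2 * m + 4) * (C * (2 + 2 * m\<^sup>2) * K)"
  have C'1: "(2 * m + 4) * (C * (1 + m) * K) \<le> C'" and C'2: "(2 * m + 4) * (C * (2 + 2 * m\<^sup>2) * K) \<le> C'"
    and C'0: "0 \<le> C'"
    using m C K(2) by (auto simp: C'_def intro!: add_nonneg_nonneg mult_nonneg_nonneg)
  have b1: "\<bar>\<Psi> u v\<bar> \<le> C' / (1 + \<bar>u - v\<bar>)" for u v
  proof -
    have "\<bar>\<Psi> u v\<bar> \<le> (2 * m + 4) * (C * (1 + m) / (1 + \<bar>u - v\<bar>) * K)"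
      unfolding \<Psi>_def abs_minus_cancel
    proof (rule abs_infsum_int_near)
      fix j :: int assume j: "\<bar>of_int j - v\<bar> < m"
      have "1 + \<bar>u - v\<bar> \<le> 1 + \<bar>u - of_int j\<bar> + m" using j by linarith
      also have "\<dots> \<le> (1 + m) * (1 + \<bar>u - of_int j\<bar>)" using m by (simp add: algebra_simps)
      finally have "C / (1 + \<bar>u - of_int j\<bar>) \<le> C * (1 + m) / (1 + \<bar>u - v\<bar>)"
        using C by (intro divide_le_scaled) auto
      then have "\<bar>N (u - of_int j)\<bar> \<le> C * (1 + m) / (1 + \<bar>u - v\<bar>)"
        using Nb[of "u - of_int j"] by linarith
      then show "\<bar>N (u - of_int j) * V (of_int j - v)\<bar> \<le> C * (1 + m) / (1 + \<bar>u - v\<bar>) * K"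
        unfolding abs_mult by (intro mult_mono Vb) (use C m in auto)
    qed (use V0 C m K(2) in \<open>auto simp: m_def\<close>)
    also have "\<dots> = (2 * m + 4) * (C * (1 + m) * K) / (1 + \<bar>u - v\<bar>)" by simp
    also have "\<dots> \<le> C' / (1 + \<bar>u - v\<bar>)" by (intro divide_right_mono C'1) auto
    finally show ?thesis .
  qed
  have b2: "\<bar>\<psi> u v\<bar> \<le> C' / (1 + (u - v)\<^sup>2)" for u v
  proof -
    have pos: "0 < 1 + z\<^sup>2" for z :: real by (simp add: add_pos_nonneg)
    have "\<bar>\<psi> u v\<bar> \<le> (2 * m + 4) * (C * (2 + 2 * m\<^sup>2) / (1 + (u - v)\<^sup>2) * K)"
      unfolding \<psi>_def
    proof (rule abs_infsum_int_near)
      fix j :: int assume j: "\<bar>of_int j - v\<bar> < m"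
      have s: "(p + q)\<^sup>2 \<le> 2 * p\<^sup>2 + 2 * q\<^sup>2" for p q :: real
        using sum_squares_bound[of p q] by (simp add: power2_sum)
      have "(of_int j - v)\<^sup>2 \<le> m\<^sup>2" using j m by (metis abs_ge_zero less_imp_le power2_abs power_mono)
      then have "1 + (u - v)\<^sup>2 \<le> 1 + (2 * (u - of_int j)\<^sup>2 + 2 * m\<^sup>2)"
        using s[of "u - of_int j" "of_int j - v"] by simp
      also have "\<dots> \<le> (2 + 2 * m\<^sup>2) * (1 + (u - of_int j)\<^sup>2)"
        by (simp add: algebra_simps)
      finally have "C / (1 + (u - of_int j)\<^sup>2) \<le> C * (2 + 2 * m\<^sup>2) / (1 + (u - v)\<^sup>2)"
        using C pos by (intro divide_le_scaled) auto
      then have "\<bar>\<eta> (u - of_int j)\<bar> \<le> C * (2 + 2 * m\<^sup>2) / (1 + (u - v)\<^sup>2)"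
        using db[of "u - of_int j"] by (simp add: \<eta>_def)
      then show "\<bar>\<eta> (u - of_int j) * w (of_int j - v)\<bar> \<le> C * (2 + 2 * m\<^sup>2) / (1 + (u - v)\<^sup>2) * K"
        unfolding abs_mult by (intro mult_mono K) (use C m in auto)
    next
      show "0 \<le> C * (2 + 2 * m\<^sup>2) / (1 + (u - v)\<^sup>2) * K"
        using C K(2) pos[of "u - v"] by (intro mult_nonneg_nonneg divide_nonneg_nonneg add_nonneg_nonneg) auto
    qed (use w0 m in \<open>auto simp: m_def\<close>)
    also have "\<dots> = (2 * m + 4) * (C * (2 + 2 * m\<^sup>2) * K) / (1 + (u - v)\<^sup>2)" by simp
    also have "\<dots> \<le> C' / (1 + (u - v)\<^sup>2)"
      using pos[of "u - v"] by (intro divide_right_mono C'2) auto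
    finally show ?thesis .
  qed
  have rec: "pv_integral (deriv (interpolated_data \<phi> w g \<epsilon> \<alpha>)) (dir \<alpha> \<bullet> x)
        = 1 / \<epsilon>\<^sup>2 * (LINT v|lborel. \<psi> (dir \<alpha> \<bullet> x / \<epsilon>) (dir \<alpha> \<bullet> v / \<epsilon>) * g v)"
    if \<epsilon>: "0 < \<epsilon>" and g: "integrable lborel g" and B: "\<And>v. g v \<noteq> 0 \<Longrightarrow> norm v \<le> B" for \<epsilon> \<alpha> x g B
  proof -
    \<comment> \<open>Only detectors with index up to \<open>n\<close> in modulus see the bounded
      support of \<open>g\<close>, so the interpolated data is a finite sum.\<close>
    define n where "n = \<lceil>B / \<epsilon> + D\<rceil>"
    define I where "I = {-n..n}"
    have [simp]: "finite I" by (simp add: I_def)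
    let ?w = "\<lambda>j v. w (of_int j - dir \<alpha> \<bullet> v / \<epsilon>)" and ?e = "\<lambda>j. \<eta> (dir \<alpha> \<bullet> x / \<epsilon> - of_int j)"
    have far: "?w j v * g v = 0" if "j \<notin> I" for j v
    proof (cases "g v = 0")
      case False
      have "\<bar>dir \<alpha> \<bullet> v\<bar> \<le> B" using B[OF False] dir_inner_le[of \<alpha> v] by linarith
      then have "\<bar>dir \<alpha> \<bullet> v / \<epsilon>\<bar> \<le> B / \<epsilon>" using \<epsilon> by (simp add: divide_right_mono)
      moreover have "B / \<epsilon> + D \<le> of_int n" unfolding n_def by linarith
      moreover have "of_int n < \<bar>of_int j :: real\<bar>" using that by (auto simp: abs_if I_def)
      ultimately have "D \<le> \<bar>of_int j - dir \<alpha> \<bullet> v / \<epsilon>\<bar>" by linarith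
      then show ?thesis using w0 by simp
    qed simp
    have sc: "(of_int j * \<epsilon> - c) / \<epsilon> = of_int j - c / \<epsilon>" "(c - of_int j * \<epsilon>) / \<epsilon> = c / \<epsilon> - of_int j" for j :: int and c
      using \<epsilon> by (auto simp: diff_divide_distrib)
    define r where "r j = radon_data w g \<epsilon> \<alpha> (of_int j * \<epsilon>)" for j :: int
    have r: "r j = 1 / \<epsilon> * (LINT v|lborel. ?w j v * g v)" for j
      by (simp add: r_def radon_data_def sc)
    have r0: "r j = 0" if "j \<notin> I" for j
      by (simp add: r far[OF that])
    have id: "interpolated_data \<phi> w g \<epsilon> \<alpha> p = (\<Sum>j\<in>I. \<phi> (p / \<epsilon> - of_int j) * r j)" for p
      unfolding interpolated_data_def r_def[symmetric] sc
      by (rule infsum_int_finite) (auto simp: r0)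
    define G where "G j p = d (p / \<epsilon> - of_int j)" for j :: int and p
    have G: "\<exists>L A. lip_supp L A (G j)" for j
      unfolding G_def using lip_supp_scale[OF lip_supp_shift[OF lip] \<epsilon>] by blast
    have hG: "hilb (G j) c = \<eta> (c / \<epsilon> - of_int j)" for j c
      unfolding G_def \<eta>_def hilb_scale[OF \<epsilon>, of "\<lambda>q. d (q - of_int j)"] by (rule hilb_translate)
    have "(interpolated_data \<phi> w g \<epsilon> \<alpha> has_real_derivative (\<Sum>j\<in>I. r j / \<epsilon> * G j p)) (at p)" for p
    proof -
      have "((\<lambda>p. \<Sum>j\<in>I. \<phi> (p / \<epsilon> - of_int j) * r j) has_real_derivative
          (\<Sum>j\<in>I. d (p / \<epsilon> - of_int j) * (1 / \<epsilon> - 0) * r j)) (at p)"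
        by (intro DERIV_sum DERIV_cmult_right DERIV_chain2[OF d] DERIV_diff DERIV_const DERIV_cdivide DERIV_ident)
      moreover have "(\<Sum>j\<in>I. d (p / \<epsilon> - of_int j) * (1 / \<epsilon> - 0) * r j) = (\<Sum>j\<in>I. r j / \<epsilon> * G j p)"
        by (intro sum.cong) (auto simp: G_def)
      ultimately show ?thesis unfolding id[abs_def] by simp
    qed
    then have de: "deriv (interpolated_data \<phi> w g \<epsilon> \<alpha>) = (\<lambda>p. \<Sum>j\<in>I. r j / \<epsilon> * G j p)"
      using DERIV_imp_deriv by blast
    have "\<exists>L A. lip_supp L A (\<lambda>p. \<Sum>j\<in>I. r j / \<epsilon> * G j p)"
      using lip_supp_cmult G by (intro lip_supp_sum) (simp, blast)
    then have "pv_integral (deriv (interpolated_data \<phi> w g \<epsilon> \<alpha>)) (dir \<alpha> \<bullet> x)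
      = hilb (\<lambda>p. \<Sum>j\<in>I. r j / \<epsilon> * G j p) (dir \<alpha> \<bullet> x)"
      unfolding de using pv_integral_eq_hilb by blast
    also have "\<dots> = (\<Sum>j\<in>I. r j / \<epsilon> * hilb (G j) (dir \<alpha> \<bullet> x))"
      using G by (intro hilb_sum) auto
    also have "\<dots> = (\<Sum>j\<in>I. 1 / \<epsilon>\<^sup>2 * (?e j * (LINT v|lborel. ?w j v * g v)))"
      by (intro sum.cong)
        (auto simp: hG r power2_eq_square)
    also have "\<dots> = 1 / \<epsilon>\<^sup>2 * (LINT v|lborel. (\<Sum>j\<in>I. ?e j * (?w j v * g v)))"
    proof -
      have i: "integrable lborel (\<lambda>v. ?w j v * g v)" for j :: int
      proof (rule Bochner_Integration.integrable_bound)
        show "integrable lborel (\<lambda>v. K * g v)" using g by simp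
        have [measurable]: "g \<in> borel_measurable borel" using g by auto
        show "(\<lambda>v. ?w j v * g v) \<in> borel_measurable lborel" by measurable
        show "AE v in lborel. norm (?w j v * g v) \<le> norm (K * g v)"
          using K by (auto intro!: AE_I2 mult_right_mono simp: abs_mult)
      qed
      then show ?thesis
        by (subst Bochner_Integration.integral_sum) (auto simp: sum_distrib_left)
    qed
    also have "(\<lambda>v. \<Sum>j\<in>I. ?e j * (?w j v * g v))
      = (\<lambda>v. \<psi> (dir \<alpha> \<bullet> x / \<epsilon>) (dir \<alpha> \<bullet> v / \<epsilon>) * g v)"
    proof
      fix v
      show "(\<Sum>j\<in>I. ?e j * (?w j v * g v))
        = \<psi> (dir \<alpha> \<bullet> x / \<epsilon>) (dir \<alpha> \<bullet> v / \<epsilon>) * g v"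
      proof (cases "g v = 0")
        case False
        have "\<psi> (dir \<alpha> \<bullet> x / \<epsilon>) (dir \<alpha> \<bullet> v / \<epsilon>)
          = (\<Sum>j\<in>I. ?e j * ?w j v)"
          unfolding \<psi>_def
        proof (rule infsum_int_finite)
          show "?e j * ?w j v = 0" if "j \<notin> I" for j
            using far[OF that, of v] False by simp
        qed simp
        then show ?thesis by (simp add: sum_distrib_right mult.assoc)
      qed simp
    qed
    finally show ?thesis .
  qed
  show ?thesis by (rule that[OF der C'0 b1 b2 cont rec])
qed

section \<open>Logarithmic sums and level sets\<close>

text \<open>The bound is uniform in \<open>m\<close>, which may lie far outside the range of
  summation. On either side of \<open>m\<close> the distances, in increasing order, dominate 0, 1,
  2, ..., so each half is at most a harmonic sum.\<close>

lemma sum_inverse_dist_int: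
  fixes m n :: int
  assumes "0 \<le> n"
  shows "(\<Sum>k\<in>{-n..n}. 1 / (1 + \<bar>of_int k - of_int m\<bar> :: real)) \<le> 2 * (1 + ln (of_int (2 * n + 1)))"
proof -
  let ?t = "\<lambda>k. 1 / (1 + \<bar>of_int k - of_int m\<bar>) :: real"
  define N where "N = nat (2 * n + 1)"
  have harm: "(\<Sum>i<N. 1 / (1 + real i)) \<le> 1 + ln (of_int (2 * n + 1))"
  proof -
    have "(\<Sum>i<N. 1 / (1 + real i)) = harm N"
      by (induction N) (auto simp: harm_Suc harm_expand(1) inverse_eq_divide)
    \<comment> \<open>The sequence harm n - ln n decreases from its value 1 at n = 1.\<close>
    moreover have "harm N - ln (real N) \<le> (1::real)"
      using euler_mascheroni_sequence_decreasing[of 1 N] assms by (simp add: N_def harm_expand)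
    moreover have "real N = of_int (2 * n + 1)" using assms by (simp add: N_def)
    ultimately show ?thesis by simp
  qed
  have 1: "(\<Sum>k\<in>{k\<in>{-n..n}. m \<le> k}. ?t k) \<le> (\<Sum>i<N. 1 / (1 + real i))"
  proof (rule sum_le_included[where i = "\<lambda>i. max m (-n) + int i"])
    show "\<forall>k\<in>{k \<in> {-n..n}. m \<le> k}. \<exists>i\<in>{..<N}. max m (-n) + int i = k \<and>
        ?t k \<le> 1 / (1 + real i)"
    proof
      fix k assume k: "k \<in> {k \<in> {-n..n}. m \<le> k}"
      then show "\<exists>i\<in>{..<N}. max m (-n) + int i = k \<and>
        ?t k \<le> 1 / (1 + real i)"
        by (intro bexI[of _ "nat (k - max m (-n))"] conjI frac_le) (auto simp: N_def of_nat_nat)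
    qed
  qed (auto intro: finite_subset[of _ "{-n..n}"])
  have 2: "(\<Sum>k\<in>{k\<in>{-n..n}. k < m}. ?t k) \<le> (\<Sum>i<N. 1 / (1 + real i))"
  proof (rule sum_le_included[where i = "\<lambda>i. min m n - int i"])
    show "\<forall>k\<in>{k \<in> {-n..n}. k < m}. \<exists>i\<in>{..<N}. min m n - int i = k \<and>
        ?t k \<le> 1 / (1 + real i)"
    proof
      fix k assume k: "k \<in> {k \<in> {-n..n}. k < m}"
      then show "\<exists>i\<in>{..<N}. min m n - int i = k \<and>
        ?t k \<le> 1 / (1 + real i)"
        by (intro bexI[of _ "nat (min m n - k)"] conjI frac_le) (auto simp: N_def of_nat_nat)
    qed
  qed (auto intro: finite_subset[of _ "{-n..n}"])
  have "(\<Sum>k\<in>{-n..n}. ?t k)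
    = (\<Sum>k\<in>{k\<in>{-n..n}. m \<le> k} \<union> {k\<in>{-n..n}. k < m}. ?t k)"
    by (intro sum.cong) auto
  also have "\<dots> = (\<Sum>k\<in>{k\<in>{-n..n}. m \<le> k}. ?t k)
    + (\<Sum>k\<in>{k\<in>{-n..n}. k < m}. ?t k)"
    by (intro sum.union_disjoint) (auto intro: finite_subset[of _ "{-n..n}"])
  also have "\<dots> \<le> (\<Sum>i<N. 1 / (1 + real i)) + (\<Sum>i<N. 1 / (1 + real i))"
    by (rule add_mono[OF 1 2])
  also have "\<dots> \<le> 2 * (1 + ln (of_int (2 * n + 1)))"
    by (rule order_trans[OF add_mono[OF harm harm]]) simp
  finally show ?thesis .
qed

text \<open>Replacing \<open>b\<close> by its floor changes distances by at most 1, which the factor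
  2 absorbs; the factor 1 / c compensates for the slope.\<close>

lemma sum_inverse_dist_real:
  fixes n :: int and b c :: real
  assumes "0 \<le> n" "0 < c"
  shows "(\<Sum>k\<in>{-n..n}. 1 / (1 + c * \<bar>of_int k - b\<bar>)) \<le> max 2 (1 / c) * (2 * (1 + ln (of_int (2 * n + 1))))"
proof -
  let ?M = "max 2 (1 / c)"
  have "1 / (1 + c * \<bar>of_int k - b\<bar>) \<le> ?M * (1 / (1 + \<bar>of_int k - of_int \<lfloor>b\<rfloor>\<bar>))" for k :: int
  proof -
    have "1 + \<bar>real_of_int k - of_int \<lfloor>b\<rfloor>\<bar> \<le> 2 + 1 * \<bar>of_int k - b\<bar>"
    proof -
      have "1 + \<bar>p - q\<bar> \<le> 2 + 1 * \<bar>p - b\<bar>" if "q \<le> b" "b < q + 1" for p q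
        using that by (auto simp: abs_if)
      then show ?thesis by simp
    qed
    also have "\<dots> \<le> ?M + (?M * c) * \<bar>of_int k - b\<bar>"
    proof (intro add_mono mult_right_mono)
      have "1 / c * c \<le> ?M * c" using assms by (intro mult_right_mono) auto
      then show "1 \<le> ?M * c" using assms by simp
    qed auto
    finally have "1 + \<bar>real_of_int k - of_int \<lfloor>b\<rfloor>\<bar> \<le> ?M * (1 + c * \<bar>of_int k - b\<bar>)"
      by (simp add: algebra_simps)
    then show ?thesis
      using divide_le_scaled[of "1 + c * \<bar>of_int k - b\<bar>" "1 + \<bar>real_of_int k - of_int \<lfloor>b\<rfloor>\<bar>" 1 ?M] assms
      by (simp add: add_pos_nonneg)
  qed
  then have "(\<Sum>k\<in>{-n..n}. 1 / (1 + c * \<bar>of_int k - b\<bar>)) \<le> (\<Sum>k\<in>{-n..n}. ?M * (1 / (1 + \<bar>of_int k - of_int \<lfloor>b\<rfloor>\<bar>)))"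
    by (rule sum_mono)
  also have "\<dots> \<le> ?M * (2 * (1 + ln (of_int (2 * n + 1))))"
    unfolding sum_distrib_left[symmetric] by (intro mult_left_mono sum_inverse_dist_int assms) auto
  finally show ?thesis .
qed

text \<open>Jordan's inequality: by concavity the sine lies above its chord on
  \<open>{0..pi/2}\<close>.\<close>

lemma jordan_sin:
  assumes "\<bar>x\<bar> \<le> pi / 2" shows "2 / pi * \<bar>x\<bar> \<le> \<bar>sin x\<bar>"
proof -
  have cv: "convex_on {0..pi/2} (\<lambda>x. - sin x)"
  proof (rule f''_ge0_imp_convex)
    show "((\<lambda>x. - sin x) has_real_derivative - cos x) (at x)" for x :: real
      by (auto intro!: derivative_eq_intros)
    show "((\<lambda>x. - cos x) has_real_derivative sin x) (at x)" for x :: real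
      by (auto intro!: derivative_eq_intros)
  qed (auto intro!: sin_ge_zero)
  define t where "t = \<bar>x\<bar> / (pi / 2)"
  have t: "0 \<le> t" "t \<le> 1" using assms by (auto simp: t_def field_simps)
  have "- sin ((1 - t) *\<^sub>R 0 + t *\<^sub>R (pi / 2)) \<le> (1 - t) * (- sin 0) + t * (- sin (pi / 2))"
    by (rule convex_onD[OF cv]) (use t in auto)
  moreover have "(1 - t) *\<^sub>R 0 + t *\<^sub>R (pi / 2) = \<bar>x\<bar>" by (simp add: t_def)
  moreover have "\<bar>sin \<bar>x\<bar>\<bar> = \<bar>sin x\<bar>" by (simp add: abs_if)
  moreover have "t = 2 / pi * \<bar>x\<bar>" by (simp add: t_def)
  ultimately show ?thesis by simp
qed

text \<open>As a function of \<alpha>, \<open>dir \<alpha> \<bullet> z\<close> is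
  \<open>norm z\<close> times a shifted sine. Around each of its zeros it grows at least linearly,
  and in steps of \<kappa> * \<epsilon> divided by \<epsilon> this gives a sum of inverse distances
  with slope \<open>c\<close>.\<close>

lemma directional_sum_bound:
  assumes "0 < \<delta>" "0 < \<kappa>"
  obtains C where "0 \<le> C"
    "\<And>\<epsilon> z. \<lbrakk>0 < \<epsilon>; \<epsilon> \<le> exp (-1); \<delta> \<le> norm z\<rbrakk> \<Longrightarrow>
      (\<Sum>k\<in>{k::int. \<bar>of_int k * (\<kappa> * \<epsilon>)\<bar> \<le> pi / 2}. 1 / (1 + \<bar>dir (of_int k * (\<kappa> * \<epsilon>)) \<bullet> z\<bar> / \<epsilon>)) \<le> C * ln (1 / \<epsilon>)"
proof -
  define c where "c = \<delta> * (2 / pi) * \<kappa>"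
  have c: "0 < c" using assms by (simp add: c_def)
  define M where "M = max 2 (1 / c)"
  \<comment> \<open>The 3 counts the zeros of the sine that matter; 2 + ln (pi / \<kappa> + 1)
    bounds 1 plus the logarithm of the number of angles, relative to ln (1/\<epsilon>).\<close>
  define C where "C = 3 * (M * (2 * (2 + ln (pi / \<kappa> + 1))))"
  have "0 \<le> ln (pi / \<kappa> + 1)" using assms by (intro ln_ge_zero) (simp add: pi_ge_zero)
  then have C0: "0 \<le> C" by (simp add: C_def M_def)
  show ?thesis
  proof (rule that[OF C0])
    fix \<epsilon> :: real and z :: "real \<times> real" assume \<epsilon>: "0 < \<epsilon>" "\<epsilon> \<le> exp (-1)" and z: "\<delta> \<le> norm z"
    define r where "r = norm z"
    have r: "0 < r" using z assms(1) unfolding r_def by linarith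
    have "r\<^sup>2 = (fst z)\<^sup>2 + (snd z)\<^sup>2" by (simp add: r_def norm_prod_def)
    moreover have "(snd z / r)\<^sup>2 + (- fst z / r)\<^sup>2 = ((fst z)\<^sup>2 + (snd z)\<^sup>2) / r\<^sup>2"
      by (simp add: power_divide add_divide_distrib)
    ultimately have "(snd z / r)\<^sup>2 + (- fst z / r)\<^sup>2 = 1" using r by (metis divide_self less_irrefl zero_less_power)
    then obtain \<beta> where \<beta>: "0 \<le> \<beta>" "\<beta> < 2 * pi" "snd z / r = cos \<beta>" "- fst z / r = sin \<beta>"
      using sincos_total_2pi by blast
    have zi: "dir \<alpha> \<bullet> z = r * sin (\<alpha> - \<beta>)" for \<alpha>
    proof -
      have "fst z = - r * sin \<beta>" "snd z = r * cos \<beta>" using \<beta>(3,4) r by (auto simp: field_simps)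
      then show ?thesis by (simp add: dir_def inner_prod_def sin_diff algebra_simps)
    qed
    define B where "B i = (\<beta> - real i * pi) / (\<kappa> * \<epsilon>)" for i :: nat
    define n where "n = \<lfloor>pi / (2 * \<kappa> * \<epsilon>)\<rfloor>"
    have n: "0 \<le> n" using \<epsilon> assms by (simp add: n_def)
    let ?K = "{k::int. \<bar>of_int k * (\<kappa> * \<epsilon>)\<bar> \<le> pi / 2}"
    have K: "?K \<subseteq> {-n..n}"
    proof
      fix k assume "k \<in> ?K"
      then have "\<bar>of_int k\<bar> * (\<kappa> * \<epsilon>) \<le> pi / 2" using assms \<epsilon> by (simp add: abs_mult)
      then have "\<bar>of_int k :: real\<bar> \<le> pi / (2 * \<kappa> * \<epsilon>)" using assms \<epsilon> by (simp add: field_simps)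
      then have "\<bar>k\<bar> \<le> n" unfolding n_def by (simp add: le_floor_iff)
      then show "k \<in> {-n..n}" by auto
    qed
    have bnd: "1 / (1 + \<bar>dir (of_int k * (\<kappa> * \<epsilon>)) \<bullet> z\<bar> / \<epsilon>) \<le> (\<Sum>i<3. 1 / (1 + c * \<bar>of_int k - B i\<bar>))"
      if "k \<in> ?K" for k
    proof -
      define \<alpha> where "\<alpha> = of_int k * (\<kappa> * \<epsilon>)"
      have \<alpha>: "\<bar>\<alpha>\<bar> \<le> pi / 2" using that by (simp add: \<alpha>_def)
      \<comment> \<open>Since \<alpha> is in [-pi/2, pi/2] and \<beta> in [0, 2 pi), the difference
        \<alpha> - \<beta> is within pi/2 of one of the zeros 0, -pi, -2 pi of the sine.\<close>
      obtain i :: nat where i: "i < 3" "\<bar>\<alpha> - (\<beta> - real i * pi)\<bar> \<le> pi / 2"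
      proof -
        consider "\<alpha> - \<beta> \<ge> - (pi / 2)" | "\<alpha> - \<beta> < - (pi / 2)" "\<alpha> - \<beta> \<ge> - (3 * pi / 2)" | "\<alpha> - \<beta> < - (3 * pi / 2)"
          by linarith
        then show ?thesis
        proof cases
          case 1 then have "\<bar>\<alpha> - (\<beta> - 0 * pi)\<bar> \<le> pi / 2" using \<alpha> \<beta>(1,2) by linarith
          then show ?thesis using that[of 0] by simp
        next
          case 2 then have "\<bar>\<alpha> - (\<beta> - 1 * pi)\<bar> \<le> pi / 2" using \<alpha> \<beta>(1,2) by linarith
          then show ?thesis using that[of 1] by simp
        next
          case 3 then have "\<bar>\<alpha> - (\<beta> - 2 * pi)\<bar> \<le> pi / 2" using \<alpha> \<beta>(1,2) by linarith
          then show ?thesis using that[of 2] by simp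
        qed
      qed
      have "\<bar>sin (\<alpha> - (\<beta> - real i * pi))\<bar> = \<bar>sin (\<alpha> - \<beta>)\<bar>"
      proof -
        have "sin (\<alpha> - (\<beta> - real i * pi)) = sin ((\<alpha> - \<beta>) + real i * pi)"
          by (rule arg_cong[where f = sin]) simp
        also have "\<dots> = sin (\<alpha> - \<beta>) * (-1) ^ i" unfolding sin_add by simp
        finally show ?thesis by (simp only: abs_mult power_abs) simp
      qed
      then have "2 / pi * \<bar>\<alpha> - (\<beta> - real i * pi)\<bar> \<le> \<bar>sin (\<alpha> - \<beta>)\<bar>"
        using jordan_sin[OF i(2)] by simp
      then have "\<delta> * (2 / pi * \<bar>\<alpha> - (\<beta> - real i * pi)\<bar>) \<le> r * \<bar>sin (\<alpha> - \<beta>)\<bar>"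
        using z assms by (intro mult_mono) (auto simp: r_def)
      also have "\<dots> = \<bar>dir \<alpha> \<bullet> z\<bar>" using r by (simp add: zi abs_mult)
      finally have "\<delta> * (2 / pi * \<bar>\<alpha> - (\<beta> - real i * pi)\<bar>) / \<epsilon> \<le> \<bar>dir \<alpha> \<bullet> z\<bar> / \<epsilon>"
        using \<epsilon> by (intro divide_right_mono) auto
      moreover have "\<delta> * (2 / pi * \<bar>\<alpha> - (\<beta> - real i * pi)\<bar>) / \<epsilon> = c * \<bar>of_int k - B i\<bar>"
      proof -
        have "\<alpha> - (\<beta> - real i * pi) = (\<kappa> * \<epsilon>) * (of_int k - B i)"
          using assms \<epsilon> by (simp add: \<alpha>_def B_def field_simps)
        then have "\<bar>\<alpha> - (\<beta> - real i * pi)\<bar> = (\<kappa> * \<epsilon>) * \<bar>of_int k - B i\<bar>"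
          using assms \<epsilon> by (simp add: abs_mult)
        then show ?thesis using \<epsilon> by (simp add: c_def)
      qed
      ultimately have "1 / (1 + \<bar>dir \<alpha> \<bullet> z\<bar> / \<epsilon>) \<le> 1 / (1 + c * \<bar>of_int k - B i\<bar>)"
        using c \<epsilon> by (intro divide_left_mono mult_pos_pos) (auto intro!: add_pos_nonneg)
      also have "\<dots> \<le> (\<Sum>i<3. 1 / (1 + c * \<bar>of_int k - B i\<bar>))"
        using i(1) c by (intro member_le_sum) (auto intro!: add_nonneg_nonneg)
      finally show ?thesis by (simp add: \<alpha>_def)
    qed
    \<comment> \<open>Here \<epsilon> \<le> exp (-1) enters: constants can be absorbed into the
      logarithm.\<close>
    have L: "1 \<le> ln (1 / \<epsilon>)"
      using \<epsilon> ln_le_cancel_iff[of \<epsilon> "exp (-1)"] by (simp add: ln_div)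
    have "1 + ln (of_int (2 * n + 1)) \<le> (2 + ln (pi / \<kappa> + 1)) * ln (1 / \<epsilon>)"
    proof -
      have "of_int n \<le> pi / (2 * \<kappa> * \<epsilon>)" by (simp add: n_def)
      then have "of_int (2 * n + 1) \<le> pi / \<kappa> * (1 / \<epsilon>) + 1" by (simp add: field_simps)
      also have "\<dots> \<le> (pi / \<kappa> + 1) * (1 / \<epsilon>)"
      proof -
        have "\<epsilon> \<le> 1" using \<epsilon>(2) order_trans[of \<epsilon> "exp (-1)" 1] by simp
        then show ?thesis using \<epsilon>(1) assms(2) by (simp add: field_simps)
      qed
      finally have "ln (of_int (2 * n + 1)) \<le> ln ((pi / \<kappa> + 1) * (1 / \<epsilon>))"
        using n by (subst ln_le_cancel_iff) auto
      also have "\<dots> = ln (pi / \<kappa> + 1) + ln (1 / \<epsilon>)"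
        using \<epsilon> assms by (intro ln_mult_pos) (auto simp: add_pos_pos)
      finally have "1 + ln (of_int (2 * n + 1)) \<le> ln (1 / \<epsilon>) + (ln (pi / \<kappa> + 1) * 1 + ln (1 / \<epsilon>))"
        using L by simp
      also have "\<dots> \<le> ln (1 / \<epsilon>) + (ln (pi / \<kappa> + 1) * ln (1 / \<epsilon>) + ln (1 / \<epsilon>))"
        using L \<open>0 \<le> ln (pi / \<kappa> + 1)\<close> by (intro add_mono mult_left_mono) auto
      finally show ?thesis by (simp add: algebra_simps)
    qed
    then have ln3: "3 * (M * (2 * (1 + ln (of_int (2 * n + 1))))) \<le> C * ln (1 / \<epsilon>)"
    proof -
      assume "1 + ln (of_int (2 * n + 1)) \<le> (2 + ln (pi / \<kappa> + 1)) * ln (1 / \<epsilon>)"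
      then have "3 * (M * (2 * (1 + ln (of_int (2 * n + 1))))) \<le> 3 * (M * (2 * ((2 + ln (pi / \<kappa> + 1)) * ln (1 / \<epsilon>))))"
        by (intro mult_left_mono) (auto simp: M_def)
      then show ?thesis by (simp only: C_def mult.assoc)
    qed
    have "(\<Sum>k\<in>?K. 1 / (1 + \<bar>dir (of_int k * (\<kappa> * \<epsilon>)) \<bullet> z\<bar> / \<epsilon>))
      \<le> (\<Sum>k\<in>?K. \<Sum>i<3. 1 / (1 + c * \<bar>of_int k - B i\<bar>))"
      by (rule sum_mono[OF bnd])
    also have "\<dots> \<le> (\<Sum>k\<in>{-n..n}. \<Sum>i<3. 1 / (1 + c * \<bar>of_int k - B i\<bar>))"
      using c by (intro sum_mono2 K sum_nonneg) (auto intro!: add_nonneg_nonneg)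
    also have "\<dots> = (\<Sum>i<3. \<Sum>k\<in>{-n..n}. 1 / (1 + c * \<bar>of_int k - B i\<bar>))"
      by (rule sum.swap)
    also have "\<dots> \<le> (\<Sum>i<(3::nat). M * (2 * (1 + ln (of_int (2 * n + 1)))))"
      unfolding M_def by (intro sum_mono sum_inverse_dist_real n c)
    also have "\<dots> \<le> C * ln (1 / \<epsilon>)" using ln3 by simp
    finally show "(\<Sum>k\<in>?K. 1 / (1 + \<bar>dir (of_int k * (\<kappa> * \<epsilon>)) \<bullet> z\<bar> / \<epsilon>)) \<le> C * ln (1 / \<epsilon>)" .
  qed
qed

section \<open>Integrals of a derivative over superlevel sets\<close>

text \<open>Between consecutive zeros \<open>h\<close> has constant sign, so the superlevel set
  consists of whole gaps between zeros, up to finitely many points, and each gap leaves only values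
  of \<open>K\<close> at its ends. An interior zero borders two gaps, hence the factor 2. The
  induction splits the interval at one zero.\<close>

lemma has_integral_superlevel:
  fixes K k h :: "real \<Rightarrow> real"
  assumes "b \<le> c" "continuous_on {b..c} h" "finite {z\<in>{b<..<c}. h z = 0}"
    "\<And>x. x \<in> {b..c} \<Longrightarrow> (K has_vector_derivative k x) (at x within {b..c})"
  shows "\<exists>I. ((\<lambda>x. if 0 < h x then k x else 0) has_integral I) {b..c} \<and>
    \<bar>I\<bar> \<le> \<bar>K b\<bar> + \<bar>K c\<bar> + 2 * (\<Sum>z\<in>{z\<in>{b<..<c}. h z = 0}. \<bar>K z\<bar>)"
  using assms
proof (induction "card {z\<in>{b<..<c}. h z = 0}" arbitrary: b c rule: less_induct)
  case less
  let ?Z = "\<lambda>b c. {z\<in>{b<..<c}. h z = 0}"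
  show ?case
  proof (cases "?Z b c = {}")
    case True
    have s0: "(\<Sum>z\<in>?Z b c. \<bar>K z\<bar>) = 0" unfolding True by simp
    have ftc: "(k has_integral (K c - K b)) {b..c}"
      using less.prems by (intro fundamental_theorem_of_calculus) auto
    have sgn: "(\<forall>x\<in>{b<..<c}. 0 < h x) \<or> (\<forall>x\<in>{b<..<c}. \<not> 0 < h x)"
    proof (rule ccontr)
      assume "\<not> ?thesis"
      then obtain p q where pq: "p \<in> {b<..<c}" "q \<in> {b<..<c}" "h p \<le> 0" "0 < h q" by force
      have cont: "continuous_on S h" if "S \<subseteq> {b..c}" for S
        using less.prems(2) that by (rule continuous_on_subset)
      have "\<exists>z\<in>{b<..<c}. h z = 0"
      proof (cases "p \<le> q")
        case True
        then obtain z where "p \<le> z" "z \<le> q" "h z = 0"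
          using IVT'[of h p 0 q] pq cont[of "{p..q}"] by auto
        then show ?thesis using pq by (intro bexI[of _ z]) auto
      next
        case False
        then obtain z where "q \<le> z" "z \<le> p" "h z = 0"
          using IVT2'[of h p 0 q] pq cont[of "{q..p}"] by auto
        then show ?thesis using pq by (intro bexI[of _ z]) auto
      qed
      then show False using True by auto
    qed
    then show ?thesis
    proof
      assume pos: "\<forall>x\<in>{b<..<c}. 0 < h x"
      have "((\<lambda>x. if 0 < h x then k x else 0) has_integral (K c - K b)) {b..c}"
        by (rule has_integral_spike_finite[OF _ _ ftc, of "{b, c}"]) (use pos in auto)
      then show ?thesis unfolding s0 by (intro exI[of _ "K c - K b"] conjI) auto
    next
      assume neg: "\<forall>x\<in>{b<..<c}. \<not> 0 < h x"
      have "((\<lambda>x. if 0 < h x then k x else 0) has_integral 0) {b..c}"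
        by (rule has_integral_spike_finite[of "{b, c}" _ _ "\<lambda>_. 0"]) (use neg in auto)
      then show ?thesis unfolding s0 by (intro exI[of _ 0] conjI) auto
    qed
  next
    case False
    then obtain p where p: "b < p" "p < c" "h p = 0" by auto
    have sub: "?Z b p \<subset> ?Z b c" "?Z p c \<subset> ?Z b c" using p by (auto simp: psubset_eq)
    have split: "?Z b c = insert p (?Z b p \<union> ?Z p c)" using p by auto
    have fin: "finite (?Z b p)" "finite (?Z p c)"
      using sub less.prems(3) by (meson finite_subset psubset_imp_subset)+
    have cont: "continuous_on {b..p} h" "continuous_on {p..c} h"
      using p by (auto intro: continuous_on_subset[OF less.prems(2)])
    have der: "(K has_vector_derivative k x) (at x within {b..p})" if "x \<in> {b..p}" for x
      using that p by (intro has_vector_derivative_within_subset[OF less.prems(4)]) auto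
    have der': "(K has_vector_derivative k x) (at x within {p..c})" if "x \<in> {p..c}" for x
      using that p by (intro has_vector_derivative_within_subset[OF less.prems(4)]) auto
    obtain I1 where I1: "((\<lambda>x. if 0 < h x then k x else 0) has_integral I1) {b..p}"
      "\<bar>I1\<bar> \<le> \<bar>K b\<bar> + \<bar>K p\<bar> + 2 * (\<Sum>z\<in>?Z b p. \<bar>K z\<bar>)"
      using less.hyps[OF psubset_card_mono[OF less.prems(3) sub(1)] _ cont(1) fin(1) der] p by auto
    obtain I2 where I2: "((\<lambda>x. if 0 < h x then k x else 0) has_integral I2) {p..c}"
      "\<bar>I2\<bar> \<le> \<bar>K p\<bar> + \<bar>K c\<bar> + 2 * (\<Sum>z\<in>?Z p c. \<bar>K z\<bar>)"
      using less.hyps[OF psubset_card_mono[OF less.prems(3) sub(2)] _ cont(2) fin(2) der'] p by auto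
    have "(\<Sum>z\<in>?Z b c. \<bar>K z\<bar>) = \<bar>K p\<bar> + ((\<Sum>z\<in>?Z b p. \<bar>K z\<bar>) + (\<Sum>z\<in>?Z p c. \<bar>K z\<bar>))"
      unfolding split using fin by (subst sum.insert) (auto intro!: sum.union_disjoint)
    then have "\<bar>I1 + I2\<bar> \<le> \<bar>K b\<bar> + \<bar>K c\<bar> + 2 * (\<Sum>z\<in>?Z b c. \<bar>K z\<bar>)"
      using I1(2) I2(2) by linarith
    moreover have "((\<lambda>x. if 0 < h x then k x else 0) has_integral (I1 + I2)) {b..c}"
      using has_integral_combine[OF _ _ I1(1) I2(1)] p by simp
    ultimately show ?thesis by blast
  qed
qed

section \<open>Geometry of the curve\<close>

definition ndir :: "real \<Rightarrow> real \<times> real" where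
  "ndir \<alpha> = (- sin \<alpha>, cos \<alpha>)"

lemma dir_dir: "dir \<alpha> \<bullet> dir \<beta> = cos (\<alpha> - \<beta>)"
  and ndir_ndir: "ndir \<alpha> \<bullet> ndir \<beta> = cos (\<alpha> - \<beta>)"
  and dir_ndir: "dir \<alpha> \<bullet> ndir \<beta> = sin (\<alpha> - \<beta>)"
  and ndir_dir: "ndir \<beta> \<bullet> dir \<alpha> = sin (\<alpha> - \<beta>)"
  by (auto simp: dir_def ndir_def inner_prod_def cos_diff sin_diff)

lemma orthonormal_expansion: "v = (v \<bullet> dir \<alpha>) *\<^sub>R dir \<alpha> + (v \<bullet> ndir \<alpha>) *\<^sub>R ndir \<alpha>"
proof -
  have s: "sin \<alpha> * sin \<alpha> = 1 - cos \<alpha> * cos \<alpha>"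
    using sin_cos_squared_add[of \<alpha>] by (simp add: power2_eq_square)
  show ?thesis
    by (rule prod_eqI) (simp_all add: dir_def ndir_def inner_prod_def algebra_simps s)
qed

lemma dir_has_vector_derivative: "(dir has_vector_derivative ndir \<theta>) (at \<theta> within S)"
  unfolding dir_def[abs_def] ndir_def
  by (intro has_vector_derivative_Pair)
    (auto intro!: derivative_eq_intros simp: has_real_derivative_iff_has_vector_derivative[symmetric])

lemma ndir_has_vector_derivative: "(ndir has_vector_derivative - dir \<theta>) (at \<theta> within S)"
  unfolding ndir_def[abs_def] dir_def uminus_prod_def
  by (intro has_vector_derivative_Pair)
    (auto intro!: derivative_eq_intros simp: has_real_derivative_iff_has_vector_derivative[symmetric])

lemma continuous_on_dir: "continuous_on S dir" and continuous_on_ndir: "continuous_on S ndir"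
  using has_vector_derivative_continuous[OF dir_has_vector_derivative]
    has_vector_derivative_continuous[OF ndir_has_vector_derivative]
  by (auto simp: continuous_on_eq_continuous_within)

lemma inner_has_real_derivative:
  assumes "(u has_vector_derivative u') (at x within S)" "(v has_vector_derivative v') (at x within S)"
  shows "((\<lambda>x. u x \<bullet> v x) has_real_derivative (u x \<bullet> v' + u' \<bullet> v x)) (at x within S)"
  unfolding has_field_derivative_def
  by (rule has_derivative_eq_rhs[OF has_derivative_inner[OF assms[unfolded has_vector_derivative_def]]])
    (auto simp: fun_eq_iff algebra_simps)

lemma inner_const_has_real_derivative:
  assumes "(u has_vector_derivative u') (at x within S)"
  shows "((\<lambda>x. u x \<bullet> c) has_real_derivative (u' \<bullet> c)) (at x within S)"
  using inner_has_real_derivative[OF assms has_vector_derivative_const[of c]] by simp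

text \<open>The velocity is orthogonal to \<open>dir \<theta>\<close>, hence a multiple
  \<open>r\<close> of \<open>ndir \<theta>\<close>. Differentiating the orthogonality gives r = -
  \<open>dir \<theta> \<bullet> y2 \<theta>\<close>, minus the radius of curvature; compactness
  makes the sign uniform.\<close>

lemma normal_angle_param_velocity:
  assumes "normal_angle_param S a y"
  obtains r r0 where "continuous_on {-a..a} r" "0 < r0" "\<And>\<theta>. \<theta> \<in> {-a..a} \<Longrightarrow> r \<theta> \<le> - r0"
    "\<And>\<theta>. \<theta> \<in> {-a..a} \<Longrightarrow> (y has_vector_derivative r \<theta> *\<^sub>R ndir \<theta>) (at \<theta> within {-a..a})"
proof -
  obtain y1 y2 where a: "0 < a" and y: "\<And>\<theta>. \<theta> \<in> {-a..a} \<Longrightarrow> (y has_vector_derivative y1 \<theta>) (at \<theta> within {-a..a})"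
    and y1: "\<And>\<theta>. \<theta> \<in> {-a..a} \<Longrightarrow> (y1 has_vector_derivative y2 \<theta>) (at \<theta> within {-a..a})"
    and orth: "\<And>\<theta>. \<theta> \<in> {-a..a} \<Longrightarrow> y1 \<theta> \<bullet> dir \<theta> = 0"
    and pos: "\<And>\<theta>. \<theta> \<in> {-a..a} \<Longrightarrow> dir \<theta> \<bullet> y2 \<theta> > 0"
    using assms unfolding normal_angle_param_def by blast
  define r where "r \<theta> = y1 \<theta> \<bullet> ndir \<theta>" for \<theta>
  have "y1 \<theta> = r \<theta> *\<^sub>R ndir \<theta>" if "\<theta> \<in> {-a..a}" for \<theta>
    using orthonormal_expansion[of "y1 \<theta>" \<theta>] orth[OF that] by (simp add: r_def)
  then have yd: "(y has_vector_derivative r \<theta> *\<^sub>R ndir \<theta>) (at \<theta> within {-a..a})" if "\<theta> \<in> {-a..a}" for \<theta>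
    using y[OF that] that by simp
  have rc: "continuous_on {-a..a} r"
    unfolding r_def
    using has_vector_derivative_continuous[OF y1]
    by (intro continuous_on_inner continuous_on_ndir) (simp add: continuous_on_eq_continuous_within)
  have neg: "r \<theta> < 0" if \<theta>: "\<theta> \<in> {-a..a}" for \<theta>
  proof -
    have "((\<lambda>\<theta>. y1 \<theta> \<bullet> dir \<theta>) has_real_derivative (y1 \<theta> \<bullet> ndir \<theta> + y2 \<theta> \<bullet> dir \<theta>)) (at \<theta> within {-a..a})"
      by (rule inner_has_real_derivative[OF y1[OF \<theta>] dir_has_vector_derivative])
    then have "((\<lambda>\<theta>. y1 \<theta> \<bullet> dir \<theta>) has_vector_derivative (y1 \<theta> \<bullet> ndir \<theta> + y2 \<theta> \<bullet> dir \<theta>)) (at \<theta> within cbox (-a) a)"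
      by (simp add: has_real_derivative_iff_has_vector_derivative)
    moreover have "((\<lambda>\<theta>. y1 \<theta> \<bullet> dir \<theta>) has_vector_derivative 0) (at \<theta> within cbox (-a) a)"
      by (rule has_vector_derivative_transform[where f = "\<lambda>_. 0"]) (use \<theta> orth in auto)
    ultimately have "y1 \<theta> \<bullet> ndir \<theta> + y2 \<theta> \<bullet> dir \<theta> = 0"
      by (rule vector_derivative_unique_within_closed_interval[rotated 2]) (use a \<theta> in auto)
    then show ?thesis using pos[OF \<theta>] by (simp add: r_def inner_commute)
  qed
  obtain \<theta>m where "\<theta>m \<in> {-a..a}" "\<And>\<theta>. \<theta> \<in> {-a..a} \<Longrightarrow> r \<theta> \<le> r \<theta>m"
    using continuous_attains_sup[OF compact_Icc _ rc] a by auto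
  then show ?thesis using neg by (intro that[OF rc, of "- r \<theta>m"] yd) auto
qed

text \<open>Any differentiable arc in the curve has its velocity along the tangent of the chart, so a
  closed parametrization cannot have a corner where its two ends meet.\<close>

lemma C4_chart_tangent:
  assumes chart: "C4_chart S U I g" and h: "homeomorphism I (S \<inter> U) (g 0) h" and z: "z \<in> S" "z \<in> U"
    and y: "y ` T \<subseteq> S" "\<theta>0 \<in> T" "y \<theta>0 = z" "at \<theta>0 within T \<noteq> bot"
    and yd: "(y has_vector_derivative v) (at \<theta>0 within T)"
    and n: "n \<bullet> g 1 (h z) = 0"
  shows "n \<bullet> v = 0"
proof -
  define t0 where "t0 = h z"
  let ?g = "\<lambda>c t. (g 0 t \<bullet> c - g 0 t0 \<bullet> c) / (t - t0)" and ?y = "\<lambda>c \<theta>. (y \<theta> \<bullet> c - y \<theta>0 \<bullet> c) / (\<theta> - \<theta>0)"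
  define m where "m = g 1 t0"
  have t0: "t0 \<in> I" "g 0 t0 = z" using h z by (auto simp: homeomorphism_def t0_def)
  have U: "open U" using chart by (auto simp: C4_chart_def)
  have m0: "m \<bullet> m > 0" using chart t0 by (auto simp: C4_chart_def m_def)
  have gd: "(g 0 has_vector_derivative m) (at t0 within I)"
    using chart t0 by (auto simp: C4_chart_def m_def)
  \<comment> \<open>Near \<open>z\<close>, displacements within the curve along \<open>n\<close> are
    at most \<open>e\<close> times those along the chart tangent \<open>m\<close>. Any arc in the
    curve inherits this, and so does its velocity.\<close>
  have bound: "\<bar>v \<bullet> n\<bar> \<le> e * \<bar>v \<bullet> m\<bar>" if e: "e > 0" for e
  proof -
    have "((\<lambda>t. ?g n t) \<longlongrightarrow> m \<bullet> n) (at t0 within I)"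
      using inner_const_has_real_derivative[OF gd, of n] by (simp add: has_field_derivative_iff)
    then have "((\<lambda>t. \<bar>?g n t\<bar>) \<longlongrightarrow> 0) (at t0 within I)"
      using n by (intro tendsto_rabs_zero) (simp add: m_def t0_def inner_commute)
    moreover have "((\<lambda>t. e * \<bar>?g m t\<bar>) \<longlongrightarrow> e * \<bar>m \<bullet> m\<bar>) (at t0 within I)"
      using inner_const_has_real_derivative[OF gd, of m]
      by (intro tendsto_intros) (simp add: has_field_derivative_iff)
    ultimately have "((\<lambda>t. e * \<bar>?g m t\<bar> - \<bar>?g n t\<bar>)
        \<longlongrightarrow> e * \<bar>m \<bullet> m\<bar> - 0) (at t0 within I)"
      by (rule tendsto_diff[rotated])
    moreover have "0 < e * \<bar>m \<bullet> m\<bar> - 0" using e m0 by simp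
    ultimately have "\<forall>\<^sub>F t in at t0 within I. 0 < e * \<bar>?g m t\<bar> - \<bar>?g n t\<bar>"
      by (rule order_tendstoD(1))
    then obtain d where d: "d > 0" and dd: "\<And>t. t \<in> I \<Longrightarrow> t \<noteq> t0 \<Longrightarrow> dist t t0 < d \<Longrightarrow>
        0 < e * \<bar>?g m t\<bar> - \<bar>?g n t\<bar>"
      unfolding eventually_at by blast
    have near: "\<bar>(p - z) \<bullet> n\<bar> \<le> e * \<bar>(p - z) \<bullet> m\<bar>" if p: "p \<in> S \<inter> U" "dist (h p) t0 < d" for p
    proof (cases "h p = t0")
      case True
      then have "p = z" using h p z by (metis IntI homeomorphism_def t0_def)
      then show ?thesis by simp
    next
      case False
      have "h p \<in> I" "g 0 (h p) = p" using h p by (auto simp: homeomorphism_def)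
      then have "\<bar>(p \<bullet> n - z \<bullet> n) / (h p - t0)\<bar> < e * \<bar>(p \<bullet> m - z \<bullet> m) / (h p - t0)\<bar>"
        using dd[of "h p"] False p t0 by auto
      then have "\<bar>(p - z) \<bullet> n\<bar> / \<bar>h p - t0\<bar> < (e * \<bar>(p - z) \<bullet> m\<bar>) / \<bar>h p - t0\<bar>"
        by (simp only: abs_divide inner_diff_left times_divide_eq_right)
      then show ?thesis by (auto simp: divide_less_cancel)
    qed
    have yc: "(y \<longlongrightarrow> z) (at \<theta>0 within T)"
      using has_vector_derivative_continuous[OF yd] y by (simp add: continuous_within)
    have ev1: "\<forall>\<^sub>F \<theta> in at \<theta>0 within T. y \<theta> \<in> S \<inter> U"
    proof -
      have "\<forall>\<^sub>F \<theta> in at \<theta>0 within T. \<theta> \<in> T" by (simp add: eventually_at_filter)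
      with topological_tendstoD[OF yc U z(2)] show ?thesis
        by eventually_elim (use y(1) in auto)
    qed
    \<comment> \<open>Continuity of the inverse chart: curve points close to \<open>z\<close> have
      chart parameters close to \<open>t0\<close>, so the chart's difference quotients apply to
      them.\<close>
    have "continuous (at z within S \<inter> U) h"
      using h z by (auto simp: homeomorphism_def continuous_on_eq_continuous_within)
    then obtain d' where d': "d' > 0" "\<And>p. p \<in> S \<inter> U \<Longrightarrow> dist p z < d' \<Longrightarrow> dist (h p) t0 < d"
      unfolding continuous_within_eps_delta t0_def using d by blast
    have ev2: "\<forall>\<^sub>F \<theta> in at \<theta>0 within T. dist (y \<theta>) z < d'"
      using tendstoD[OF yc d'(1)] .
    have "\<forall>\<^sub>F \<theta> in at \<theta>0 within T. \<bar>?y n \<theta>\<bar> \<le> e * \<bar>?y m \<theta>\<bar>"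
      using ev1 ev2
    proof eventually_elim
      case (elim \<theta>)
      then have "\<bar>(y \<theta> - z) \<bullet> n\<bar> \<le> e * \<bar>(y \<theta> - z) \<bullet> m\<bar>" using near d' by blast
      then have "\<bar>(y \<theta> - z) \<bullet> n\<bar> / \<bar>\<theta> - \<theta>0\<bar> \<le> e * \<bar>(y \<theta> - z) \<bullet> m\<bar> / \<bar>\<theta> - \<theta>0\<bar>"
        by (rule divide_right_mono) simp
      then show ?case by (simp add: y inner_diff_left)
    qed
    moreover have "((\<lambda>\<theta>. \<bar>?y n \<theta>\<bar>) \<longlongrightarrow> \<bar>v \<bullet> n\<bar>) (at \<theta>0 within T)"
      using inner_const_has_real_derivative[OF yd, of n]
      by (intro tendsto_intros) (simp add: has_field_derivative_iff)
    moreover have "((\<lambda>\<theta>. e * \<bar>?y m \<theta>\<bar>) \<longlongrightarrow> e * \<bar>v \<bullet> m\<bar>) (at \<theta>0 within T)"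
      using inner_const_has_real_derivative[OF yd, of m]
      by (intro tendsto_intros) (simp add: has_field_derivative_iff)
    ultimately show ?thesis using tendsto_le[OF y(4)] by blast
  qed
  have "\<bar>v \<bullet> n\<bar> \<le> 0"
  proof (rule field_le_epsilon)
    fix e :: real assume "0 < e"
    then have "\<bar>v \<bullet> n\<bar> \<le> e / (\<bar>v \<bullet> m\<bar> + 1) * \<bar>v \<bullet> m\<bar>"
      by (intro bound) (simp add: add_nonneg_pos)
    also have "\<dots> \<le> e" using \<open>0 < e\<close> by (simp add: field_simps add_nonneg_pos)
    finally show "\<bar>v \<bullet> n\<bar> \<le> 0 + e" by simp
  qed
  then show ?thesis by (simp add: inner_commute)
qed

text \<open>Both end velocities lie on the chart tangent, so \<open>ndir a\<close> and
  \<open>ndir (-a)\<close> are parallel and sin a = 0 or cos a = 0. In the second case the two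
  normals are opposite, and a point slightly off the curve would lie in both \<open>Dp\<close> and
  \<open>Dm\<close>.\<close>

lemma closed_param_normals_agree:
  assumes param: "normal_angle_param (singular_set f) a y" and curve: "C4_curve (singular_set f)"
    and jump: "jump_of f a y \<Delta>f" and cl: "y a = y (-a)"
  shows "dir a = dir (-a)"
proof -
  let ?S = "singular_set f"
  have a: "0 < a" and yS: "y ` {-a..a} \<subseteq> ?S" using param by (auto simp: normal_angle_param_def)
  obtain r r0 where r: "0 < r0" "\<And>\<theta>. \<theta> \<in> {-a..a} \<Longrightarrow> r \<theta> \<le> - r0"
    and yd: "\<And>\<theta>. \<theta> \<in> {-a..a} \<Longrightarrow> (y has_vector_derivative r \<theta> *\<^sub>R ndir \<theta>) (at \<theta> within {-a..a})"
    using normal_angle_param_velocity[OF param] by metis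
  have z: "y a \<in> ?S" using yS a by auto
  then obtain U I g where zU: "y a \<in> U" and chart: "C4_chart ?S U I g"
    using curve unfolding C4_curve_def by blast
  then obtain h where h: "homeomorphism I (?S \<inter> U) (g 0) h" unfolding C4_chart_def by blast
  define t0 where "t0 = h (y a)"
  have "t0 \<in> I" using h z zU by (auto simp: homeomorphism_def t0_def)
  then have g1: "g 1 t0 \<noteq> 0" using chart by (auto simp: C4_chart_def)
  define n where "n = (- snd (g 1 t0), fst (g 1 t0))"
  have n: "n \<bullet> g 1 t0 = 0" "n \<noteq> 0" using g1
    by (auto simp: n_def inner_prod_def zero_prod_def prod_eq_iff)
  have "n \<bullet> (r \<theta> *\<^sub>R ndir \<theta>) = 0" if "\<theta> \<in> {-a, a}" for \<theta>
  proof (rule C4_chart_tangent[OF chart h z zU yS])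
    show "at \<theta> within {-a..a} \<noteq> bot"
      using that a by (auto simp: trivial_limit_within islimpt_Icc)
  qed (use that a cl yd n in \<open>auto simp: t0_def\<close>)
  moreover have "r \<theta> \<noteq> 0" if "\<theta> \<in> {-a, a}" for \<theta> using r(2)[of \<theta>] r(1) that a by auto
  ultimately have nn: "n \<bullet> ndir a = 0" "n \<bullet> ndir (-a) = 0" by auto
  have "sin a * fst n = cos a * snd n" "sin a * fst n = - (cos a * snd n)"
    using nn by (auto simp: ndir_def inner_prod_def algebra_simps)
  then have sf: "sin a * fst n = 0" "cos a * snd n = 0" by auto
  have "sin a = 0 \<or> cos a = 0"
    using sf n(2) by (auto simp: prod_eq_iff)
  moreover have "cos a \<noteq> 0"
  proof
    assume c: "cos a = 0"
    obtain U Dm Dp fm fp where zU: "y a \<in> U" and two: "two_sided_on f U Dm Dp fm fp"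
      and side: "\<forall>\<theta>'\<in>{-a..a}. y \<theta>' \<in> U \<longrightarrow>
           (\<forall>\<^sub>F t in at_right 0. y \<theta>' + t *\<^sub>R dir \<theta>' \<in> Dp \<and> y \<theta>' - t *\<^sub>R dir \<theta>' \<in> Dm)"
    proof -
      have "a \<in> {-a..a}" using a by simp
      then show ?thesis using jump that unfolding jump_of_def by meson
    qed
    have "\<forall>\<^sub>F t in at_right (0::real). y a + t *\<^sub>R dir a \<in> Dp \<and> y a - t *\<^sub>R dir a \<in> Dm"
      "\<forall>\<^sub>F t in at_right (0::real). y a + t *\<^sub>R dir (-a) \<in> Dp \<and> y a - t *\<^sub>R dir (-a) \<in> Dm"
      using bspec[OF side, of a] bspec[OF side, of "-a"] zU a unfolding cl by auto
    then have "\<forall>\<^sub>F t in at_right (0::real). False"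
    proof eventually_elim
      case (elim t)
      have "y a - t *\<^sub>R dir (-a) = y a + t *\<^sub>R dir a" using c by (simp add: dir_def prod_eq_iff)
      then have "y a + t *\<^sub>R dir a \<in> Dm \<inter> Dp" using elim by (metis IntI)
      moreover have "Dm \<inter> Dp = {}" using two unfolding two_sided_on_def by blast
      ultimately show ?case by blast
    qed
    then show False by simp
  qed
  ultimately show ?thesis by (simp add: dir_def)
qed

text \<open>The local representations differ from point to point but each makes \<Delta>f
  continuously differentiable. Taking \<open>D\<close> from the Frechet derivative of \<Delta>f
  itself makes the local derivatives fit together on the union of all good open sets.\<close>

lemma jump_C1:
  assumes "jump_of f a y \<Delta>f"
  obtains \<Omega> D where "open \<Omega>" "y ` {-a..a} \<subseteq> \<Omega>"
    "\<And>x. x \<in> \<Omega> \<Longrightarrow> (\<Delta>f has_derivative blinfun_apply (D x)) (at x)" "continuous_on \<Omega> D"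
proof -
  define D where "D x = Blinfun (frechet_derivative \<Delta>f (at x))" for x
  have loc: "\<exists>U. open U \<and> y \<theta> \<in> U \<and> (\<forall>x\<in>U. (\<Delta>f has_derivative blinfun_apply (D x)) (at x)) \<and> continuous_on U D"
    if \<theta>: "\<theta> \<in> {-a..a}" for \<theta>
  proof -
    obtain U Dm Dp fm fp where U: "y \<theta> \<in> U" and two: "two_sided_on f U Dm Dp fm fp"
      and eq: "\<And>x. x \<in> U \<Longrightarrow> \<Delta>f x = fp x - fm x"
      using assms \<theta> unfolding jump_of_def by meson
    have opU: "open U" and "C2_on fm UNIV" "C2_on fp UNIV" using two by (auto simp: two_sided_on_def)
    then obtain m1 m2 p1 p2 where m: "\<And>x. (fm has_derivative blinfun_apply (m1 x)) (at x)"
      "\<And>x. (m1 has_derivative blinfun_apply (m2 x)) (at x)"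
      and p: "\<And>x. (fp has_derivative blinfun_apply (p1 x)) (at x)"
      "\<And>x. (p1 has_derivative blinfun_apply (p2 x)) (at x)"
      unfolding C2_on_def by auto
    have der: "(\<Delta>f has_derivative blinfun_apply (p1 x - m1 x)) (at x)" if "x \<in> U" for x
    proof -
      have "((\<lambda>x. fp x - fm x) has_derivative blinfun_apply (p1 x - m1 x)) (at x)"
        by (rule has_derivative_eq_rhs[OF has_derivative_diff[OF p(1) m(1)]]) (auto simp: fun_eq_iff blinfun.diff_left)
      then show ?thesis
        by (rule has_derivative_transform_within_open[OF _ opU that]) (simp add: eq)
    qed
    have D: "D x = p1 x - m1 x" if "x \<in> U" for x
      unfolding D_def using frechet_derivative_at[OF der[OF that]] blinfun_apply_inverse by metis
    have "continuous_on U (\<lambda>x. p1 x - m1 x)"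
      by (intro continuous_intros continuous_at_imp_continuous_on ballI has_derivative_continuous[OF p(2)]
          has_derivative_continuous[OF m(2)])
    then have "continuous_on U D" by (rule continuous_on_eq) (simp add: D)
    then show ?thesis using opU U der D by (intro exI[of _ U]) auto
  qed
  define \<Omega> where "\<Omega> = \<Union>{U. open U \<and> (\<forall>x\<in>U. (\<Delta>f has_derivative blinfun_apply (D x)) (at x)) \<and> continuous_on U D}"
  show ?thesis
  proof (rule that[of \<Omega> D])
    show "continuous_on \<Omega> D" unfolding \<Omega>_def by (rule continuous_on_open_Union) auto
  qed (use loc in \<open>fastforce simp: \<Omega>_def\<close>)+
qed

section \<open>Injectivity of the normal coordinates on a tube\<close>

text \<open>In the fixed direction \<open>ndir \<mu>\<close> the curve moves with speed r(x) cos (x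
  - \<mu>), which is at most -r0 cos 1 for parameters within 1 of \<mu>; the rest is the mean value
  theorem.\<close>

lemma chord_bound:
  assumes yd: "\<And>\<theta>. \<theta> \<in> T \<Longrightarrow> (y has_vector_derivative r \<theta> *\<^sub>R ndir \<theta>) (at \<theta> within T)"
    and r: "\<And>\<theta>. \<theta> \<in> T \<Longrightarrow> r \<theta> \<le> - r0" and r0: "0 \<le> r0"
    and pq: "{p..q} \<subseteq> T" "p \<le> q" "\<bar>p - \<mu>\<bar> \<le> 1" "\<bar>q - \<mu>\<bar> \<le> 1"
  shows "r0 * cos 1 * (q - p) \<le> (y p - y q) \<bullet> ndir \<mu>"
proof -
  have "((\<lambda>\<theta>. y \<theta> \<bullet> ndir \<mu>) has_derivative (*) (r x * cos (x - \<mu>))) (at x within {p..q})"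
    if "p \<le> x" "x \<le> q" for x
  proof -
    have "(y has_vector_derivative r x *\<^sub>R ndir x) (at x within {p..q})"
      using that pq(1) by (intro has_vector_derivative_within_subset[OF yd]) auto
    from inner_const_has_real_derivative[OF this, of "ndir \<mu>"] show ?thesis
      by (simp add: ndir_ndir has_field_derivative_def)
  qed
  then obtain x where x: "x \<in> {p..q}" "y q \<bullet> ndir \<mu> - y p \<bullet> ndir \<mu> = r x * cos (x - \<mu>) * (q - p)"
    using mvt_very_simple[OF pq(2), of "\<lambda>\<theta>. y \<theta> \<bullet> ndir \<mu>" "\<lambda>x. (*) (r x * cos (x - \<mu>))"] by blast
  have x1: "\<bar>x - \<mu>\<bar> \<le> 1" using x(1) pq by auto
  have "cos 1 \<le> cos \<bar>x - \<mu>\<bar>" using x1 pi_gt3 by (intro cos_monotone_0_pi_le) auto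
  then have c: "cos 1 \<le> cos (x - \<mu>)" by simp
  have "0 < cos (1::real)" using pi_gt3 by (intro cos_gt_zero) auto
  moreover have rx: "r x \<le> - r0" using r[of x] x(1) pq(1) by auto
  ultimately have "r0 * cos 1 \<le> (- r x) * cos (x - \<mu>)"
    using c r0 rx by (intro mult_mono) auto
  then have "r0 * cos 1 * (q - p) \<le> (- r x) * cos (x - \<mu>) * (q - p)"
    using pq by (intro mult_right_mono) auto
  then show ?thesis using x(2) by (simp add: inner_diff_left algebra_simps)
qed

text \<open>Each normal deviates from the normal at the midpoint angle by half the gap only, so
  short normals move a point along the midpoint tangent by little. Compared with the chord bound,
  they cannot bridge the distance between nearby base points.\<close>

lemma normal_displacement_bound:
  assumes "\<mu> = (p + q) / 2" "p < q" "\<bar>t\<bar> < \<delta>" "\<bar>s\<bar> < \<delta>"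
  shows "(s *\<^sub>R dir q - t *\<^sub>R dir p) \<bullet> ndir \<mu> < \<delta> * (q - p)"
proof -
  have "(s *\<^sub>R dir q - t *\<^sub>R dir p) \<bullet> ndir \<mu> = s * sin ((q - p) / 2) + t * sin ((q - p) / 2)"
  proof -
    have "q - \<mu> = (q - p) / 2" "p - \<mu> = - ((q - p) / 2)" using assms by (auto simp: field_simps)
    then show ?thesis by (simp only: inner_diff_left inner_scaleR_left dir_ndir sin_minus)
  qed
  also have "\<dots> \<le> \<bar>s\<bar> * ((q - p) / 2) + \<bar>t\<bar> * ((q - p) / 2)"
  proof -
    have "\<bar>u * sin ((q - p) / 2)\<bar> \<le> \<bar>u\<bar> * ((q - p) / 2)" for u
      using abs_sin_x_le_abs_x[of "(q - p) / 2"] assms(2) unfolding abs_mult by (intro mult_left_mono) auto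
    from this[of s] this[of t] show ?thesis by linarith
  qed
  also have "\<dots> < \<delta> * ((q - p) / 2) + \<delta> * ((q - p) / 2)"
    using assms by (intro add_strict_mono mult_strict_right_mono) auto
  finally show ?thesis by (simp add: field_simps)
qed

lemma tube_injective:
  assumes param: "normal_angle_param S a y" and closed: "y a = y (-a) \<Longrightarrow> dir a = dir (-a)"
  obtains \<delta> where "0 < \<delta>" "inj_on (\<lambda>(\<theta>, t). y \<theta> + t *\<^sub>R dir \<theta>) ({-a<..<a} \<times> {-\<delta><..<\<delta>})"
proof -
  obtain r r0 where r0: "0 < r0" and r: "\<And>\<theta>. \<theta> \<in> {-a..a} \<Longrightarrow> r \<theta> \<le> - r0"
    and yd: "\<And>\<theta>. \<theta> \<in> {-a..a} \<Longrightarrow> (y has_vector_derivative r \<theta> *\<^sub>R ndir \<theta>) (at \<theta> within {-a..a})"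
    using normal_angle_param_velocity[OF param] by metis
  have a: "0 < a" and inj: "inj_on y {-a..<a}" "inj_on y {-a<..a}"
    using param by (auto simp: normal_angle_param_def)
  have yc: "continuous_on {-a..a} y"
    using has_vector_derivative_continuous[OF yd] by (simp add: continuous_on_eq_continuous_within)
  define c where "c = r0 * cos 1"
  have c: "0 < c" unfolding c_def using r0 pi_gt3 by (intro mult_pos_pos cos_gt_zero) auto
  \<comment> \<open>Pairs of parameters that are far apart, where for a closed curve the two ends
    count as close. On this compact set the base points are distinct, so their distance has a
    positive minimum \<open>m\<close>.\<close>
  define P where "P = ({-a..a} \<times> {-a..a}) \<inter> {z. 1 \<le> \<bar>fst z - snd z\<bar> \<and> (y a = y (-a) \<longrightarrow> \<bar>fst z - snd z\<bar> \<le> 2 * a - 1)}"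
  have "compact P"
    unfolding P_def
    by (intro compact_Int_closed compact_Times compact_Icc)
      (cases "y a = y (-a)"; simp; intro closed_Collect_conj closed_Collect_le continuous_intros)
  have Pne: "y (fst z) \<noteq> y (snd z)" if "z \<in> P" for z
  proof
    assume e: "y (fst z) = y (snd z)"
    have ne: "fst z \<noteq> snd z" using that by (auto simp: P_def)
    have m: "fst z \<in> {-a..a}" "snd z \<in> {-a..a}" using that by (auto simp: P_def mem_Times_iff)
    have "\<not> (fst z \<in> {-a..<a} \<and> snd z \<in> {-a..<a})" "\<not> (fst z \<in> {-a<..a} \<and> snd z \<in> {-a<..a})"
      using inj e ne by (auto dest: inj_onD)
    then have "fst z = a \<and> snd z = -a \<or> fst z = -a \<and> snd z = a" using m ne by auto
    then show False using that e by (auto simp: P_def)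
  qed
  obtain m where m: "0 < m" "\<And>z. z \<in> P \<Longrightarrow> m \<le> norm (y (fst z) - y (snd z))"
  proof (cases "P = {}")
    case True then show ?thesis using that[of 1] by auto
  next
    case False
    have "continuous_on P (\<lambda>z. norm (y (fst z) - y (snd z)))"
      by (intro continuous_intros continuous_on_compose2[OF yc]) (auto simp: P_def)
    then obtain z0 where "z0 \<in> P" "\<And>z. z \<in> P \<Longrightarrow> norm (y (fst z0) - y (snd z0)) \<le> norm (y (fst z) - y (snd z))"
      using continuous_attains_inf[OF \<open>compact P\<close> False] by blast
    then show ?thesis using Pne by (intro that[of "norm (y (fst z0) - y (snd z0))"]) auto
  qed
  \<comment> \<open>With \<open>m / 2\<close> two normals are too short to join base points of a
    pair in \<open>P\<close>; with \<open>c\<close> they lose against the chord bound for close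
    pairs.\<close>
  define \<delta> where "\<delta> = min (m / 2) c"
  have \<delta>: "0 < \<delta>" "\<delta> \<le> m / 2" "\<delta> \<le> c" using m c by (auto simp: \<delta>_def)
  have main: False
    if pq: "p \<in> {-a<..<a}" "q \<in> {-a<..<a}" "p < q" and ts: "\<bar>t\<bar> < \<delta>" "\<bar>s\<bar> < \<delta>"
      and eq: "y p + t *\<^sub>R dir p = y q + s *\<^sub>R dir q" for p q t s
  proof -
    have yy: "y p - y q = s *\<^sub>R dir q - t *\<^sub>R dir p" using eq by (simp add: algebra_simps)
    consider "q - p \<le> 1" | "y a = y (-a)" "2 * a - 1 < q - p" | "(p, q) \<in> P"
      using pq unfolding P_def by fastforce
    then show False
    proof cases
      case 1
      define \<mu> where "\<mu> = (p + q) / 2"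
      have "c * (q - p) \<le> (y p - y q) \<bullet> ndir \<mu>"
        unfolding c_def by (rule chord_bound[OF yd r]) (use 1 pq r0 in \<open>auto simp: \<mu>_def abs_if field_simps\<close>)
      also have "\<dots> < \<delta> * (q - p)"
        unfolding yy by (rule normal_displacement_bound[OF \<mu>_def pq(3) ts])
      finally show False using \<delta>(3) pq(3) by (simp add: mult_less_cancel_right)
    next
      case 2
      have d: "dir a = dir (-a)" using closed 2 by blast
      \<comment> \<open>Past the common endpoint the curve continues with the angle shifted by \<open>2 * a\<close>.\<close>
      define p' where "p' = p + 2 * a"
      have "sin a = 0" using d by (simp add: dir_def)
      then have sc: "sin (2 * a) = 0" "cos (2 * a) = 1" by (simp_all add: sin_double cos_double_sin)
      have dp: "dir p' = dir p" by (simp add: p'_def dir_def sin_add cos_add sc)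
      define \<mu> where "\<mu> = (q + p') / 2"
      have nd: "ndir (\<mu> - 2 * a) = ndir \<mu>" by (simp add: ndir_def sin_diff cos_diff sc)
      have lt: "q < p'" "p' - q < 1" using 2 pq by (auto simp: p'_def)
      \<comment> \<open>The chord bound is applied to the two arcs from \<open>q\<close> to
        \<open>a\<close> and from \<open>-a\<close> to \<open>p\<close>, which meet at the common
        endpoint; their sum is the bound for the arc across the joint.\<close>
      have "c * (a - q) \<le> (y q - y a) \<bullet> ndir \<mu>"
        unfolding c_def by (rule chord_bound[OF yd r]) (use lt pq r0 in \<open>auto simp: \<mu>_def p'_def abs_if field_simps\<close>)
      moreover have "c * (p - (-a)) \<le> (y (-a) - y p) \<bullet> ndir (\<mu> - 2 * a)"
        unfolding c_def by (rule chord_bound[OF yd r]) (use lt pq r0 in \<open>auto simp: \<mu>_def p'_def abs_if field_simps\<close>)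
      ultimately have "c * (p' - q) \<le> (y q - y p) \<bullet> ndir \<mu>"
        unfolding nd using 2(1) by (simp add: p'_def inner_diff_left algebra_simps)
      also have "y q - y p = t *\<^sub>R dir p' - s *\<^sub>R dir q" using yy dp by (simp add: algebra_simps)
      also have "\<dots> \<bullet> ndir \<mu> < \<delta> * (p' - q)"
        by (rule normal_displacement_bound[OF \<mu>_def lt(1) ts(2,1)])
      finally show False using \<delta>(3) lt(1) by (simp add: mult_less_cancel_right)
    next
      case 3
      have "m \<le> norm (y p - y q)" using m(2)[OF 3] by simp
      also have "\<dots> \<le> \<bar>s\<bar> + \<bar>t\<bar>"
        unfolding yy using norm_triangle_ineq4[of "s *\<^sub>R dir q" "t *\<^sub>R dir p"] by simp
      finally show False using ts \<delta>(2) by linarith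
    qed
  qed
  show ?thesis
  proof (rule that[OF \<delta>(1)], rule inj_onI, clarsimp)
    fix p t q s
    assume *: "- a < p" "p < a" "- \<delta> < t" "t < \<delta>" "- a < q" "q < a" "- \<delta> < s" "s < \<delta>"
      "y p + t *\<^sub>R dir p = y q + s *\<^sub>R dir q"
    have "p = q"
    proof (rule ccontr)
      assume "p \<noteq> q"
      then consider "p < q" | "q < p" by linarith
      then show False
        using main[of p q t s] main[of q p s t] * by cases (auto simp: abs_less_iff)
    qed
    moreover have "dir q \<noteq> 0" by (metis dir_dir diff_self cos_zero inner_zero_left zero_neq_one)
    ultimately show "p = q \<and> t = s" using * by auto
  qed
qed

section \<open>Change of variables in the plane\<close>

text \<open>The change of variables theorem used below is formulated on \<open>real^'n\<close>;
  these isometric identifications carry it over to pairs.\<close>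

definition pair_of_vec :: "real^2 \<Rightarrow> real \<times> real" where
  "pair_of_vec v = (v $ 1, v $ 2)"

definition vec_of_pair :: "real \<times> real \<Rightarrow> real^2" where
  "vec_of_pair p = vector [fst p, snd p]"

lemma pair_vec [simp]: "pair_of_vec (vec_of_pair p) = p" "vec_of_pair (pair_of_vec v) = v"
  by (auto simp: pair_of_vec_def vec_of_pair_def vec_eq_iff forall_2)

lemma bounded_linear_pair_of_vec: "bounded_linear pair_of_vec"
  unfolding pair_of_vec_def[abs_def] by (intro bounded_linear_Pair bounded_linear_vec_nth)

lemma bounded_linear_vec_of_pair: "bounded_linear vec_of_pair"
  by (intro linear_conv_bounded_linear[THEN iffD1] linearI)
    (auto simp: vec_of_pair_def vec_eq_iff forall_2)

text \<open>Lebesgue measure is determined by the volume of boxes, and a box pulls back to a box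
  with the same side lengths.\<close>

lemma distr_pair_of_vec: "distr lborel borel pair_of_vec = lborel"
proof (rule lborel_eqI[symmetric])
  have [measurable]: "pair_of_vec \<in> borel_measurable borel"
    by (intro borel_measurable_continuous_onI linear_continuous_on bounded_linear_pair_of_vec)
  fix l u :: "real \<times> real" assume le: "\<And>b. b \<in> Basis \<Longrightarrow> l \<bullet> b \<le> u \<bullet> b"
  have mb: "p \<in> box l u \<longleftrightarrow> fst l < fst p \<and> fst p < fst u \<and> snd l < snd p \<and> snd p < snd u" for p
    by (auto simp: mem_box Basis_prod_def inner_prod_def)
  have "pair_of_vec -` box l u = box (vec_of_pair l) (vec_of_pair u)"
    by (rule set_eqI) (auto simp: mb mem_box_cart forall_2 pair_of_vec_def vec_of_pair_def)
  moreover have "vec_of_pair l \<bullet> b \<le> vec_of_pair u \<bullet> b" if "b \<in> Basis" for b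
  proof -
    have "fst l \<le> fst u" "snd l \<le> snd u"
      using le[of "(1, 0)"] le[of "(0, 1)"] by (auto simp: Basis_prod_def inner_prod_def)
    then have "\<forall>i. vec_of_pair l $ i \<le> vec_of_pair u $ i" by (simp add: forall_2 vec_of_pair_def)
    then show ?thesis using that by (auto simp: Basis_vec_def inner_axis)
  qed
  moreover have "(\<Prod>b\<in>Basis. (vec_of_pair u - vec_of_pair l) \<bullet> b) = (\<Prod>b\<in>Basis. (u - l) \<bullet> b)"
  proof -
    have "(\<Prod>b\<in>Basis. (vec_of_pair u - vec_of_pair l) \<bullet> b) = (fst u - fst l) * (snd u - snd l)"
    proof -
      have B: "Basis = {axis 1 1, axis 2 1 :: real^2}"
        by (auto simp: Basis_vec_def) (metis exhaust_2)
      have "axis 1 1 \<noteq> (axis 2 1 :: real^2)" by (simp add: axis_eq_axis)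
      then show ?thesis unfolding B by (simp add: inner_axis vec_of_pair_def)
    qed
    also have "\<dots> = (\<Prod>b\<in>Basis. (u - l) \<bullet> b)"
      by (simp add: Basis_prod_def inner_prod_def)
    finally show ?thesis .
  qed
  ultimately show "emeasure (distr lborel borel pair_of_vec) (box l u) = (\<Prod>b\<in>Basis. (u - l) \<bullet> b)"
    by (subst emeasure_distr) (auto simp: emeasure_lborel_box)
qed simp

text \<open>A bridge between absolute integrability of \<open>real^1\<close>-valued functions and
  Lebesgue integrals over pairs. Borel measurability permits the step from the completed measure to
  \<open>lborel\<close>.\<close>

lemma pair_of_vec_integral:
  fixes g :: "real \<times> real \<Rightarrow> real"
  assumes m: "(\<lambda>p. indicator U p * g p) \<in> borel_measurable borel"
  shows "(\<lambda>x. vec (g (pair_of_vec x)) :: real^1) absolutely_integrable_on (pair_of_vec -` U) \<longleftrightarrow> set_integrable lborel U g"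
    and "set_integrable lborel U g \<Longrightarrow>
      integral (pair_of_vec -` U) (\<lambda>x. vec (g (pair_of_vec x)) :: real^1) = vec (LINT p:U|lborel. g p)"
proof -
  have pm [measurable]: "pair_of_vec \<in> borel_measurable borel"
    by (intro borel_measurable_continuous_onI linear_continuous_on bounded_linear_pair_of_vec)
  let ?h = "\<lambda>p. indicator U p * g p"
  have m' [measurable]: "(\<lambda>x. ?h (pair_of_vec x)) \<in> borel_measurable borel"
    using measurable_compose[OF pm m] by simp
  have ind: "indicator (pair_of_vec -` U) x *\<^sub>R g (pair_of_vec x) = ?h (pair_of_vec x)" for x
    by (simp add: indicator_def)
  have lift: "(\<lambda>x. vec (g (pair_of_vec x)) :: real^1) absolutely_integrable_on (pair_of_vec -` U)
      \<longleftrightarrow> (\<lambda>x. g (pair_of_vec x)) absolutely_integrable_on (pair_of_vec -` U)"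
    by (subst absolutely_integrable_componentwise_iff) (simp add: Basis_vec_def inner_axis)
  have "(\<lambda>x. g (pair_of_vec x)) absolutely_integrable_on (pair_of_vec -` U)
      \<longleftrightarrow> integrable lborel (\<lambda>x. ?h (pair_of_vec x))"
    unfolding set_integrable_def ind by (rule integrable_completion) simp
  also have "\<dots> \<longleftrightarrow> integrable (distr lborel borel pair_of_vec) ?h"
    by (rule integrable_distr_eq[symmetric]) (use m in auto)
  finally have iff: "(\<lambda>x. g (pair_of_vec x)) absolutely_integrable_on (pair_of_vec -` U) \<longleftrightarrow> set_integrable lborel U g"
    by (simp add: distr_pair_of_vec set_integrable_def)
  then show *: "(\<lambda>x. vec (g (pair_of_vec x)) :: real^1) absolutely_integrable_on (pair_of_vec -` U) \<longleftrightarrow> set_integrable lborel U g"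
    using lift by simp
  assume g: "set_integrable lborel U g"
  have "integral (pair_of_vec -` U) (\<lambda>x. g (pair_of_vec x)) = (LINT x:pair_of_vec -` U|lebesgue. g (pair_of_vec x))"
    using g iff by (intro set_lebesgue_integral_eq_integral(2)[symmetric]) simp
  also have "\<dots> = (LINT x|lborel. ?h (pair_of_vec x))"
    unfolding set_lebesgue_integral_def ind by (rule integral_completion) simp
  also have "\<dots> = (LINT p|distr lborel borel pair_of_vec. ?h p)"
    by (rule integral_distr[symmetric]) (use m in auto)
  finally have I: "integral (pair_of_vec -` U) (\<lambda>x. g (pair_of_vec x)) = (LINT p:U|lborel. g p)"
    by (simp add: distr_pair_of_vec set_lebesgue_integral_def)
  have int: "(\<lambda>x. vec (g (pair_of_vec x)) :: real^1) integrable_on (pair_of_vec -` U)"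
    using g * by (auto dest: absolutely_integrable_on_def[THEN iffD1])
  show "integral (pair_of_vec -` U) (\<lambda>x. vec (g (pair_of_vec x)) :: real^1) = vec (LINT p:U|lborel. g p)"
    using integral_component_eq_cart[OF int, of 1] I by (simp add: vec_eq_iff)
qed

text \<open>The Jacobian is the determinant of the columns \<open>A p\<close> and
  \<open>B p\<close>. The image is open by invariance of domain, so continuity of \<open>k\<close>
  makes the integrand measurable, and integrability is transferred from the parameter side.\<close>

lemma integral_image_pair:
  fixes Y :: "real \<times> real \<Rightarrow> real \<times> real" and k :: "real \<times> real \<Rightarrow> real"
  assumes S: "open S" and inj: "inj_on Y S"
    and der: "\<And>p. p \<in> S \<Longrightarrow> (Y has_derivative (\<lambda>h. fst h *\<^sub>R A p + snd h *\<^sub>R B p)) (at p)"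
    and k: "continuous_on (Y ` S) k"
    and J: "\<And>p. p \<in> S \<Longrightarrow> J p = \<bar>fst (A p) * snd (B p) - snd (A p) * fst (B p)\<bar>"
    and int: "set_integrable lborel S (\<lambda>p. J p * k (Y p))"
  shows "open (Y ` S)" "set_integrable lborel (Y ` S) k"
    "(LINT v:Y ` S|lborel. k v) = (LINT p:S|lborel. J p * k (Y p))"
proof -
  have "continuous_on S Y"
    using der has_derivative_continuous continuous_at_imp_continuous_on by blast
  then show op: "open (Y ` S)" using invariance_of_domain[OF _ S inj] by blast
  have mk: "(\<lambda>v. indicator (Y ` S) v * k v) \<in> borel_measurable borel"
    using borel_measurable_continuous_on_indicator[OF _ k] op by simp
  have mS: "(\<lambda>p. indicator S p * (J p * k (Y p))) \<in> borel_measurable borel"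
    using int by (auto simp: set_integrable_def)
  let ?T = "pair_of_vec -` S"
  define G where "G v = vec_of_pair (Y (pair_of_vec v))" for v
  define G' where "G' v h = vec_of_pair (fst (pair_of_vec h) *\<^sub>R A (pair_of_vec v) + snd (pair_of_vec h) *\<^sub>R B (pair_of_vec v))" for v h
  have T: "?T \<in> sets lebesgue"
  proof -
    have "open ?T" by (rule open_vimage[OF S linear_continuous_on[OF bounded_linear_pair_of_vec]])
    then show ?thesis by (simp add: borel_open)
  qed
  have G: "(G has_derivative G' v) (at v within ?T)" if "v \<in> ?T" for v
  proof -
    have "(G has_derivative G' v) (at v)"
      unfolding G_def[abs_def] G'_def[abs_def]
      by (rule bounded_linear.has_derivative[OF bounded_linear_vec_of_pair],
          rule has_derivative_compose[OF bounded_linear_imp_has_derivative[OF bounded_linear_pair_of_vec] der])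
        (use that in simp)
    then show ?thesis by (rule has_derivative_at_withinI)
  qed
  have det: "\<bar>det (matrix (G' v))\<bar> = J (pair_of_vec v)" if "v \<in> ?T" for v
    using J[of "pair_of_vec v"] that
    by (simp add: det_2 matrix_def G'_def pair_of_vec_def vec_of_pair_def axis_def mult_ac)
  have injG: "inj_on G ?T"
  proof (rule inj_onI)
    fix v w assume "v \<in> ?T" "w \<in> ?T" "G v = G w"
    then have "Y (pair_of_vec v) = Y (pair_of_vec w)" unfolding G_def by (metis pair_vec(1))
    then have "pair_of_vec v = pair_of_vec w" using inj \<open>v \<in> ?T\<close> \<open>w \<in> ?T\<close> by (auto dest: inj_onD)
    then show "v = w" by (metis pair_vec(2))
  qed
  have im: "G ` ?T = pair_of_vec -` (Y ` S)"
  proof (intro set_eqI iffI)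
    fix x assume "x \<in> pair_of_vec -` (Y ` S)"
    then obtain p where "p \<in> S" "pair_of_vec x = Y p" by auto
    then have "x = G (vec_of_pair p)" "vec_of_pair p \<in> ?T" by (auto simp: G_def) (metis pair_vec(2))
    then show "x \<in> G ` ?T" by blast
  qed (auto simp: G_def)
  have eq: "vec (J (pair_of_vec v) * k (Y (pair_of_vec v))) = \<bar>det (matrix (G' v))\<bar> *\<^sub>R (vec (k (pair_of_vec (G v))) :: real^1)"
    if "v \<in> ?T" for v
    using det[OF that] by (simp add: G_def vec_eq_iff)
  have 1: "(\<lambda>v. \<bar>det (matrix (G' v))\<bar> *\<^sub>R (vec (k (pair_of_vec (G v))) :: real^1)) absolutely_integrable_on ?T"
    using pair_of_vec_integral(1)[OF mS] int
    by (subst (asm) set_integrable_cong[OF refl refl eq]) auto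
  have 2: "integral ?T (\<lambda>v. \<bar>det (matrix (G' v))\<bar> *\<^sub>R (vec (k (pair_of_vec (G v))) :: real^1)) = vec (LINT p:S|lborel. J p * k (Y p))"
    using pair_of_vec_integral(2)[OF mS int] integral_cong[of ?T, OF eq] by simp
  have "(\<lambda>v. vec (k (pair_of_vec v)) :: real^1) absolutely_integrable_on (G ` ?T) \<and>
      integral (G ` ?T) (\<lambda>v. vec (k (pair_of_vec v)) :: real^1) = vec (LINT p:S|lborel. J p * k (Y p))"
    using has_absolute_integral_change_of_variables[OF T G injG, of "\<lambda>v. vec (k (pair_of_vec v)) :: real^1"] 1 2 by blast
  note * = this[unfolded im]
  then show si: "set_integrable lborel (Y ` S) k"
    using pair_of_vec_integral(1)[OF mk] by blast
  show "(LINT v:Y ` S|lborel. k v) = (LINT p:S|lborel. J p * k (Y p))"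
    using pair_of_vec_integral(2)[OF mk si] * by (simp add: vec_eq_iff)
qed

section \<open>Estimates on the tube\<close>

text \<open>The tube map is used only for parameters strictly between \<open>-a\<close> and
  \<open>a\<close>; the normals at the two ends lie on such lines and are negligible.\<close>

lemma null_line: "AE v in lborel. ndir b \<bullet> (v::real \<times> real) \<noteq> c"
proof -
  have "ndir b \<noteq> 0" using ndir_ndir[of b b] by auto
  then have "negligible {v. ndir b \<bullet> v = c}" by (intro negligible_hyperplane) auto
  then have "{v. ndir b \<bullet> v = c} \<in> null_sets (completion lborel)"
    by (simp add: negligible_iff_null_sets)
  moreover have "{v. ndir b \<bullet> v = c} \<in> sets lborel"
    by (intro borel_closed[THEN sets_lborel[THEN equalityD2, THEN subsetD]] closed_hyperplane)
  ultimately have "{v. ndir b \<bullet> v = c} \<in> null_sets lborel"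
    by (simp add: null_sets_completion_iff)
  then show ?thesis by (rule AE_I') auto
qed

text \<open>Eliminates the existential \<open>t\<close>: a piece of a normal becomes a Borel subset
  of a line.\<close>

lemma on_normal_iff:
  "(\<exists>t. v = p + t *\<^sub>R dir b \<and> P t) \<longleftrightarrow> ndir b \<bullet> v = ndir b \<bullet> p \<and> P ((v - p) \<bullet> dir b)"
proof
  assume "\<exists>t. v = p + t *\<^sub>R dir b \<and> P t"
  then show "ndir b \<bullet> v = ndir b \<bullet> p \<and> P ((v - p) \<bullet> dir b)"
    by (auto simp: inner_add_right ndir_dir dir_dir)
next
  assume *: "ndir b \<bullet> v = ndir b \<bullet> p \<and> P ((v - p) \<bullet> dir b)"
  have "(v - p) \<bullet> ndir b = ndir b \<bullet> v - ndir b \<bullet> p" by (subst inner_commute) (rule inner_diff_right)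
  then have "(v - p) \<bullet> ndir b = 0" using * by simp
  then have "v - p = ((v - p) \<bullet> dir b) *\<^sub>R dir b"
    using orthonormal_expansion[of "v - p" b] by simp
  then have "v = p + ((v - p) \<bullet> dir b) *\<^sub>R dir b" by (metis add_diff_cancel_left' diff_add_cancel add.commute)
  then show "\<exists>t. v = p + t *\<^sub>R dir b \<and> P t" using * by blast
qed

text \<open>The quantitative setting, uniform in \<open>x\<close> over the neighbourhood
  \<open>V\<close>. \<open>M\<close> is one common upper bound, and \<open>transversal\<close> is
  the tangent line hypothesis with a margin \<beta>, extended to the parallel curves at distance
  \<open>t\<close>, which share the normals of \<open>y\<close>.\<close>

locale tube_kernel =
  fixes a \<delta> M \<beta> C :: real and y :: "real \<Rightarrow> real \<times> real" and r :: "real \<Rightarrow> real"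
    and \<Delta>f :: "real \<times> real \<Rightarrow> real" and D :: "real \<times> real \<Rightarrow> (real \<times> real) \<Rightarrow>\<^sub>L real"
    and \<psi> \<Psi> :: "real \<Rightarrow> real \<Rightarrow> real" and V :: "(real \<times> real) set"
  assumes a_pos: "0 < a" and \<delta>_pos: "0 < \<delta>" and \<beta>_pos: "0 < \<beta>" and C_nonneg: "0 \<le> C"
    and y_deriv: "\<And>\<theta>. \<theta> \<in> {-a..a} \<Longrightarrow> (y has_vector_derivative r \<theta> *\<^sub>R ndir \<theta>) (at \<theta> within {-a..a})"
    and r_cont: "continuous_on {-a..a} r"
    and jac_neg: "\<And>\<theta> t. \<theta> \<in> {-a..a} \<Longrightarrow> \<bar>t\<bar> \<le> \<delta> \<Longrightarrow> r \<theta> + t < 0"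
    and jac_bound: "\<And>\<theta> t. \<theta> \<in> {-a..a} \<Longrightarrow> \<bar>t\<bar> \<le> \<delta> \<Longrightarrow> \<bar>r \<theta> + t\<bar> \<le> M"
    and jump_deriv: "\<And>\<theta> t. \<theta> \<in> {-a..a} \<Longrightarrow> \<bar>t\<bar> \<le> \<delta> \<Longrightarrow>
      (\<Delta>f has_derivative blinfun_apply (D (y \<theta> + t *\<^sub>R dir \<theta>))) (at (y \<theta> + t *\<^sub>R dir \<theta>))"
    and jump_deriv_bound: "\<And>\<theta> t. \<theta> \<in> {-a..a} \<Longrightarrow> \<bar>t\<bar> \<le> \<delta> \<Longrightarrow> norm (D (y \<theta> + t *\<^sub>R dir \<theta>)) \<le> M"
    and jump_bound: "\<And>\<theta> t. \<theta> \<in> {-a..a} \<Longrightarrow> \<bar>t\<bar> \<le> \<delta> \<Longrightarrow> \<bar>\<Delta>f (y \<theta> + t *\<^sub>R dir \<theta>)\<bar> \<le> M"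
    and transversal: "\<And>x \<theta> t. x \<in> V \<Longrightarrow> \<theta> \<in> {-a..a} \<Longrightarrow> \<bar>t\<bar> \<le> \<delta> \<Longrightarrow> \<beta> \<le> \<bar>(x - (y \<theta> + t *\<^sub>R dir \<theta>)) \<bullet> dir \<theta>\<bar>"
    and dist_bound: "\<And>x \<theta> t. x \<in> V \<Longrightarrow> \<theta> \<in> {-a..a} \<Longrightarrow> \<bar>t\<bar> \<le> \<delta> \<Longrightarrow> norm (x - (y \<theta> + t *\<^sub>R dir \<theta>)) \<le> M"
    and \<Psi>_deriv: "\<And>u v. ((\<lambda>v. \<Psi> u v) has_real_derivative \<psi> u v) (at v)"
    and \<Psi>_bound: "\<And>u v. \<bar>\<Psi> u v\<bar> \<le> C / (1 + \<bar>u - v\<bar>)"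
    and \<psi>_bound: "\<And>u v. \<bar>\<psi> u v\<bar> \<le> C / (1 + (u - v)\<^sup>2)"
    and \<psi>_cont: "\<And>u. continuous_on UNIV (\<psi> u)"
begin

definition Y :: "real \<Rightarrow> real \<Rightarrow> real \<times> real" where
  "Y \<theta> t = y \<theta> + t *\<^sub>R dir \<theta>"

abbreviation \<psi>d :: "real \<Rightarrow> real \<Rightarrow> real \<times> real \<Rightarrow> real \<times> real \<Rightarrow> real" where
  "\<psi>d \<epsilon> \<alpha> x v \<equiv> \<psi> (dir \<alpha> \<bullet> x / \<epsilon>) (dir \<alpha> \<bullet> v / \<epsilon>)"

abbreviation decay :: "real \<Rightarrow> real \<Rightarrow> real \<times> real \<Rightarrow> real \<Rightarrow> real \<Rightarrow> real" where
  "decay \<epsilon> \<alpha> x \<theta> t \<equiv> 1 / (1 + \<bar>dir \<alpha> \<bullet> (x - Y \<theta> t)\<bar> / \<epsilon>)"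

text \<open>The integrand in the coordinates (\<theta>, t); the factor - (r \<theta> + t), which is
  positive, is their Jacobian.\<close>

definition E :: "real \<Rightarrow> real \<Rightarrow> real \<times> real \<Rightarrow> real \<Rightarrow> real \<Rightarrow> real" where
  "E \<epsilon> \<alpha> x \<theta> t = - (r \<theta> + t) * (\<psi> (dir \<alpha> \<bullet> x / \<epsilon>) (dir \<alpha> \<bullet> Y \<theta> t / \<epsilon>) * \<Delta>f (Y \<theta> t))"

text \<open>The three summands bound, in the notation of \<open>approx_primitive_exists\<close>, the
  part of the integrand containing q, the function G', and G.\<close>

definition B :: real where
  "B = C * (2 * (M * (M / \<beta>)) + ((M * M * M + M * M) / (\<beta> * \<beta>) * M + M / \<beta> * M) + M / \<beta> * M)"

lemma M_nonneg: "0 \<le> M"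
  using jac_bound[of 0 0] a_pos \<delta>_pos by (auto intro: order_trans[OF abs_ge_zero])

lemma B_nonneg: "0 \<le> B"
  using M_nonneg \<beta>_pos C_nonneg by (simp add: B_def add_nonneg_nonneg)

text \<open>\<open>E\<close> is the derivative of \<epsilon> K only up to an error of order
  \<epsilon>. Error and boundary values carry the same decaying weight, so both sum logarithmically
  over the angles.\<close>

definition approx_primitive ::
  "real \<Rightarrow> real \<Rightarrow> real \<times> real \<Rightarrow> real \<Rightarrow> (real \<Rightarrow> real) \<Rightarrow> (real \<Rightarrow> real) \<Rightarrow> bool" where
  "approx_primitive \<epsilon> \<alpha> x t K K' \<longleftrightarrow>
    (\<forall>\<theta>\<in>{-a..a}. (K has_real_derivative K' \<theta>) (at \<theta> within {-a..a}) \<and>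
    \<bar>K \<theta>\<bar> \<le> B * (decay \<epsilon> \<alpha> x \<theta> t) \<and>
    \<bar>E \<epsilon> \<alpha> x \<theta> t - \<epsilon> * K' \<theta>\<bar> \<le> \<epsilon> * (B * (decay \<epsilon> \<alpha> x \<theta> t)))"

lemma approx_primitiveD:
  assumes "approx_primitive \<epsilon> \<alpha> x t K K'" "\<theta> \<in> {-a..a}"
  shows "(K has_real_derivative K' \<theta>) (at \<theta> within {-a..a})"
    "\<bar>K \<theta>\<bar> \<le> B * (decay \<epsilon> \<alpha> x \<theta> t)"
    "\<bar>E \<epsilon> \<alpha> x \<theta> t - \<epsilon> * K' \<theta>\<bar> \<le> \<epsilon> * (B * (decay \<epsilon> \<alpha> x \<theta> t))"
  using bspec[OF assms(1)[unfolded approx_primitive_def] assms(2)] by simp_all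

text \<open>The primitive is \<Psi> times G = (g / A) p. Differentiating \<Psi> along the curve
  produces \<psi> with the factor (r + t) sin (\<alpha> - \<theta>) / \<epsilon>, which is the sine
  part of the split of g = F A. Dividing by \<open>A\<close> is safe by transversality, whatever the
  angle \<alpha>.\<close>

lemma approx_primitive_exists:
  assumes x: "x \<in> V" and \<epsilon>: "0 < \<epsilon>" and t: "\<bar>t\<bar> \<le> \<delta>"
  shows "\<exists>K K'. approx_primitive \<epsilon> \<alpha> x t K K'"
proof -
  let ?m = "(M * M * M + M * M) / (\<beta> * \<beta>)"
  define u where "u = dir \<alpha> \<bullet> x / \<epsilon>"
  define v where "v \<theta> = Y \<theta> t \<bullet> dir \<alpha> / \<epsilon>" for \<theta>
  define g where "g \<theta> = \<Delta>f (Y \<theta> t)" for \<theta>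
  define g' where "g' \<theta> = D (Y \<theta> t) ((r \<theta> + t) *\<^sub>R ndir \<theta>)" for \<theta>
  define A where "A \<theta> = (x - Y \<theta> t) \<bullet> dir \<theta>" for \<theta>
  define A' where "A' \<theta> = (x - Y \<theta> t) \<bullet> ndir \<theta>" for \<theta>
  define p where "p \<theta> = (x - Y \<theta> t) \<bullet> ndir \<alpha>" for \<theta>
  define p' where "p' \<theta> = - ((r \<theta> + t) * cos (\<theta> - \<alpha>))" for \<theta>
  define q where "q \<theta> = (x - Y \<theta> t) \<bullet> dir \<alpha>" for \<theta>
  define F where "F \<theta> = g \<theta> / A \<theta>" for \<theta>
  define F' where "F' \<theta> = (g' \<theta> * A \<theta> - g \<theta> * A' \<theta>) / (A \<theta> * A \<theta>)" for \<theta>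
  define G where "G \<theta> = F \<theta> * p \<theta>" for \<theta>
  define G' where "G' \<theta> = F' \<theta> * p \<theta> + p' \<theta> * F \<theta>" for \<theta>
  define K where "K \<theta> = \<Psi> u (v \<theta>) * G \<theta>" for \<theta>
  define K' where "K' \<theta> = \<psi> u (v \<theta>) * ((r \<theta> + t) * sin (\<alpha> - \<theta>) / \<epsilon>) * G \<theta> + G' \<theta> * \<Psi> u (v \<theta>)" for \<theta>
  show ?thesis
    unfolding approx_primitive_def
  proof (rule exI[of _ K], rule exI[of _ K'], rule ballI)
    fix \<theta> assume \<theta>: "\<theta> \<in> {-a..a}"
    let ?F = "at \<theta> within {-a..a}"
    have Yd: "((\<lambda>\<theta>. Y \<theta> t) has_vector_derivative (r \<theta> + t) *\<^sub>R ndir \<theta>) ?F"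
      unfolding Y_def scaleR_add_left
      by (intro has_vector_derivative_add y_deriv[OF \<theta>]
          bounded_linear.has_vector_derivative[OF bounded_linear_scaleR_right] dir_has_vector_derivative)
    have xYd: "((\<lambda>\<theta>. x - Y \<theta> t) has_vector_derivative - ((r \<theta> + t) *\<^sub>R ndir \<theta>)) ?F"
      using has_vector_derivative_diff[OF has_vector_derivative_const[of x] Yd] by simp
    have gd: "(g has_real_derivative g' \<theta>) ?F"
    proof -
      have "(g has_derivative (\<lambda>h. D (Y \<theta> t) (h *\<^sub>R ((r \<theta> + t) *\<^sub>R ndir \<theta>)))) ?F"
        unfolding g_def[abs_def]
        by (rule has_derivative_compose[OF Yd[unfolded has_vector_derivative_def]])
          (unfold Y_def, rule jump_deriv[OF \<theta> t])
      then show ?thesis unfolding has_field_derivative_def g'_def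
        by (rule has_derivative_eq_rhs) (simp only: blinfun.scaleR_right real_scaleR_def mult_ac fun_eq_iff, simp)
    qed
    \<comment> \<open>The parallel curve moves along \<open>ndir \<theta>\<close>, orthogonally to
      \<open>dir \<theta>\<close>, so only the rotation of \<open>dir \<theta>\<close> contributes
      to the derivative.\<close>
    have Ad: "(A has_real_derivative A' \<theta>) ?F"
      unfolding A_def[abs_def] A'_def
      using inner_has_real_derivative[OF xYd dir_has_vector_derivative] by (simp add: ndir_dir)
    have A0: "\<beta> \<le> \<bar>A \<theta>\<bar>" unfolding A_def Y_def by (rule transversal[OF x \<theta> t])
    then have Anz: "A \<theta> \<noteq> 0" using \<beta>_pos by auto
    have Fd: "(F has_real_derivative F' \<theta>) ?F"
      unfolding F_def[abs_def] F'_def by (rule DERIV_divide[OF gd Ad Anz])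
    have pd: "(p has_real_derivative p' \<theta>) ?F"
      unfolding p_def[abs_def] p'_def
      using inner_const_has_real_derivative[OF xYd, of "ndir \<alpha>"] by (simp add: ndir_ndir)
    have Gd: "(G has_real_derivative G' \<theta>) ?F"
      unfolding G_def[abs_def] G'_def by (rule DERIV_mult[OF Fd pd])
    have vd: "(v has_real_derivative (r \<theta> + t) * sin (\<alpha> - \<theta>) / \<epsilon>) ?F"
      unfolding v_def[abs_def]
      using DERIV_cdivide[OF inner_const_has_real_derivative[OF Yd, of "dir \<alpha>"], of \<epsilon>] by (simp add: ndir_dir)
    have Kd: "(K has_real_derivative K' \<theta>) ?F"
      unfolding K_def[abs_def] K'_def
      by (rule DERIV_mult[OF DERIV_chain2[OF \<Psi>_deriv vd] Gd])
    define w where "w = 1 / (1 + \<bar>q \<theta>\<bar> / \<epsilon>)"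
    have w: "0 \<le> w" using \<epsilon> by (simp add: w_def add_nonneg_nonneg)
    have uv: "u - v \<theta> = q \<theta> / \<epsilon>"
      by (simp add: u_def v_def q_def inner_diff_left inner_commute[of "dir \<alpha>"] diff_divide_distrib)
    have \<Psi>b: "\<bar>\<Psi> u (v \<theta>)\<bar> \<le> C * w"
      using \<Psi>_bound[of u "v \<theta>"] \<epsilon> by (simp add: uv w_def)
    \<comment> \<open>One of the two powers of decay is spent on q = \<epsilon> (q / \<epsilon>),
      via z / (1 + z^2) \<le> 2 / (1 + z).\<close>
    have \<psi>b: "\<bar>\<psi> u (v \<theta>) * q \<theta>\<bar> \<le> \<epsilon> * (2 * (C * w))"
    proof -
      define z where "z = \<bar>q \<theta>\<bar> / \<epsilon>"
      have z: "0 \<le> z" using \<epsilon> by (simp add: z_def)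
      have "\<bar>\<psi> u (v \<theta>)\<bar> \<le> C / (1 + z\<^sup>2)"
        using \<psi>_bound[of u "v \<theta>"] by (simp add: uv z_def power_divide)
      then have "\<bar>\<psi> u (v \<theta>)\<bar> * z \<le> C / (1 + z\<^sup>2) * z"
        using z by (intro mult_right_mono) auto
      also have "\<dots> \<le> C * 2 / (1 + z)"
      proof -
        have "z * (1 + z) \<le> 2 * (1 + z\<^sup>2)"
          using sum_squares_bound[of z 1] z by (simp add: power2_eq_square algebra_simps)
        moreover have "0 < 1 + z\<^sup>2" by (simp add: add_pos_nonneg)
        ultimately have "z / (1 + z\<^sup>2) \<le> 2 / (1 + z)"
          using z by (simp add: divide_simps mult_ac)
        then show ?thesis using C_nonneg mult_left_mono[of "z / (1 + z\<^sup>2)" "2 / (1 + z)" C] by simp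
      qed
      finally have "\<epsilon> * (\<bar>\<psi> u (v \<theta>)\<bar> * z) \<le> \<epsilon> * (C * 2 / (1 + z))"
        using \<epsilon> by (intro mult_left_mono) auto
      then show ?thesis using \<epsilon> by (simp add: z_def w_def abs_mult mult_ac)
    qed
    have xY: "norm (x - Y \<theta> t) \<le> M" unfolding Y_def by (rule dist_bound[OF x \<theta> t])
    have nin: "\<bar>(x - Y \<theta> t) \<bullet> n\<bar> \<le> M" if "norm n = 1" for n
      using Cauchy_Schwarz_ineq2[of "x - Y \<theta> t" n] xY that by simp
    have nnd: "norm (ndir \<gamma>) = 1" for \<gamma> by (simp add: ndir_def norm_Pair)
    have Ab: "\<bar>A \<theta>\<bar> \<le> M" "\<bar>A' \<theta>\<bar> \<le> M" "\<bar>p \<theta>\<bar> \<le> M"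
      unfolding A_def A'_def p_def by (rule nin; simp add: nnd)+
    have gb: "\<bar>g \<theta>\<bar> \<le> M" unfolding g_def Y_def by (rule jump_bound[OF \<theta> t])
    have jb: "\<bar>r \<theta> + t\<bar> \<le> M" by (rule jac_bound[OF \<theta> t])
    have g'b: "\<bar>g' \<theta>\<bar> \<le> M * M"
    proof -
      have "\<bar>g' \<theta>\<bar> \<le> norm (D (Y \<theta> t)) * norm ((r \<theta> + t) *\<^sub>R ndir \<theta>)"
        unfolding g'_def using norm_blinfun[of "D (Y \<theta> t)"] by (metis real_norm_def)
      also have "\<dots> \<le> M * M"
        using jump_deriv_bound[OF \<theta> t] jb M_nonneg unfolding Y_def
        by (intro mult_mono) (auto simp: nnd)
      finally show ?thesis .
    qed
    have p'b: "\<bar>p' \<theta>\<bar> \<le> M"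
    proof -
      have "\<bar>r \<theta> + t\<bar> * \<bar>cos (\<theta> - \<alpha>)\<bar> \<le> M * 1"
        using jb M_nonneg by (intro mult_mono) auto
      then show ?thesis unfolding p'_def abs_minus_cancel abs_mult by simp
    qed
    have Fb: "\<bar>F \<theta>\<bar> \<le> M / \<beta>"
      unfolding F_def abs_divide using gb A0 \<beta>_pos M_nonneg by (intro frac_le) auto
    have F'b: "\<bar>F' \<theta>\<bar> \<le> ?m"
      unfolding F'_def abs_divide
    proof (rule frac_le)
      have "\<bar>g' \<theta> * A \<theta>\<bar> \<le> M * M * M" "\<bar>g \<theta> * A' \<theta>\<bar> \<le> M * M"
        unfolding abs_mult by (intro mult_mono g'b Ab gb; use M_nonneg in simp)+
      then show "\<bar>g' \<theta> * A \<theta> - g \<theta> * A' \<theta>\<bar> \<le> M * M * M + M * M" by linarith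
      show "\<beta> * \<beta> \<le> \<bar>A \<theta> * A \<theta>\<bar>" unfolding abs_mult using A0 \<beta>_pos by (intro mult_mono) auto
    qed (use M_nonneg \<beta>_pos in auto)
    have Gb: "\<bar>G \<theta>\<bar> \<le> M / \<beta> * M"
      unfolding G_def abs_mult using Fb Ab M_nonneg \<beta>_pos by (intro mult_mono) auto
    have G'b: "\<bar>G' \<theta>\<bar> \<le> ?m * M + M / \<beta> * M"
    proof -
      have "\<bar>F' \<theta> * p \<theta>\<bar> \<le> ?m * M"
        unfolding abs_mult using F'b Ab M_nonneg \<beta>_pos by (intro mult_mono) auto
      moreover have "\<bar>p' \<theta> * F \<theta>\<bar> \<le> M * (M / \<beta>)"
        unfolding abs_mult using Fb p'b M_nonneg \<beta>_pos by (intro mult_mono) auto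
      ultimately show ?thesis unfolding G'_def by (simp add: mult.commute)
    qed
    have Bs: "C * (2 * (M * (M / \<beta>)) + (?m * M + M / \<beta> * M)) \<le> B" "C * (M / \<beta> * M) \<le> B"
    proof -
      have nn: "0 \<le> 2 * (M * (M / \<beta>))" "0 \<le> ?m * M + M / \<beta> * M" "0 \<le> M / \<beta> * M"
        using M_nonneg \<beta>_pos by (auto intro!: add_nonneg_nonneg mult_nonneg_nonneg divide_nonneg_nonneg)
      show "C * (2 * (M * (M / \<beta>)) + (?m * M + M / \<beta> * M)) \<le> B"
        unfolding B_def by (rule mult_left_mono[OF _ C_nonneg]) (rule add_increasing2[OF nn(3) order_refl])
      show "C * (M / \<beta> * M) \<le> B"
        unfolding B_def by (rule mult_left_mono[OF _ C_nonneg]) (rule add_increasing[OF add_nonneg_nonneg[OF nn(1,2)] order_refl])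
    qed
    have Kb: "\<bar>K \<theta>\<bar> \<le> B * w"
    proof -
      have "\<bar>K \<theta>\<bar> \<le> (C * w) * (M / \<beta> * M)"
        unfolding K_def abs_mult using \<Psi>b Gb C_nonneg w by (intro mult_mono) auto
      also have "\<dots> = (C * (M / \<beta> * M)) * w" by simp
      also have "\<dots> \<le> B * w" by (rule mult_right_mono[OF Bs(2) w])
      finally show ?thesis .
    qed
    \<comment> \<open>The first summand is absorbed by the decay of \<open>\<psi>\<close>; the second carries the factor
      \<open>sin (\<alpha> - \<theta>)\<close> that turns \<open>\<psi>\<close> into a \<open>\<theta>\<close>-derivative of \<open>\<Psi>\<close>.\<close>
    have Aexp: "A \<theta> = cos (\<alpha> - \<theta>) * q \<theta> - sin (\<alpha> - \<theta>) * p \<theta>"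
    proof -
      have "dir \<theta> = cos (\<alpha> - \<theta>) *\<^sub>R dir \<alpha> - sin (\<alpha> - \<theta>) *\<^sub>R ndir \<alpha>"
        using orthonormal_expansion[of "dir \<theta>" \<alpha>] by (simp add: dir_dir dir_ndir cos_diff sin_diff algebra_simps)
      then show ?thesis unfolding A_def q_def p_def by (simp add: inner_diff_right)
    qed
    have gF: "g \<theta> = F \<theta> * A \<theta>" using Anz by (simp add: F_def)
    have "E \<epsilon> \<alpha> x \<theta> t - \<epsilon> * K' \<theta>
      = - ((\<psi> u (v \<theta>) * q \<theta>) * ((r \<theta> + t) * (F \<theta> * cos (\<alpha> - \<theta>)))) - \<epsilon> * (G' \<theta> * \<Psi> u (v \<theta>))"
    proof -
      have "E \<epsilon> \<alpha> x \<theta> t = - (r \<theta> + t) * (\<psi> u (v \<theta>) * g \<theta>)"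
        by (simp add: E_def u_def v_def g_def inner_commute)
      also have "\<dots> = - (r \<theta> + t) * \<psi> u (v \<theta>) * F \<theta> * (cos (\<alpha> - \<theta>) * q \<theta> - sin (\<alpha> - \<theta>) * p \<theta>)"
        unfolding gF Aexp by simp
      also have "\<dots> = - ((\<psi> u (v \<theta>) * q \<theta>) * ((r \<theta> + t) * (F \<theta> * cos (\<alpha> - \<theta>)))) + \<psi> u (v \<theta>) * ((r \<theta> + t) * sin (\<alpha> - \<theta>)) * G \<theta>"
        by (simp add: G_def algebra_simps)
      finally have "E \<epsilon> \<alpha> x \<theta> t = - ((\<psi> u (v \<theta>) * q \<theta>) * ((r \<theta> + t) * (F \<theta> * cos (\<alpha> - \<theta>)))) + \<psi> u (v \<theta>) * ((r \<theta> + t) * sin (\<alpha> - \<theta>)) * G \<theta>" .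
      moreover have "\<epsilon> * K' \<theta> = \<psi> u (v \<theta>) * ((r \<theta> + t) * sin (\<alpha> - \<theta>)) * G \<theta> + \<epsilon> * (G' \<theta> * \<Psi> u (v \<theta>))"
        using \<epsilon> by (simp add: K'_def distrib_left)
      ultimately show ?thesis by linarith
    qed
    also have "\<bar>\<dots>\<bar> \<le> \<epsilon> * (2 * (C * w)) * (M * (M / \<beta>)) + \<epsilon> * ((?m * M + M / \<beta> * M) * (C * w))"
    proof -
      have "\<bar>F \<theta> * cos (\<alpha> - \<theta>)\<bar> \<le> M / \<beta> * 1"
        unfolding abs_mult using Fb M_nonneg \<beta>_pos by (intro mult_mono) auto
      then have "\<bar>(r \<theta> + t) * (F \<theta> * cos (\<alpha> - \<theta>))\<bar> \<le> M * (M / \<beta>)"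
        unfolding abs_mult[of "r \<theta> + t"] using jb M_nonneg by (intro mult_mono) auto
      then have "\<bar>(\<psi> u (v \<theta>) * q \<theta>) * ((r \<theta> + t) * (F \<theta> * cos (\<alpha> - \<theta>)))\<bar> \<le> \<epsilon> * (2 * (C * w)) * (M * (M / \<beta>))"
        unfolding abs_mult[of "\<psi> u (v \<theta>) * q \<theta>"] using \<psi>b \<epsilon> C_nonneg w by (intro mult_mono) auto
      moreover have "\<bar>\<epsilon> * (G' \<theta> * \<Psi> u (v \<theta>))\<bar> \<le> \<epsilon> * ((?m * M + M / \<beta> * M) * (C * w))"
        unfolding abs_mult using G'b \<Psi>b \<epsilon> M_nonneg \<beta>_pos
        by (intro mult_mono) (auto intro!: add_nonneg_nonneg mult_nonneg_nonneg divide_nonneg_nonneg)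
      ultimately show ?thesis by linarith
    qed
    also have "\<dots> = \<epsilon> * ((C * (2 * (M * (M / \<beta>)) + (?m * M + M / \<beta> * M))) * w)"
      by (simp add: algebra_simps)
    also have "\<dots> \<le> \<epsilon> * (B * w)"
      using \<epsilon> by (intro mult_left_mono mult_right_mono Bs(1) w) auto
    finally show "(K has_real_derivative K' \<theta>) ?F \<and>
      \<bar>K \<theta>\<bar> \<le> B * (decay \<epsilon> \<alpha> x \<theta> t) \<and>
      \<bar>E \<epsilon> \<alpha> x \<theta> t - \<epsilon> * K' \<theta>\<bar> \<le> \<epsilon> * (B * (decay \<epsilon> \<alpha> x \<theta> t))"
      using Kd Kb by (simp add: w_def q_def inner_commute)
  qed
qed

text \<open>The weights are summed at a fixed point (\<theta>, t), where the total is
  \<open>S\<close>. Maximizing over \<theta> for each angle separately would destroy the logarithmic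
  bound.\<close>

lemma approx_primitive_sum:
  assumes x: "x \<in> V" and \<epsilon>: "0 < \<epsilon>" and t: "\<bar>t\<bar> \<le> \<delta>" and I: "finite I"
    and S: "\<And>\<theta>. \<theta> \<in> {-a..a} \<Longrightarrow> (\<Sum>k\<in>I. decay \<epsilon> (ang k) x \<theta> t) \<le> S"
  shows "\<exists>K K'. \<forall>\<theta>\<in>{-a..a}. (K has_real_derivative K' \<theta>) (at \<theta> within {-a..a}) \<and>
    \<bar>K \<theta>\<bar> \<le> B * S \<and> \<bar>(\<Sum>k\<in>I. E \<epsilon> (ang k) x \<theta> t) - \<epsilon> * K' \<theta>\<bar> \<le> \<epsilon> * (B * S)"
proof -
  let ?w = "\<lambda>k \<theta>. decay \<epsilon> (ang k) x \<theta> t"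
  have "\<forall>k. \<exists>K K'. approx_primitive \<epsilon> (ang k) x t K K'"
    using approx_primitive_exists[OF x \<epsilon> t] by blast
  then obtain K K' where KK: "\<And>k. approx_primitive \<epsilon> (ang k) x t (K k) (K' k)" by metis
  note K = approx_primitiveD[OF KK]
  show ?thesis
  proof (rule exI[of _ "\<lambda>\<theta>. \<Sum>k\<in>I. K k \<theta>"], rule exI[of _ "\<lambda>\<theta>. \<Sum>k\<in>I. K' k \<theta>"], intro ballI conjI)
    fix \<theta> assume \<theta>: "\<theta> \<in> {-a..a}"
    show "((\<lambda>\<theta>. \<Sum>k\<in>I. K k \<theta>) has_real_derivative (\<Sum>k\<in>I. K' k \<theta>)) (at \<theta> within {-a..a})"
      by (rule DERIV_sum) (rule K(1)[OF \<theta>])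
    have BS: "(\<Sum>k\<in>I. B * ?w k \<theta>) \<le> B * S"
      unfolding sum_distrib_left[symmetric] by (rule mult_left_mono[OF S[OF \<theta>] B_nonneg])
    have "\<bar>\<Sum>k\<in>I. K k \<theta>\<bar> \<le> (\<Sum>k\<in>I. B * ?w k \<theta>)"
      by (rule order_trans[OF sum_abs sum_mono]) (rule K(2)[OF \<theta>])
    then show "\<bar>\<Sum>k\<in>I. K k \<theta>\<bar> \<le> B * S" using BS by linarith
    have eq: "(\<Sum>k\<in>I. E \<epsilon> (ang k) x \<theta> t) - \<epsilon> * (\<Sum>k\<in>I. K' k \<theta>) = (\<Sum>k\<in>I. E \<epsilon> (ang k) x \<theta> t - \<epsilon> * K' k \<theta>)"
      by (simp add: sum_subtractf sum_distrib_left)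
    have le: "\<bar>\<Sum>k\<in>I. E \<epsilon> (ang k) x \<theta> t - \<epsilon> * K' k \<theta>\<bar> \<le> (\<Sum>k\<in>I. \<epsilon> * (B * ?w k \<theta>))"
      by (rule order_trans[OF sum_abs sum_mono]) (rule K(3)[OF \<theta>])
    have "(\<Sum>k\<in>I. \<epsilon> * (B * ?w k \<theta>)) = \<epsilon> * (\<Sum>k\<in>I. B * ?w k \<theta>)"
      by (rule sum_distrib_left[symmetric])
    also have "\<dots> \<le> \<epsilon> * (B * S)"
      using \<epsilon> by (intro mult_left_mono BS) auto
    finally show "\<bar>(\<Sum>k\<in>I. E \<epsilon> (ang k) x \<theta> t) - \<epsilon> * (\<Sum>k\<in>I. K' k \<theta>)\<bar> \<le> \<epsilon> * (B * S)"
      unfolding eq using le by (rule order_trans[rotated])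
  qed
qed

section \<open>Slices of the region and change to tube coordinates\<close>

lemma y_cont: "continuous_on {-a..a} y"
  using has_vector_derivative_continuous[OF y_deriv] by (simp add: continuous_on_eq_continuous_within)

abbreviation Yp :: "real \<times> real \<Rightarrow> real \<times> real" where
  "Yp \<equiv> \<lambda>p. Y (fst p) (snd p)"

text \<open>The form that \<open>has_integral_superlevel\<close> can integrate over;
  \<open>h\<close> may depend on the slice.\<close>

abbreviation superlevel_section :: "real \<Rightarrow> real set \<Rightarrow> bool" where
  "superlevel_section N A \<equiv> \<exists>h :: real \<Rightarrow> real. continuous_on {-a..a} h \<and> finite {z\<in>{-a<..<a}. h z = 0} \<and>
    real (card {z\<in>{-a<..<a}. h z = 0}) \<le> N \<and> A = {\<theta>\<in>{-a<..<a}. 0 < h \<theta>}"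

lemma Y_cont: "continuous_on ({-a..a} \<times> T) Yp"
  unfolding Y_def
  by (intro continuous_intros continuous_on_compose2[OF y_cont] continuous_on_compose2[OF continuous_on_dir[of UNIV]]) auto

lemma jump_cont: "continuous_on (Yp ` ({-a..a} \<times> {-\<delta>..\<delta>})) \<Delta>f"
proof (rule continuous_at_imp_continuous_on, rule ballI)
  fix v assume "v \<in> Yp ` ({-a..a} \<times> {-\<delta>..\<delta>})"
  then show "isCont \<Delta>f v"
    using has_derivative_continuous[OF jump_deriv] by (auto simp: Y_def abs_le_iff)
qed

lemma E_cont:
  assumes "0 < \<epsilon>"
  shows "continuous_on ({-a..a} \<times> {-\<delta>..\<delta>}) (\<lambda>p. E \<epsilon> \<alpha> x (fst p) (snd p))"
  unfolding E_def
  by (intro continuous_intros continuous_on_compose2[OF r_cont] continuous_on_compose2[OF \<psi>_cont]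
      continuous_on_compose2[OF jump_cont] Y_cont) (use assms in auto)

text \<open>Inside the last factor, 2 stands for the ends \<open>-a\<close> and \<open>a\<close>,
  \<open>2 * N\<close> for zeros counted from both sides, and \<open>2 * a\<close> for the length
  over which the error is integrated.\<close>

abbreviation Bd :: "real \<Rightarrow> real \<Rightarrow> real \<Rightarrow> real" where
  "Bd \<epsilon> S N \<equiv> \<epsilon> * (B * S * (2 + 2 * N + 2 * a))"

abbreviation E_sum :: "real \<Rightarrow> 'k set \<Rightarrow> ('k \<Rightarrow> real) \<Rightarrow> real \<times> real \<Rightarrow> real \<Rightarrow> real \<Rightarrow> real" where
  "E_sum \<epsilon> I ang x \<theta> t \<equiv> \<Sum>k\<in>I. E \<epsilon> (ang k) x \<theta> t"

lemma inner_bound: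
  fixes h :: "real \<Rightarrow> real"
  assumes x: "x \<in> V" and \<epsilon>: "0 < \<epsilon>" and t: "\<bar>t\<bar> \<le> \<delta>" and I: "finite I"
    and S: "\<And>\<theta>. \<theta> \<in> {-a..a} \<Longrightarrow> (\<Sum>k\<in>I. decay \<epsilon> (ang k) x \<theta> t) \<le> S" "0 \<le> S"
    and h: "continuous_on {-a..a} h" "finite {z\<in>{-a<..<a}. h z = 0}" "real (card {z\<in>{-a<..<a}. h z = 0}) \<le> N"
  shows "\<bar>LINT \<theta>:{\<theta>\<in>{-a<..<a}. 0 < h \<theta>}|lborel. E_sum \<epsilon> I ang x \<theta> t\<bar> \<le> Bd \<epsilon> S N"
proof -
  define U where "U = {\<theta>\<in>{-a<..<a}. 0 < h \<theta>}"
  define e where "e \<theta> = E_sum \<epsilon> I ang x \<theta> t" for \<theta>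
  let ?Z = "{z\<in>{-a<..<a}. h z = 0}"
  obtain K K' where K: "\<And>\<theta>. \<theta> \<in> {-a..a} \<Longrightarrow> (K has_real_derivative K' \<theta>) (at \<theta> within {-a..a})"
    "\<And>\<theta>. \<theta> \<in> {-a..a} \<Longrightarrow> \<bar>K \<theta>\<bar> \<le> B * S"
    "\<And>\<theta>. \<theta> \<in> {-a..a} \<Longrightarrow> \<bar>e \<theta> - \<epsilon> * K' \<theta>\<bar> \<le> \<epsilon> * (B * S)"
    using approx_primitive_sum[OF x \<epsilon> t I S(1)] unfolding e_def by blast
  have "continuous_on {-a..a} e"
    unfolding e_def
    by (intro continuous_intros continuous_on_compose2[OF E_cont[OF \<epsilon>], of _ "\<lambda>\<theta>. (\<theta>, t)", simplified])
      (use t in \<open>auto simp: abs_le_iff\<close>)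
  then have eI: "set_integrable lborel {-a..a} e" by (rule borel_integrable_atLeastAtMost')
  have "open U"
  proof -
    have "open ({-a<..<a} \<inter> h -` {0<..})"
      by (rule continuous_open_preimage[OF continuous_on_subset[OF h(1)]]) auto
    moreover have "U = {-a<..<a} \<inter> h -` {0<..}" by (auto simp: U_def)
    ultimately show ?thesis by simp
  qed
  then have eU: "set_integrable lborel U e"
    by (intro set_integrable_subset[OF eI]) (auto simp: U_def)
  define i where "i = (LINT \<theta>:U|lborel. e \<theta>)"
  have "(e has_integral i) U"
    using set_borel_integral_eq_integral[OF eU] by (simp add: i_def has_integral_integral)
  then have i: "((\<lambda>\<theta>. if \<theta> \<in> U then e \<theta> else 0) has_integral i) {-a..a}"
    by (subst has_integral_restrict) (auto simp: U_def)
  obtain j where j: "((\<lambda>\<theta>. if 0 < h \<theta> then K' \<theta> else 0) has_integral j) {-a..a}"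
    "\<bar>j\<bar> \<le> \<bar>K (-a)\<bar> + \<bar>K a\<bar> + 2 * (\<Sum>z\<in>?Z. \<bar>K z\<bar>)"
    using has_integral_superlevel[OF _ h(1,2), of K K'] K(1) a_pos
    by (auto simp: has_real_derivative_iff_has_vector_derivative)
  have j1: "((\<lambda>\<theta>. if \<theta> \<in> U then K' \<theta> else 0) has_integral j) {-a..a}"
    by (rule has_integral_spike_finite[OF _ _ j(1), of "{-a, a}"]) (auto simp: U_def)
  have "\<bar>j\<bar> \<le> B * S + B * S + 2 * (N * (B * S))"
  proof -
    have "(\<Sum>z\<in>?Z. \<bar>K z\<bar>) \<le> real (card ?Z) * (B * S)"
      by (rule sum_bounded_above) (use K(2) in auto)
    also have "\<dots> \<le> N * (B * S)" by (intro mult_right_mono h(3) mult_nonneg_nonneg B_nonneg S)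
    finally have "(\<Sum>z\<in>?Z. \<bar>K z\<bar>) \<le> N * (B * S)" .
    moreover have "\<bar>K (-a)\<bar> \<le> B * S" "\<bar>K a\<bar> \<le> B * S" using K(2) a_pos by auto
    ultimately show ?thesis using j(2) by linarith
  qed
  then have jb: "\<epsilon> * \<bar>j\<bar> \<le> \<epsilon> * (B * S + B * S + 2 * (N * (B * S)))"
    using \<epsilon> by (intro mult_left_mono) auto
  have "((\<lambda>\<theta>. (if \<theta> \<in> U then e \<theta> else 0) - \<epsilon> * (if \<theta> \<in> U then K' \<theta> else 0)) has_integral (i - \<epsilon> * j)) {-a..a}"
    by (rule has_integral_diff[OF i has_integral_mult_right[OF j1]])
  then have "norm (i - \<epsilon> * j) \<le> (\<epsilon> * (B * S)) * measure lborel {-a..a}"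
    by (rule has_integral_bound_real[where S = "{}", rotated 2]) (use K(3) \<epsilon> B_nonneg S(2) in auto)
  then have "\<bar>i - \<epsilon> * j\<bar> \<le> (\<epsilon> * (B * S)) * (2 * a)" using a_pos by simp
  moreover have "\<bar>i\<bar> \<le> \<bar>i - \<epsilon> * j\<bar> + \<epsilon> * \<bar>j\<bar>" using \<epsilon> abs_triangle_ineq[of "i - \<epsilon> * j" "\<epsilon> * j"] by (simp add: abs_mult)
  ultimately have "\<bar>i\<bar> \<le> (\<epsilon> * (B * S)) * (2 * a) + \<epsilon> * (B * S + B * S + 2 * (N * (B * S)))"
    using jb by linarith
  also have "\<dots> = Bd \<epsilon> S N" by (simp add: algebra_simps)
  finally show ?thesis by (simp add: i_def e_def U_def)
qed

text \<open>Fubini with \<theta> inside, because the cancellation takes place along the curve; the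
  integral over \<open>t\<close> only contributes the thickness \<open>2 * \<tau>\<close>.\<close>

lemma region_bound:
  assumes x: "x \<in> V" and \<epsilon>: "0 < \<epsilon>" and I: "finite I" and \<tau>: "0 \<le> \<tau>" "\<tau> \<le> \<delta>"
    and S: "\<And>\<theta> t. \<theta> \<in> {-a..a} \<Longrightarrow> \<bar>t\<bar> \<le> \<delta> \<Longrightarrow> (\<Sum>k\<in>I. decay \<epsilon> (ang k) x \<theta> t) \<le> S" "0 \<le> S"
    and W: "open W" "W \<subseteq> {-a<..<a} \<times> {-\<tau>..\<tau>}" and N: "0 \<le> N"
    and sec: "\<And>t. \<bar>t\<bar> \<le> \<tau> \<Longrightarrow> superlevel_section N {\<theta>. (\<theta>, t) \<in> W}"
  shows "set_integrable lborel W (\<lambda>p. E_sum \<epsilon> I ang x (fst p) (snd p))"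
    "\<bar>LINT p:W|lborel. E_sum \<epsilon> I ang x (fst p) (snd p)\<bar> \<le> 2 * \<tau> * Bd \<epsilon> S N"
proof -
  let ?e = "\<lambda>p. E_sum \<epsilon> I ang x (fst p) (snd p)"
  have "set_integrable lborel ({-a..a} \<times> {-\<delta>..\<delta>}) ?e"
    unfolding set_integrable_def
    by (intro borel_integrable_compact compact_Times compact_Icc continuous_intros E_cont[OF \<epsilon>])
  then show i: "set_integrable lborel W ?e"
  proof (rule set_integrable_subset)
    show "W \<in> sets lborel" using W(1) by simp
    show "W \<subseteq> {-a..a} \<times> {-\<delta>..\<delta>}"
    proof
      fix p assume "p \<in> W"
      then have "p \<in> {-a<..<a} \<times> {-\<tau>..\<tau>}" using W(2) by blast
      then show "p \<in> {-a..a} \<times> {-\<delta>..\<delta>}" using \<tau> by (cases p) auto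
    qed
  qed
  then have ip: "integrable (lborel \<Otimes>\<^sub>M lborel) (\<lambda>(\<theta>, t). indicator W (\<theta>, t) *\<^sub>R ?e (\<theta>, t))"
    by (simp add: lborel_prod set_integrable_def case_prod_unfold)
  have "(LINT p:W|lborel. ?e p) = (LINT p|(lborel \<Otimes>\<^sub>M lborel). (\<lambda>(\<theta>, t). indicator W (\<theta>, t) *\<^sub>R ?e (\<theta>, t)) p)"
    by (simp add: set_lebesgue_integral_def lborel_prod case_prod_unfold)
  also have "\<dots> = (LINT t|lborel. LINT \<theta>|lborel. indicator W (\<theta>, t) *\<^sub>R ?e (\<theta>, t))"
    by (rule lborel_pair.integral_snd[OF ip, symmetric])
  finally have eq: "(LINT p:W|lborel. ?e p) = (LINT t|lborel. LINT \<theta>|lborel. indicator W (\<theta>, t) *\<^sub>R ?e (\<theta>, t))" .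
  show "\<bar>LINT p:W|lborel. ?e p\<bar> \<le> 2 * \<tau> * Bd \<epsilon> S N"
    unfolding eq
  proof (rule abs_LINT_le[OF _ \<tau>(1)])
    fix t
    show "\<bar>LINT \<theta>|lborel. indicator W (\<theta>, t) *\<^sub>R ?e (\<theta>, t)\<bar> \<le> Bd \<epsilon> S N * indicator {-\<tau>..\<tau>} t"
    proof (cases "\<bar>t\<bar> \<le> \<tau>")
      case True
      obtain h :: "real \<Rightarrow> real" where "continuous_on {-a..a} h \<and> finite {z\<in>{-a<..<a}. h z = 0} \<and>
        real (card {z\<in>{-a<..<a}. h z = 0}) \<le> N \<and> {\<theta>. (\<theta>, t) \<in> W} = {\<theta>\<in>{-a<..<a}. 0 < h \<theta>}"
        using sec[OF True] by (rule exE)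
      note h = this[THEN conjunct1] this[THEN conjunct2, THEN conjunct1]
        this[THEN conjunct2, THEN conjunct2, THEN conjunct1] this[THEN conjunct2, THEN conjunct2, THEN conjunct2]
      have t: "\<bar>t\<bar> \<le> \<delta>" using True \<tau> by simp
      have ind: "indicator W (\<theta>, t) = (indicator {\<theta>\<in>{-a<..<a}. 0 < h \<theta>} \<theta> :: real)" for \<theta>
        unfolding h(4)[symmetric] by (simp add: indicator_def)
      have "\<bar>LINT \<theta>|lborel. indicator W (\<theta>, t) *\<^sub>R ?e (\<theta>, t)\<bar> \<le> Bd \<epsilon> S N"
        unfolding ind using inner_bound[OF x \<epsilon> t I S(1)[OF _ t] S(2) h(1,2,3)]
        by (simp add: set_lebesgue_integral_def)
      then show ?thesis using True by (auto simp: abs_le_iff)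
    next
      case False
      then have "(\<theta>, t) \<notin> W" for \<theta> using W(2) by (auto simp: abs_le_iff)
      moreover have "indicator {-\<tau>..\<tau>} t = (0::real)" using False by (auto simp: abs_le_iff)
      ultimately show ?thesis by simp
    qed
  qed
qed

lemma Y_has_derivative:
  assumes "\<theta> \<in> {-a<..<a}"
  shows "(Yp has_derivative
    (\<lambda>h. fst h *\<^sub>R ((r \<theta> + t) *\<^sub>R ndir \<theta>) + snd h *\<^sub>R dir \<theta>)) (at (\<theta>, t))"
proof -
  have "at \<theta> within {-a..a} = at \<theta>"
    using assms by (intro at_within_interior) (simp add: interior_atLeastAtMost_real)
  then have yd: "(y has_derivative (\<lambda>h. h *\<^sub>R (r \<theta> *\<^sub>R ndir \<theta>))) (at (fst (\<theta>, t)))"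
    using y_deriv[of \<theta>] assms by (simp add: has_vector_derivative_def)
  have dd: "(dir has_derivative (\<lambda>h. h *\<^sub>R ndir \<theta>)) (at (fst (\<theta>, t)))"
    using dir_has_vector_derivative[of \<theta> UNIV] by (simp add: has_vector_derivative_def)
  have f: "(fst has_derivative fst) (at (\<theta>, t))" and s: "(snd has_derivative snd) (at (\<theta>, t))"
    by (rule bounded_linear_imp_has_derivative; rule bounded_linear_fst bounded_linear_snd)+
  have "((\<lambda>p. y (fst p) + snd p *\<^sub>R dir (fst p)) has_derivative
    (\<lambda>h. fst h *\<^sub>R (r \<theta> *\<^sub>R ndir \<theta>) + (snd (\<theta>, t) *\<^sub>R (fst h *\<^sub>R ndir \<theta>) + snd h *\<^sub>R dir (fst (\<theta>, t))))) (at (\<theta>, t))"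
    by (intro has_derivative_add has_derivative_scaleR s has_derivative_compose[OF f yd] has_derivative_compose[OF f dd])
  then show ?thesis unfolding Y_def
    by (rule has_derivative_eq_rhs) (auto simp: fun_eq_iff algebra_simps scaleR_add_left)
qed

lemma image_bound:
  assumes x: "x \<in> V" and \<epsilon>: "0 < \<epsilon>" and I: "finite I" and \<tau>: "0 \<le> \<tau>" "\<tau> \<le> \<delta>"
    and S: "\<And>\<theta> t. \<theta> \<in> {-a..a} \<Longrightarrow> \<bar>t\<bar> \<le> \<delta> \<Longrightarrow> (\<Sum>k\<in>I. decay \<epsilon> (ang k) x \<theta> t) \<le> S" "0 \<le> S"
    and W: "open W" "W \<subseteq> {-a<..<a} \<times> {-\<tau>..\<tau>}" and N: "0 \<le> N"
    and sec: "\<And>t. \<bar>t\<bar> \<le> \<tau> \<Longrightarrow> superlevel_section N {\<theta>. (\<theta>, t) \<in> W}"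
    and inj: "inj_on Yp W"
  defines "k \<equiv> \<lambda>v. (\<Sum>k\<in>I. \<psi>d \<epsilon> (ang k) x v) * \<Delta>f v"
  shows "open (Yp ` W)"
    "set_integrable lborel (Yp ` W) k"
    "\<bar>LINT v:Yp ` W|lborel. k v\<bar> \<le> 2 * \<tau> * Bd \<epsilon> S N"
proof -
  let ?Y = "\<lambda>p. Y (fst p) (snd p)"
  let ?J = "\<lambda>p. - (r (fst p) + snd p)"
  have W': "p \<in> {-a..a} \<times> {-\<delta>..\<delta>}" "fst p \<in> {-a<..<a}" if "p \<in> W" for p
  proof -
    have "p \<in> {-a<..<a} \<times> {-\<tau>..\<tau>}" using W(2) that by blast
    then show "p \<in> {-a..a} \<times> {-\<delta>..\<delta>}" "fst p \<in> {-a<..<a}" using \<tau> by (cases p; auto)+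
  qed
  have EJ: "?J p * k (?Y p) = E_sum \<epsilon> I ang x (fst p) (snd p)" for p
    unfolding k_def E_def by (simp add: sum_distrib_left sum_distrib_right mult.assoc)
  have der: "(?Y has_derivative (\<lambda>h. fst h *\<^sub>R ((r (fst p) + snd p) *\<^sub>R ndir (fst p)) + snd h *\<^sub>R dir (fst p))) (at p)"
    if "p \<in> W" for p
    using Y_has_derivative[OF W'(2)[OF that], of "snd p"] by simp
  have cont: "continuous_on (?Y ` W) k"
    unfolding k_def using \<epsilon> W'(1)
    by (intro continuous_intros continuous_on_compose2[OF \<psi>_cont] continuous_on_subset[OF jump_cont]) auto
  have J: "?J p = \<bar>fst ((r (fst p) + snd p) *\<^sub>R ndir (fst p)) * snd (dir (fst p))
      - snd ((r (fst p) + snd p) *\<^sub>R ndir (fst p)) * fst (dir (fst p))\<bar>" if "p \<in> W" for p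
  proof -
    have "fst (q *\<^sub>R ndir b) * snd (dir b) - snd (q *\<^sub>R ndir b) * fst (dir b) = - q" for q b
    proof -
      have "fst (q *\<^sub>R ndir b) * snd (dir b) - snd (q *\<^sub>R ndir b) * fst (dir b) = - (q * (ndir b \<bullet> ndir b))"
        by (simp add: ndir_def dir_def inner_prod_def algebra_simps del: sin_cos_squared_add3)
      then show ?thesis by (simp add: ndir_ndir)
    qed
    moreover have "r (fst p) + snd p < 0"
      using W'(1)[OF that] by (intro jac_neg) (auto simp: abs_le_iff mem_Times_iff)
    ultimately show ?thesis by simp
  qed
  have int: "set_integrable lborel W (\<lambda>p. ?J p * k (?Y p))"
    unfolding EJ by (rule region_bound(1)[OF x \<epsilon> I \<tau> S W N sec])
  note im = integral_image_pair[OF W(1) inj der cont J int]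
  show "open (?Y ` W)" by (rule im(1))
  show "set_integrable lborel (?Y ` W) k" by (rule im(2))
  show "\<bar>LINT v:?Y ` W|lborel. k v\<bar> \<le> 2 * \<tau> * Bd \<epsilon> S N"
  proof -
    have "(LINT v:?Y ` W|lborel. k v) = (LINT p:W|lborel. E_sum \<epsilon> I ang x (fst p) (snd p))"
      by (rule trans[OF im(3) arg_cong[where f = "set_lebesgue_integral lborel W", OF ext[OF EJ]]])
    then show ?thesis using region_bound(2)[OF x \<epsilon> I \<tau> S W N sec] by simp
  qed
qed

section \<open>The perturbation in tube coordinates\<close>

text \<open>The end parameters are left out because the tube map need not be injective there; the
  omitted points lie on two lines.\<close>

definition Wp :: "(real \<Rightarrow> real) \<Rightarrow> (real \<times> real) set" where
  "Wp h = {p. - a < fst p \<and> fst p < a \<and> 0 < snd p \<and> snd p < h (fst p)}"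

definition Wm :: "(real \<Rightarrow> real) \<Rightarrow> (real \<times> real) set" where
  "Wm h = {p. - a < fst p \<and> fst p < a \<and> h (fst p) < snd p \<and> snd p < 0}"

lemma open_Wp: "continuous_on UNIV h \<Longrightarrow> open (Wp h)"
  and open_Wm: "continuous_on UNIV h \<Longrightarrow> open (Wm h)"
  unfolding Wp_def Wm_def
  by (intro open_Collect_conj open_Collect_less continuous_intros; rule continuous_on_compose2; auto intro: continuous_intros)+

definition side_set :: "bool \<Rightarrow> (real \<Rightarrow> real) \<Rightarrow> (real \<times> real) set" where
  "side_set b h = {v. \<exists>\<theta>\<in>{-a..a}. \<exists>t. v = y \<theta> + t *\<^sub>R dir \<theta> \<and> (if b then 0 < t \<and> t < h \<theta> else h \<theta> < t \<and> t < 0)}"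

lemma perturbation_side_set:
  "perturbation a y \<Delta>f h v = (if v \<in> side_set True h then \<Delta>f v else if v \<in> side_set False h then - \<Delta>f v else 0)"
  unfolding perturbation_def side_set_def mem_Collect_eq if_True if_False by (rule refl)

text \<open>An open image plus two segments of end normals: this shows that the set is Borel, and
  that it may be replaced by the image under an integral.\<close>

lemma side_set_eq:
  fixes h :: "real \<Rightarrow> real"
  defines "L \<equiv> \<lambda>c b. {v. ndir b \<bullet> v = ndir b \<bullet> y b \<and> (if c then 0 < (v - y b) \<bullet> dir b \<and> (v - y b) \<bullet> dir b < h b
      else h b < (v - y b) \<bullet> dir b \<and> (v - y b) \<bullet> dir b < 0)}"
  shows "side_set c h = Yp ` (if c then Wp h else Wm h) \<union> L c a \<union> L c (-a)"
proof -
  let ?Q = "\<lambda>\<theta> t. if c then 0 < t \<and> t < h \<theta> else h \<theta> < t \<and> t < 0"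
  have "{-a..a} = {-a<..<a} \<union> {a, -a}" using a_pos by auto
  then have "side_set c h = {v. \<exists>\<theta>\<in>{-a<..<a}. \<exists>t. v = y \<theta> + t *\<^sub>R dir \<theta> \<and> ?Q \<theta> t}
    \<union> {v. \<exists>t. v = y a + t *\<^sub>R dir a \<and> ?Q a t} \<union> {v. \<exists>t. v = y (-a) + t *\<^sub>R dir (-a) \<and> ?Q (-a) t}"
    unfolding side_set_def by auto
  moreover have "{v. \<exists>\<theta>\<in>{-a<..<a}. \<exists>t. v = y \<theta> + t *\<^sub>R dir \<theta> \<and> ?Q \<theta> t} = Yp ` (if c then Wp h else Wm h)"
    by (auto simp: Y_def Wp_def Wm_def image_def)
  moreover have "{v. \<exists>t. v = y b + t *\<^sub>R dir b \<and> ?Q b t} = L c b" for b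
    unfolding on_normal_iff L_def by simp
  ultimately show ?thesis by simp
qed

lemma open_Y_image:
  assumes "open W" "W \<subseteq> {-a..a} \<times> T" "inj_on Yp W"
  shows "open (Yp ` W)"
  by (rule invariance_of_domain[OF continuous_on_subset[OF Y_cont assms(2)] assms(1,3)])

lemma side_set_measurable:
  assumes "continuous_on UNIV h" "\<And>s. \<bar>h s\<bar> \<le> \<tau>" "\<tau> \<le> \<delta>"
    and inj: "inj_on Yp ({-a<..<a} \<times> {-\<delta>..\<delta>})"
  shows "side_set c h \<in> sets borel"
proof -
  let ?W = "if c then Wp h else Wm h"
  have sub: "?W \<subseteq> {-a<..<a} \<times> {-\<delta>..\<delta>}"
  proof
    fix p assume "p \<in> ?W"
    then show "p \<in> {-a<..<a} \<times> {-\<delta>..\<delta>}"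
      using assms(2)[of "fst p"] assms(3) by (cases p) (auto simp: Wp_def Wm_def split: if_splits)
  qed
  have "open (Yp ` ?W)"
  proof (rule open_Y_image)
    show "open ?W" using open_Wp open_Wm assms(1) by simp
    show "?W \<subseteq> {-a..a} \<times> {-\<delta>..\<delta>}"
      by (rule order_trans[OF sub]) (rule Sigma_mono; auto)
    show "inj_on Yp ?W" by (rule inj_on_subset[OF inj sub])
  qed
  moreover have "{v. ndir b \<bullet> v = ndir b \<bullet> y b \<and> (if c then 0 < (v - y b) \<bullet> dir b \<and> (v - y b) \<bullet> dir b < h b
      else h b < (v - y b) \<bullet> dir b \<and> (v - y b) \<bullet> dir b < 0)} \<in> sets borel" for b
    by (cases c) simp_all
  ultimately show ?thesis unfolding side_set_eq by (intro sets.Un) auto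
qed

definition tube :: "(real \<times> real) set" where
  "tube = Yp ` ({-a..a} \<times> {-\<delta>..\<delta>})"

lemma compact_tube: "compact tube"
  unfolding tube_def by (intro compact_continuous_image Y_cont compact_Times compact_Icc)

lemma perturbation_support:
  assumes "\<And>s. \<bar>h s\<bar> \<le> \<tau>" "\<tau> \<le> \<delta>" "perturbation a y \<Delta>f h v \<noteq> 0"
  shows "v \<in> tube"
proof -
  have "v \<in> side_set True h \<or> v \<in> side_set False h"
    using assms(3) unfolding perturbation_side_set by (auto split: if_splits)
  then obtain \<theta> t where "\<theta> \<in> {-a..a}" "v = y \<theta> + t *\<^sub>R dir \<theta>" "0 < t \<and> t < h \<theta> \<or> h \<theta> < t \<and> t < 0"
    unfolding side_set_def mem_Collect_eq if_True if_False by blast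
  moreover have "\<bar>t\<bar> \<le> \<delta>" using assms(1)[of \<theta>] assms(2) calculation(3) by auto
  ultimately show ?thesis unfolding tube_def
    by (intro image_eqI[of _ _ "(\<theta>, t)"]) (auto simp: Y_def abs_le_iff)
qed

lemma perturbation_integrable:
  assumes "continuous_on UNIV h" "\<And>s. \<bar>h s\<bar> \<le> \<tau>" "\<tau> \<le> \<delta>"
    and inj: "inj_on Yp ({-a<..<a} \<times> {-\<delta>..\<delta>})"
  shows "integrable lborel (perturbation a y \<Delta>f h)"
proof (rule Bochner_Integration.integrable_bound)
  let ?f = "perturbation a y \<Delta>f h"
  \<comment> \<open>\<Delta>f is controlled only near the curve. Its restriction to the compact tube
    is integrable and dominates the perturbation, which vanishes outside the tube.\<close>
  let ?g = "\<lambda>v. indicator tube v *\<^sub>R \<Delta>f v"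
  have "set_integrable lborel tube \<Delta>f"
    unfolding set_integrable_def tube_def
    by (rule borel_integrable_compact[OF compact_tube[unfolded tube_def] jump_cont])
  then show g: "integrable lborel ?g" by (simp add: set_integrable_def)
  then have [measurable]: "?g \<in> borel_measurable borel" by auto
  note [measurable] = side_set_measurable[OF assms]
  have eq: "?f v = (if v \<in> side_set True h then ?g v else if v \<in> side_set False h then - ?g v else 0)" for v
  proof (cases "v \<in> tube")
    case True then show ?thesis by (simp add: perturbation_side_set)
  next
    case False
    then have "?f v = 0" using perturbation_support[of h \<tau> v, OF assms(2,3)] by blast
    then show ?thesis using False by simp
  qed
  have m: "(\<lambda>v. if v \<in> side_set True h then ?g v else if v \<in> side_set False h then - ?g v else 0) \<in> borel_measurable borel"
    by measurable
  have feq: "?f = (\<lambda>v. if v \<in> side_set True h then ?g v else if v \<in> side_set False h then - ?g v else 0)"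
    using eq by (rule ext)
  show "?f \<in> borel_measurable lborel" unfolding feq using m by simp
  show "AE v in lborel. norm (?f v) \<le> norm (?g v)" by (rule AE_I2) (simp add: eq)
qed

lemma perturbation_bound:
  assumes x: "x \<in> V" and \<epsilon>: "0 < \<epsilon>" and I: "finite I" and \<tau>: "0 \<le> \<tau>" "\<tau> \<le> \<delta>"
    and S: "\<And>\<theta> t. \<theta> \<in> {-a..a} \<Longrightarrow> \<bar>t\<bar> \<le> \<delta> \<Longrightarrow> (\<Sum>k\<in>I. decay \<epsilon> (ang k) x \<theta> t) \<le> S" "0 \<le> S"
    and h: "continuous_on UNIV h" "\<And>s. \<bar>h s\<bar> \<le> \<tau>" and N: "0 \<le> N"
    and lev: "\<And>t. finite {z\<in>{-a<..<a}. h z = t}" "\<And>t. real (card {z\<in>{-a<..<a}. h z = t}) \<le> N"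
    and inj: "inj_on Yp ({-a<..<a} \<times> {-\<delta>..\<delta>})"
  shows "\<bar>\<Sum>k\<in>I. LINT v|lborel. \<psi>d \<epsilon> (ang k) x v * perturbation a y \<Delta>f h v\<bar>
    \<le> 2 * (2 * \<tau> * Bd \<epsilon> S N)"
proof -
  let ?f = "perturbation a y \<Delta>f h"
  let ?Y = "\<lambda>p. Y (fst p) (snd p)"
  define \<psi>t where "\<psi>t v = (\<Sum>k\<in>I. \<psi>d \<epsilon> (ang k) x v)" for v
  note fi = perturbation_integrable[OF h \<tau>(2) inj]
  have hc: "continuous_on {-a..a} h" using h(1) by (rule continuous_on_subset) simp
  have sub: "Wp h \<subseteq> {-a<..<a} \<times> {-\<tau>..\<tau>}" "Wm h \<subseteq> {-a<..<a} \<times> {-\<tau>..\<tau>}"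
  proof -
    have "p \<in> {-a<..<a} \<times> {-\<tau>..\<tau>}" if "p \<in> Wp h \<or> p \<in> Wm h" for p
      using that h(2)[of "fst p"] \<tau> by (cases p) (auto simp: Wp_def Wm_def)
    then show "Wp h \<subseteq> {-a<..<a} \<times> {-\<tau>..\<tau>}" "Wm h \<subseteq> {-a<..<a} \<times> {-\<tau>..\<tau>}" by auto
  qed
  have box: "{-a<..<a} \<times> {-\<tau>..\<tau>} \<subseteq> {-a<..<a} \<times> {-\<delta>..\<delta>}" using \<tau> by (intro Sigma_mono) auto
  have injW: "inj_on ?Y (Wp h)" "inj_on ?Y (Wm h)"
    by (rule inj_on_subset[OF inj], rule order_trans[OF sub(1) box], rule inj_on_subset[OF inj], rule order_trans[OF sub(2) box])
  have secp: "superlevel_section N {\<theta>. (\<theta>, t) \<in> Wp h}" for t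
  proof (cases "0 < t")
    case True
    show ?thesis
      by (rule exI[of _ "\<lambda>\<theta>. h \<theta> - t"], intro conjI)
        (use True lev[of t] in \<open>auto intro!: continuous_intros hc simp: Wp_def\<close>)
  next
    case False
    \<comment> \<open>An empty slice, written as the superlevel set of a constant without
      zeros.\<close>
    show ?thesis
      by (rule exI[of _ "\<lambda>_. -1"], intro conjI) (use False N in \<open>auto simp: Wp_def\<close>)
  qed
  have secm: "superlevel_section N {\<theta>. (\<theta>, t) \<in> Wm h}" for t
  proof (cases "t < 0")
    case True
    have "{z\<in>{-a<..<a}. t - h z = 0} = {z\<in>{-a<..<a}. h z = t}" by auto
    then show ?thesis
      by (intro exI[of _ "\<lambda>\<theta>. t - h \<theta>"] conjI)
        (use True lev[of t] in \<open>auto intro!: continuous_intros hc simp: Wm_def\<close>)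
  next
    case False
    show ?thesis
      by (rule exI[of _ "\<lambda>_. -1"], intro conjI) (use False N in \<open>auto simp: Wm_def\<close>)
  qed
  note bp = image_bound[OF x \<epsilon> I \<tau> S open_Wp[OF h(1)] sub(1) N secp injW(1), folded \<psi>t_def]
  note bm = image_bound[OF x \<epsilon> I \<tau> S open_Wm[OF h(1)] sub(2) N secm injW(2), folded \<psi>t_def]
  have \<psi>i: "integrable lborel (\<lambda>v. \<psi>d \<epsilon> (ang k) x v * ?f v)" for k
  proof (rule Bochner_Integration.integrable_bound)
    show "integrable lborel (\<lambda>v. C * ?f v)" using fi by simp
    have [measurable]: "?f \<in> borel_measurable borel" using fi by auto
    have "(\<lambda>v. \<psi>d \<epsilon> (ang k) x v) \<in> borel_measurable borel"
      using \<epsilon> by (intro borel_measurable_continuous_onI continuous_on_compose2[OF \<psi>_cont] continuous_intros) auto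
    then show "(\<lambda>v. \<psi>d \<epsilon> (ang k) x v * ?f v) \<in> borel_measurable lborel"
      by simp
    have "\<bar>\<psi> u v\<bar> \<le> C" for u v
    proof -
      have "C / (1 + (u - v)\<^sup>2) \<le> C / 1" using C_nonneg by (intro divide_left_mono) (auto simp: add_pos_nonneg)
      then show ?thesis using \<psi>_bound[of u v] by simp
    qed
    then show "AE v in lborel. norm (\<psi>d \<epsilon> (ang k) x v * ?f v) \<le> norm (C * ?f v)"
      using C_nonneg by (auto intro!: AE_I2 mult_right_mono simp: abs_mult)
  qed
  have "(\<Sum>k\<in>I. LINT v|lborel. \<psi>d \<epsilon> (ang k) x v * ?f v) = (LINT v|lborel. \<psi>t v * ?f v)"
    unfolding \<psi>t_def sum_distrib_right by (rule Bochner_Integration.integral_sum[symmetric]) (rule \<psi>i)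
  also have "\<dots> = (LINT v|lborel. indicator (?Y ` Wp h) v *\<^sub>R (\<psi>t v * \<Delta>f v) - indicator (?Y ` Wm h) v *\<^sub>R (\<psi>t v * \<Delta>f v))"
  proof (rule integral_cong_AE)
    show "(\<lambda>v. \<psi>t v * ?f v) \<in> borel_measurable lborel"
      unfolding \<psi>t_def sum_distrib_right by (intro borel_measurable_sum borel_measurable_integrable[OF \<psi>i])
    show "(\<lambda>v. indicator (?Y ` Wp h) v *\<^sub>R (\<psi>t v * \<Delta>f v) - indicator (?Y ` Wm h) v *\<^sub>R (\<psi>t v * \<Delta>f v)) \<in> borel_measurable lborel"
      using bp(2) bm(2) unfolding set_integrable_def by (intro borel_measurable_diff borel_measurable_integrable)
    show "AE v in lborel. \<psi>t v * ?f v = indicator (?Y ` Wp h) v *\<^sub>R (\<psi>t v * \<Delta>f v) - indicator (?Y ` Wm h) v *\<^sub>R (\<psi>t v * \<Delta>f v)"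
      using null_line[of a "ndir a \<bullet> y a"] null_line[of "-a" "ndir (-a) \<bullet> y (-a)"]
    proof eventually_elim
      case (elim v)
      have sp: "v \<in> side_set True h \<longleftrightarrow> v \<in> ?Y ` Wp h" and sm: "v \<in> side_set False h \<longleftrightarrow> v \<in> ?Y ` Wm h"
        unfolding side_set_eq using elim by auto
      have "\<not> (v \<in> ?Y ` Wp h \<and> v \<in> ?Y ` Wm h)"
      proof
        assume "v \<in> ?Y ` Wp h \<and> v \<in> ?Y ` Wm h"
        then obtain p q where pq: "p \<in> Wp h" "q \<in> Wm h" "v = ?Y p" "v = ?Y q" by blast
        then have "p = q" using inj_onD[OF inj, of p q] sub box by (metis subsetD)
        then show False using pq by (auto simp: Wp_def Wm_def)
      qed
      then show ?case unfolding perturbation_side_set sp sm by (auto simp: indicator_def)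
    qed
  qed
  also have "\<dots> = (LINT v:?Y ` Wp h|lborel. \<psi>t v * \<Delta>f v) - (LINT v:?Y ` Wm h|lborel. \<psi>t v * \<Delta>f v)"
    using bp(2) bm(2) unfolding set_integrable_def set_lebesgue_integral_def by (rule Bochner_Integration.integral_diff)
  finally have eq: "(\<Sum>k\<in>I. LINT v|lborel. \<psi>d \<epsilon> (ang k) x v * ?f v)
    = (LINT v:?Y ` Wp h|lborel. \<psi>t v * \<Delta>f v) - (LINT v:?Y ` Wm h|lborel. \<psi>t v * \<Delta>f v)" .
  show ?thesis unfolding eq using bp(3) bm(3) by linarith
qed

end

section \<open>The bound on the reconstruction\<close>

lemma compact_norm_bound:
  assumes "compact T" "continuous_on T f"
  obtains M where "0 \<le> M" "\<And>v. v \<in> T \<Longrightarrow> norm (f v) \<le> M"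
proof -
  have "bounded (f ` T)" using assms by (intro compact_imp_bounded compact_continuous_image)
  then obtain M where "\<And>w. w \<in> f ` T \<Longrightarrow> norm w \<le> M" unfolding bounded_iff by blast
  then show ?thesis by (intro that[of "max M 0"]) (auto simp: le_max_iff_disj)
qed

text \<open>Continuity at fixed \<epsilon> makes \<open>Wp\<close> and \<open>Wm\<close> open and
  brings in the intermediate value theorem on the slices.\<close>

lemma Hoelder_continuous:
  fixes h :: "real \<Rightarrow> real"
  assumes "0 < \<epsilon>" "0 < \<gamma>"
    and H: "\<And>s u. 0 < u \<Longrightarrow> \<bar>h (s + sqrt \<epsilon> * u) - h s\<bar> / (\<epsilon> * u powr \<gamma>) \<le> C"
  shows "continuous_on UNIV h"
proof (rule continuous_at_imp_continuous_on, rule ballI)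
  fix x
  have lt: "\<bar>h q - h p\<bar> \<le> C * \<epsilon> * (\<bar>q - p\<bar> / sqrt \<epsilon>) powr \<gamma>" if "p < q" for p q
  proof -
    define u where "u = (q - p) / sqrt \<epsilon>"
    have u: "0 < u" using that assms by (simp add: u_def)
    have "p + sqrt \<epsilon> * u = q" using assms by (simp add: u_def)
    then have "\<bar>h q - h p\<bar> \<le> C * (\<epsilon> * u powr \<gamma>)"
      using H[OF u, of p] assms u by (simp add: pos_divide_le_eq)
    then show ?thesis using that by (simp add: u_def)
  qed
  have "\<bar>h q - h x\<bar> \<le> C * \<epsilon> * (\<bar>q - x\<bar> / sqrt \<epsilon>) powr \<gamma>" for q
    using lt[of x q] lt[of q x] by (cases q x rule: linorder_cases) (auto simp: abs_minus_commute)
  then have b: "\<forall>\<^sub>F q in at x. norm (h q - h x) \<le> C * \<epsilon> * (\<bar>q - x\<bar> / sqrt \<epsilon>) powr \<gamma>"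
    by simp
  have "((\<lambda>q. \<bar>q - x\<bar> / sqrt \<epsilon>) \<longlongrightarrow> \<bar>x - x\<bar> / sqrt \<epsilon>) (at x)"
    using assms(1) by (intro tendsto_intros) auto
  then have "((\<lambda>q. (\<bar>q - x\<bar> / sqrt \<epsilon>) powr \<gamma>) \<longlongrightarrow> 0) (at x)"
    using assms by (intro tendsto_zero_powrI[of _ _ _ \<gamma>]) (auto intro: always_eventually)
  then have "((\<lambda>q. C * \<epsilon> * (\<bar>q - x\<bar> / sqrt \<epsilon>) powr \<gamma>) \<longlongrightarrow> 0) (at x)"
    by (rule tendsto_mult_right_zero)
  then have "((\<lambda>q. h q - h x) \<longlongrightarrow> 0) (at x)"
    using b by (rule Lim_null_comparison[rotated])
  then show "isCont h x" by (simp add: isCont_def LIM_zero_iff)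
qed

text \<open>Division by sqrt \<epsilon> maps the parameter interval, of fixed length
  \<open>2 * a\<close>, onto an interval of length \<open>2 * a / sqrt \<epsilon>\<close> in the
  variable of \<open>H\<^sub>0\<close>.\<close>

lemma rescaled_level_set_card:
  fixes a :: real
  assumes \<epsilon>: "0 < \<epsilon>" and a: "0 < a"
    and lev: "\<And>\<tau> u. finite ({u<..<u + 2 * a / sqrt \<epsilon>} \<inter> rescaled H \<epsilon> -` {\<tau>}) \<and>
        real (card ({u<..<u + 2 * a / sqrt \<epsilon>} \<inter> rescaled H \<epsilon> -` {\<tau>})) \<le> N"
  shows "finite {z\<in>{-a<..<a}. H \<epsilon> z = t}" "real (card {z\<in>{-a<..<a}. H \<epsilon> z = t}) \<le> N"
proof -
  define u where "u = - a / sqrt \<epsilon>"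
  let ?A = "{z\<in>{-a<..<a}. H \<epsilon> z = t}"
  let ?B = "{u<..<u + 2 * a / sqrt \<epsilon>} \<inter> rescaled H \<epsilon> -` {t / \<epsilon>}"
  have s: "0 < sqrt \<epsilon>" using \<epsilon> by simp
  have inj: "inj_on (\<lambda>z. z / sqrt \<epsilon>) ?A" using s by (intro inj_onI) simp
  have e: "u + 2 * a / sqrt \<epsilon> = a / sqrt \<epsilon>" by (simp add: u_def flip: add_divide_distrib)
  have sub: "(\<lambda>z. z / sqrt \<epsilon>) ` ?A \<subseteq> ?B"
    unfolding e
  proof (rule image_subsetI)
    fix z assume z: "z \<in> ?A"
    have "- a / sqrt \<epsilon> < z / sqrt \<epsilon>" "z / sqrt \<epsilon> < a / sqrt \<epsilon>"
      using z s by (auto simp only: mem_Collect_eq greaterThanLessThan_iff intro!: divide_strict_right_mono)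
    moreover have "rescaled H \<epsilon> (z / sqrt \<epsilon>) = t / \<epsilon>" using z s by (simp add: rescaled_def)
    ultimately show "z / sqrt \<epsilon> \<in> {u<..<a / sqrt \<epsilon>} \<inter> rescaled H \<epsilon> -` {t / \<epsilon>}" by (simp add: u_def)
  qed
  have B: "finite ?B" "real (card ?B) \<le> N" using lev by blast+
  show "finite ?A" by (rule inj_on_finite[OF inj sub B(1)])
  have "card ?A \<le> card ?B" by (rule card_inj_on_le[OF inj sub B(1)])
  then show "real (card ?A) \<le> N" using B(2) by linarith
qed

lemma finite_angles:
  assumes "0 < (c::real)" shows "finite {k::int. \<bar>of_int k * c\<bar> \<le> b}"
proof (rule finite_subset)
  show "{k::int. \<bar>of_int k * c\<bar> \<le> b} \<subseteq> {- \<lceil>b / c\<rceil>..\<lceil>b / c\<rceil>}"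
  proof
    fix k assume "k \<in> {k::int. \<bar>of_int k * c\<bar> \<le> b}"
    then have "\<bar>of_int k :: real\<bar> \<le> b / c" using assms by (simp add: abs_mult pos_le_divide_eq)
    then show "k \<in> {- \<lceil>b / c\<rceil>..\<lceil>b / c\<rceil>}" by (simp add: abs_le_iff) linarith
  qed
qed simp

theorem lemma4:
  fixes f \<Delta>f :: "real \<times> real \<Rightarrow> real"
    and y :: "real \<Rightarrow> real \<times> real"
    and H :: "real \<Rightarrow> real \<Rightarrow> real"
    and \<phi> w :: "real \<Rightarrow> real"
    and a \<kappa> \<gamma> :: real
    and x\<^sub>0 :: "real \<times> real"
  assumes "compact_support f"
    and "piecewise_C2 f"
    and "C4_curve (singular_set f)"
    and "finite_order_flat_points (singular_set f)"
    and "normal_angle_param (singular_set f) a y"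
    and "jump_of f a y \<Delta>f"
    and "interpolation_kernel \<phi>"
    and "fourier \<phi> \<in> O[at_infinity](\<lambda>l. of_real (1 / \<bar>l\<bar> ^ 3))"
    and "amplitude_bounded H"
    and "0 < \<gamma>" and "\<gamma> \<le> 1"
    and "uniformly_Hoelder \<gamma> H"
    and "C02 w"
    and "(LINT p|lborel. w p) = 1"
    and "0 < \<kappa>"
    and "x\<^sub>0 \<notin> y ` {-a..a}"
    and "\<forall>\<theta>\<in>{-a..a}. x\<^sub>0 \<notin> tangent_line y \<theta>"
    and "well_behaved_level_sets H"
  shows "\<exists>V C. open V \<and> x\<^sub>0 \<in> V \<and>
           (\<forall>\<^sub>F \<epsilon> in at_right 0. \<forall>x\<in>V.
              \<bar>reconstruction \<kappa> \<phi> w (perturbation a y \<Delta>f (H \<epsilon>)) \<epsilon> x\<bar>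
                \<le> C * (sqrt \<epsilon> * ln (1 / \<epsilon>)))"
proof -
  have a: "0 < a" using assms(5) by (simp add: normal_angle_param_def)
  have \<kappa>: "0 < \<kappa>" by (rule assms(15))
  obtain \<psi> \<Psi> C where \<Psi>_deriv: "\<And>u v. ((\<lambda>v. \<Psi> u v) has_real_derivative \<psi> u v) (at v)"
    and C: "0 \<le> C" and \<Psi>_bound: "\<And>u v. \<bar>\<Psi> u v\<bar> \<le> C / (1 + \<bar>u - v\<bar>)"
    and \<psi>_bound: "\<And>u v. \<bar>\<psi> u v\<bar> \<le> C / (1 + (u - v)\<^sup>2)"
    and \<psi>_cont: "\<And>u. continuous_on UNIV (\<psi> u)"
    and pv: "\<And>\<epsilon> \<alpha> x g B. \<lbrakk>0 < \<epsilon>; integrable lborel g; \<And>v. g v \<noteq> 0 \<Longrightarrow> norm v \<le> B\<rbrakk> \<Longrightarrow>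
      pv_integral (deriv (interpolated_data \<phi> w g \<epsilon> \<alpha>)) (dir \<alpha> \<bullet> x)
        = 1 / \<epsilon>\<^sup>2 * (LINT v|lborel. \<psi> (dir \<alpha> \<bullet> x / \<epsilon>) (dir \<alpha> \<bullet> v / \<epsilon>) * g v)"
  proof (rule reconstruction_kernel[OF assms(7) assms(13)], goal_cases)
    case (1 \<psi> \<Psi> C)
    show ?case by (rule that; fact 1)
  qed
  obtain r r0 where r_cont: "continuous_on {-a..a} r" and r0: "0 < r0" "\<And>\<theta>. \<theta> \<in> {-a..a} \<Longrightarrow> r \<theta> \<le> - r0"
    and y_deriv: "\<And>\<theta>. \<theta> \<in> {-a..a} \<Longrightarrow> (y has_vector_derivative r \<theta> *\<^sub>R ndir \<theta>) (at \<theta> within {-a..a})"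
    by (rule normal_angle_param_velocity[OF assms(5)]) (rule that)
  have y_cont: "continuous_on {-a..a} y"
    using has_vector_derivative_continuous[OF y_deriv] by (simp add: continuous_on_eq_continuous_within)
  obtain \<delta>1 where \<delta>1: "0 < \<delta>1" and inj1: "inj_on (\<lambda>(\<theta>, t). y \<theta> + t *\<^sub>R dir \<theta>) ({-a<..<a} \<times> {-\<delta>1<..<\<delta>1})"
  proof (rule tube_injective[OF assms(5)], goal_cases)
    case 1
    show ?case by (rule closed_param_normals_agree[OF assms(5,3,6) 1(2)])
  next
    case (2 \<delta>)
    show ?case by (rule that; fact 2)
  qed
  obtain \<Omega> D where \<Omega>: "open \<Omega>" "y ` {-a..a} \<subseteq> \<Omega>"
    and D: "\<And>x. x \<in> \<Omega> \<Longrightarrow> (\<Delta>f has_derivative blinfun_apply (D x)) (at x)" and D_cont: "continuous_on \<Omega> D"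
  proof (rule jump_C1[OF assms(6)], goal_cases)
    case (1 \<Omega> D)
    show ?case by (rule that; fact 1)
  qed
  obtain e where e: "0 < e" "(\<Union>p\<in>y ` {-a..a}. cball p e) \<subseteq> \<Omega>"
    by (rule compact_subset_open_imp_cball_epsilon_subset[OF compact_continuous_image[OF y_cont compact_Icc] \<Omega>]) (rule that)
  obtain b0 where b0: "0 < b0" "\<And>\<theta>. \<theta> \<in> {-a..a} \<Longrightarrow> b0 \<le> \<bar>(x\<^sub>0 - y \<theta>) \<bullet> dir \<theta>\<bar>"
  proof -
    have ne: "{-a..a} \<noteq> {}" using a by simp
    have cont: "continuous_on {-a..a} (\<lambda>\<theta>. \<bar>(x\<^sub>0 - y \<theta>) \<bullet> dir \<theta>\<bar>)"
      by (intro continuous_intros y_cont continuous_on_dir)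
    obtain \<theta>m where m: "\<theta>m \<in> {-a..a}"
      "\<forall>\<theta>\<in>{-a..a}. \<bar>(x\<^sub>0 - y \<theta>m) \<bullet> dir \<theta>m\<bar> \<le> \<bar>(x\<^sub>0 - y \<theta>) \<bullet> dir \<theta>\<bar>"
      using continuous_attains_inf[OF compact_Icc ne cont] by (elim bexE) (rule that)
    have "(x\<^sub>0 - y \<theta>m) \<bullet> dir \<theta>m \<noteq> 0" using assms(17) m(1) by (auto simp: tangent_line_def)
    then show ?thesis using m(2) by (intro that[of "\<bar>(x\<^sub>0 - y \<theta>m) \<bullet> dir \<theta>m\<bar>"]) auto
  qed
  \<comment> \<open>\<open>\<delta>1 / 2\<close> keeps the closed range of \<open>t\<close> inside
    the injective tube, \<open>r0 / 2\<close> keeps \<open>r \<theta> + t\<close> negative, and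
    \<open>e\<close> keeps the tube inside \<Omega>. With \<open>b0 / 4\<close>, and the radius
    \<open>b0 / 4\<close> of \<open>V\<close>, a transversality margin of \<open>b0 / 2\<close>
    remains.\<close>
  define \<delta> where "\<delta> = min (min (\<delta>1 / 2) (r0 / 2)) (min (b0 / 4) e)"
  have \<delta>: "0 < \<delta>" "\<delta> < \<delta>1" "\<delta> < r0" "\<delta> \<le> b0 / 4" "\<delta> \<le> e"
    using \<delta>1 r0 b0 e by (auto simp: \<delta>_def)
  define T where "T = (\<lambda>p. y (fst p) + snd p *\<^sub>R dir (fst p)) ` ({-a..a} \<times> {-\<delta>..\<delta>})"
  have T: "compact T"
    unfolding T_def
    by (intro compact_continuous_image compact_Times compact_Icc continuous_intros
        continuous_on_compose2[OF y_cont] continuous_on_compose2[OF continuous_on_dir[of UNIV]]) auto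
  have inT: "y \<theta> + t *\<^sub>R dir \<theta> \<in> T" if "\<theta> \<in> {-a..a}" "\<bar>t\<bar> \<le> \<delta>" for \<theta> t
    unfolding T_def using that by (intro image_eqI[of _ _ "(\<theta>, t)"]) (auto simp: abs_le_iff)
  have T\<Omega>: "T \<subseteq> \<Omega>"
  proof
    fix v assume "v \<in> T"
    then obtain \<theta> t where v: "\<theta> \<in> {-a..a}" "t \<in> {-\<delta>..\<delta>}" "v = y \<theta> + t *\<^sub>R dir \<theta>"
      unfolding T_def by auto
    then have "v \<in> cball (y \<theta>) e" using \<delta>(5) by (auto simp: dist_norm)
    then show "v \<in> \<Omega>" using e(2) v(1) by blast
  qed
  have "continuous_on T \<Delta>f"
    using T\<Omega> has_derivative_continuous[OF D] by (auto intro!: continuous_at_imp_continuous_on)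
  then obtain M1 where M1: "0 \<le> M1" "\<And>v. v \<in> T \<Longrightarrow> norm (\<Delta>f v) \<le> M1"
    using compact_norm_bound[OF T] by blast
  obtain M2 where M2: "0 \<le> M2" "\<And>v. v \<in> T \<Longrightarrow> norm (D v) \<le> M2"
    using compact_norm_bound[OF T continuous_on_subset[OF D_cont T\<Omega>]] by blast
  obtain M3 where M3: "0 \<le> M3" "\<And>\<theta>. \<theta> \<in> {-a..a} \<Longrightarrow> norm (r \<theta>) \<le> M3"
    using compact_norm_bound[OF compact_Icc r_cont] by blast
  obtain M4 where M4: "0 \<le> M4" "\<And>v. v \<in> T \<Longrightarrow> norm v \<le> M4"
    using compact_norm_bound[OF T continuous_on_id] by auto
  define M where "M = M1 + M2 + (M3 + \<delta>) + (norm x\<^sub>0 + b0 / 4 + M4)"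
  define V where "V = ball x\<^sub>0 (b0 / 4)"
  interpret tk: tube_kernel a \<delta> M "b0 / 2" C y r \<Delta>f D \<psi> \<Psi> V
  proof
    fix \<theta> t assume *: "\<theta> \<in> {-a..a}" "\<bar>t\<bar> \<le> \<delta>"
    show "r \<theta> + t < 0" using r0(2)[OF *(1)] *(2) \<delta>(3) by linarith
    show "\<bar>r \<theta> + t\<bar> \<le> M"
      using M3(2)[OF *(1)] *(2) M1(1) M2(1) M4(1) b0(1) norm_ge_zero[of x\<^sub>0] unfolding M_def real_norm_def by linarith
    show "(\<Delta>f has_derivative blinfun_apply (D (y \<theta> + t *\<^sub>R dir \<theta>))) (at (y \<theta> + t *\<^sub>R dir \<theta>))"
      using inT[OF *] T\<Omega> by (intro D) blast
    show "norm (D (y \<theta> + t *\<^sub>R dir \<theta>)) \<le> M"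
      using M2(2)[OF inT[OF *]] M1(1) M3(1) M4(1) b0(1) \<delta>(1) norm_ge_zero[of x\<^sub>0] unfolding M_def by linarith
    show "\<bar>\<Delta>f (y \<theta> + t *\<^sub>R dir \<theta>)\<bar> \<le> M"
      using M1(2)[OF inT[OF *]] M2(1) M3(1) M4(1) b0(1) \<delta>(1) norm_ge_zero[of x\<^sub>0] unfolding M_def real_norm_def by linarith
    fix x assume x: "x \<in> V"
    then have dx: "norm (x - x\<^sub>0) < b0 / 4" by (simp add: V_def dist_norm norm_minus_commute)
    show "b0 / 2 \<le> \<bar>(x - (y \<theta> + t *\<^sub>R dir \<theta>)) \<bullet> dir \<theta>\<bar>"
    proof -
      have eq: "(x - (y \<theta> + t *\<^sub>R dir \<theta>)) \<bullet> dir \<theta> = (x\<^sub>0 - y \<theta>) \<bullet> dir \<theta> + (x - x\<^sub>0) \<bullet> dir \<theta> - t"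
        by (simp add: inner_diff_left inner_add_left dir_dir)
      have "\<bar>(x - x\<^sub>0) \<bullet> dir \<theta>\<bar> \<le> b0 / 4"
        using dir_inner_le[of \<theta> "x - x\<^sub>0"] dx by (simp add: inner_commute)
      then show ?thesis unfolding eq using b0(2)[OF *(1)] *(2) \<delta>(4) by linarith
    qed
    show "norm (x - (y \<theta> + t *\<^sub>R dir \<theta>)) \<le> M"
    proof -
      have "norm (x - (y \<theta> + t *\<^sub>R dir \<theta>)) \<le> norm x + norm (y \<theta> + t *\<^sub>R dir \<theta>)"
        by (rule norm_triangle_ineq4)
      moreover have "norm x \<le> norm x\<^sub>0 + norm (x - x\<^sub>0)" by (rule norm_triangle_sub)
      ultimately show ?thesis
        using M4(2)[OF inT[OF *]] dx M1(1) M2(1) M3(1) \<delta>(1) unfolding M_def by linarith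
    qed
  qed (use a \<delta>(1) b0(1) C y_deriv r_cont \<Psi>_deriv \<Psi>_bound \<psi>_bound \<psi>_cont in auto)
  have inj: "inj_on (\<lambda>p. tk.Y (fst p) (snd p)) ({-a<..<a} \<times> {-\<delta>..\<delta>})"
  proof -
    have "(\<lambda>p. tk.Y (fst p) (snd p)) = (\<lambda>(\<theta>, t). y \<theta> + t *\<^sub>R dir \<theta>)"
      by (auto simp: tk.Y_def)
    then show ?thesis using inj_on_subset[OF inj1, of "{-a<..<a} \<times> {-\<delta>..\<delta>}"] \<delta>(2) by fastforce
  qed
  obtain CD where CD: "0 \<le> CD" "\<And>\<epsilon> z. \<lbrakk>0 < \<epsilon>; \<epsilon> \<le> exp (-1); b0 / 2 \<le> norm z\<rbrakk> \<Longrightarrow>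
      (\<Sum>k\<in>{k::int. \<bar>of_int k * (\<kappa> * \<epsilon>)\<bar> \<le> pi / 2}. 1 / (1 + \<bar>dir (of_int k * (\<kappa> * \<epsilon>)) \<bullet> z\<bar> / \<epsilon>)) \<le> CD * ln (1 / \<epsilon>)"
    by (rule directional_sum_bound[of "b0 / 2" \<kappa>]) (use b0(1) \<kappa> in auto)
  obtain c0 where c0: "\<forall>\<^sub>F \<epsilon> in at_right 0. \<forall>s. \<bar>H \<epsilon> s / \<epsilon>\<bar> \<le> c0"
    using assms(9) unfolding amplitude_bounded_def by blast
  \<comment> \<open>Forced to be positive, as it is divided by in \<open>e0\<close>.\<close>
  define c1 where "c1 = max c0 1"
  obtain CH where CH: "\<forall>\<^sub>F \<epsilon> in at_right 0. \<forall>s. \<forall>h>0. \<bar>H \<epsilon> (s + sqrt \<epsilon> * h) - H \<epsilon> s\<bar> / (\<epsilon> * h powr \<gamma>) \<le> CH"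
    using assms(12) unfolding uniformly_Hoelder_def by blast
  obtain \<rho> L0 where \<rho>: "0 < \<rho>" "0 < L0" and lev: "\<forall>\<^sub>F \<epsilon> in at_right 0. \<forall>\<tau> u L. L0 \<le> L \<longrightarrow>
        finite ({u<..<u + L} \<inter> rescaled H \<epsilon> -` {\<tau>}) \<and>
        real (card ({u<..<u + L} \<inter> rescaled H \<epsilon> -` {\<tau>})) \<le> \<rho> * L"
    using assms(18) unfolding well_behaved_level_sets_def by blast
  \<comment> \<open>The three terms make the logarithmic sum available, keep \<bar>H
    \<epsilon>\<bar> \<le> c1 \<epsilon> below \<delta>, and make the rescaled interval at least
    \<open>L0\<close> long.\<close>
  define e0 where "e0 = min (exp (-1)) (min (\<delta> / c1) ((2 * a / L0)\<^sup>2))"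
  have e0: "0 < e0" using \<delta>(1) a \<rho>(2) by (simp add: e0_def c1_def)
  have ev0: "\<forall>\<^sub>F \<epsilon> in at_right 0. 0 < \<epsilon> \<and> \<epsilon> < e0"
    using e0 by (auto simp: eventually_at_right_field)
  define K where "K = 2 * \<kappa> * c1 * tk.B * CD * (2 + 2 * a + 4 * a * \<rho>) / pi\<^sup>2"
  have "\<forall>\<^sub>F \<epsilon> in at_right 0. \<forall>x\<in>V. \<bar>reconstruction \<kappa> \<phi> w (perturbation a y \<Delta>f (H \<epsilon>)) \<epsilon> x\<bar> \<le> K * (sqrt \<epsilon> * ln (1 / \<epsilon>))"
    using c0 CH lev ev0
  proof eventually_elim
    case (elim \<epsilon>)
    have \<epsilon>: "0 < \<epsilon>" "\<epsilon> \<le> exp (-1)" "\<epsilon> \<le> \<delta> / c1" "\<epsilon> \<le> (2 * a / L0)\<^sup>2"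
      using elim(4) by (auto simp: e0_def)
    have c1: "1 \<le> c1" by (simp add: c1_def)
    have s: "0 < sqrt \<epsilon>" "sqrt \<epsilon> \<le> 1" "\<epsilon> = sqrt \<epsilon> * sqrt \<epsilon>"
    proof -
      have "\<epsilon> \<le> 1" using \<epsilon>(2) order_trans[of \<epsilon> "exp (-1)" 1] by simp
      then show "0 < sqrt \<epsilon>" "sqrt \<epsilon> \<le> 1" "\<epsilon> = sqrt \<epsilon> * sqrt \<epsilon>" using \<epsilon>(1) by auto
    qed
    have ln0: "0 \<le> ln (1 / \<epsilon>)" using s \<epsilon>(1) by (simp add: ln_div)
    define \<tau> where "\<tau> = c1 * \<epsilon>"
    have \<tau>: "0 \<le> \<tau>" "\<tau> \<le> \<delta>" using \<epsilon> c1 by (auto simp: \<tau>_def pos_le_divide_eq mult.commute)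
    have hb: "\<bar>H \<epsilon> s\<bar> \<le> \<tau>" for s
    proof -
      have "\<bar>H \<epsilon> s\<bar> / \<epsilon> \<le> c1" using elim(1)[rule_format, of s] \<epsilon>(1) by (simp add: c1_def)
      then show ?thesis using \<epsilon>(1) by (simp add: \<tau>_def pos_divide_le_eq)
    qed
    have hc: "continuous_on UNIV (H \<epsilon>)"
      by (rule Hoelder_continuous[OF \<epsilon>(1) assms(10), of _ CH]) (use elim(2) in blast)
    define N where "N = \<rho> * (2 * a / sqrt \<epsilon>)"
    have N: "0 \<le> N" using \<rho> a s by (simp add: N_def)
    have L0: "L0 \<le> 2 * a / sqrt \<epsilon>"
    proof -
      have "sqrt \<epsilon> \<le> 2 * a / L0" using \<epsilon>(4) a \<rho>(2) by (intro real_le_lsqrt) auto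
      then show ?thesis using s(1) \<rho>(2) by (simp add: field_simps)
    qed
    have lv: "finite {z\<in>{-a<..<a}. H \<epsilon> z = t}" "real (card {z\<in>{-a<..<a}. H \<epsilon> z = t}) \<le> N" for t
      using rescaled_level_set_card[OF \<epsilon>(1) a, of H N t] elim(3) L0 unfolding N_def by blast+
    show ?case
    proof
      fix x assume x: "x \<in> V"
      define ang where "ang k = of_int k * (\<kappa> * \<epsilon>)" for k :: int
      define I where "I = {k. \<bar>ang k\<bar> \<le> pi / 2}"
      have I: "finite I" unfolding I_def ang_def using \<kappa> \<epsilon>(1) by (intro finite_angles) simp
      let ?f = "perturbation a y \<Delta>f (H \<epsilon>)"
      \<comment> \<open>Transversality also keeps \<open>x\<close> at distance at least
        \<open>b0 / 2\<close> from the tube, as the sum over directions requires.\<close>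
      have S: "(\<Sum>k\<in>I. 1 / (1 + \<bar>dir (ang k) \<bullet> (x - tk.Y \<theta> t)\<bar> / \<epsilon>)) \<le> CD * ln (1 / \<epsilon>)"
        if "\<theta> \<in> {-a..a}" "\<bar>t\<bar> \<le> \<delta>" for \<theta> t
        unfolding I_def ang_def
      proof (rule CD(2)[OF \<epsilon>(1,2)])
        have "\<bar>(x - tk.Y \<theta> t) \<bullet> dir \<theta>\<bar> \<le> norm (x - tk.Y \<theta> t)"
          using dir_inner_le[of \<theta> "x - tk.Y \<theta> t"] by (simp add: inner_commute)
        then show "b0 / 2 \<le> norm (x - tk.Y \<theta> t)"
          using tk.transversal[OF x that] unfolding tk.Y_def by linarith
      qed
      have S0: "0 \<le> CD * ln (1 / \<epsilon>)" using CD(1) ln0 by simp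
      let ?I = "\<lambda>k. LINT v|lborel. \<psi> (dir (ang k) \<bullet> x / \<epsilon>) (dir (ang k) \<bullet> v / \<epsilon>) * ?f v"
      define Z where "Z = (\<Sum>k\<in>I. ?I k)"
      have Z: "\<bar>Z\<bar> \<le> 2 * (2 * \<tau> * (\<epsilon> * (tk.B * (CD * ln (1 / \<epsilon>)) * (2 + 2 * N + 2 * a))))"
        unfolding Z_def by (rule tk.perturbation_bound[OF x \<epsilon>(1) I \<tau> S S0 hc hb N lv inj])
      have fi: "integrable lborel ?f" by (rule tk.perturbation_integrable[OF hc hb \<tau>(2) inj])
      have fs: "norm v \<le> M4" if "?f v \<noteq> 0" for v
      proof -
        have "v \<in> tk.tube" by (rule tk.perturbation_support[of "H \<epsilon>" \<tau>, OF hb \<tau>(2) that])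
        then show ?thesis by (intro M4(2)) (simp add: tk.tube_def T_def tk.Y_def)
      qed
      have pvk: "pv_integral (deriv (interpolated_data \<phi> w ?f \<epsilon> \<alpha>)) (dir \<alpha> \<bullet> x)
          = 1 / \<epsilon>\<^sup>2 * (LINT v|lborel. \<psi> (dir \<alpha> \<bullet> x / \<epsilon>) (dir \<alpha> \<bullet> v / \<epsilon>) * ?f v)" for \<alpha>
        by (rule pv[OF \<epsilon>(1) fi fs])
      have "reconstruction \<kappa> \<phi> w ?f \<epsilon> x = - (\<kappa> * \<epsilon> / (2 * pi)) * (\<Sum>k\<in>I. 1 / pi * (1 / \<epsilon>\<^sup>2 * ?I k))"
        unfolding reconstruction_def Let_def ang_def[symmetric] I_def[symmetric]
        by (simp only: pvk)
      also have "\<dots> = - (\<kappa> * \<epsilon> / (2 * pi)) * (1 / pi * (1 / \<epsilon>\<^sup>2 * Z))"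
        by (simp only: Z_def sum_distrib_left)
      also have "\<dots> = - (\<kappa> / (2 * pi\<^sup>2 * \<epsilon>)) * Z"
        using \<epsilon>(1) by (simp add: field_simps power2_eq_square)
      finally have rec: "reconstruction \<kappa> \<phi> w ?f \<epsilon> x = - (\<kappa> / (2 * pi\<^sup>2 * \<epsilon>)) * Z" .
      have "\<bar>reconstruction \<kappa> \<phi> w ?f \<epsilon> x\<bar> = \<kappa> / (2 * pi\<^sup>2 * \<epsilon>) * \<bar>Z\<bar>"
        using \<kappa> \<epsilon>(1) unfolding rec by (simp add: abs_mult)
      also have "\<dots> \<le> \<kappa> / (2 * pi\<^sup>2 * \<epsilon>) * (2 * (2 * \<tau> * (\<epsilon> * (tk.B * (CD * ln (1 / \<epsilon>)) * (2 + 2 * N + 2 * a)))))"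
        using \<kappa> \<epsilon>(1) by (intro mult_left_mono Z) auto
      also have "\<dots> = 2 * \<kappa> * c1 * tk.B * CD / pi\<^sup>2 * ln (1 / \<epsilon>) * (\<epsilon> * (2 + 2 * N + 2 * a))"
        using \<epsilon>(1) unfolding \<tau>_def by (simp add: divide_simps)
      also have "\<dots> \<le> 2 * \<kappa> * c1 * tk.B * CD / pi\<^sup>2 * ln (1 / \<epsilon>) * (sqrt \<epsilon> * (2 + 2 * a + 4 * a * \<rho>))"
      \<comment> \<open>The endpoint count decides the order: \<epsilon> N is exactly of order sqrt
        \<epsilon>, and the other terms are of order \<epsilon>.\<close>
      proof (rule mult_left_mono)
        have "\<epsilon> * N = sqrt \<epsilon> * (2 * a * \<rho>)"
        proof -
          have "\<epsilon> * N = (sqrt \<epsilon> * sqrt \<epsilon>) * (\<rho> * (2 * a / sqrt \<epsilon>))" using s(3) by (simp add: N_def)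
          also have "\<dots> = sqrt \<epsilon> * (2 * a * \<rho>)"
          proof -
            have "(q * q) * (\<rho> * (2 * a / q)) = q * (2 * a * \<rho>)" if "0 < q" for q :: real
              using that by simp
            then show ?thesis using s(1) by blast
          qed
          finally show ?thesis .
        qed
        moreover have "\<epsilon> * (2 + 2 * a) \<le> sqrt \<epsilon> * (2 + 2 * a)"
        proof (rule mult_right_mono)
          have "sqrt \<epsilon> * sqrt \<epsilon> \<le> sqrt \<epsilon> * 1" using s by (intro mult_left_mono) auto
          then show "\<epsilon> \<le> sqrt \<epsilon>" using s(3) by simp
        qed (use a in simp)
        ultimately show "\<epsilon> * (2 + 2 * N + 2 * a) \<le> sqrt \<epsilon> * (2 + 2 * a + 4 * a * \<rho>)"
          by (simp add: algebra_simps)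
        show "0 \<le> 2 * \<kappa> * c1 * tk.B * CD / pi\<^sup>2 * ln (1 / \<epsilon>)"
          using \<kappa> c1 tk.B_nonneg CD(1) ln0 by (intro mult_nonneg_nonneg divide_nonneg_nonneg) auto
      qed
      also have "\<dots> = K * (sqrt \<epsilon> * ln (1 / \<epsilon>))" by (simp add: K_def)
      finally show "\<bar>reconstruction \<kappa> \<phi> w ?f \<epsilon> x\<bar> \<le> K * (sqrt \<epsilon> * ln (1 / \<epsilon>))" .
    qed
  qed
  moreover have "open V" "x\<^sub>0 \<in> V" using b0(1) by (auto simp: V_def)
  ultimately show ?thesis by blast
qed

end
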